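(* (Graphical Kazhdan–Lusztig basis.) For all $v,w\in W^{\mathfrak p}$ the parabolic Kazhdan–Lusztig polynomial is $$n_{v,w}=\begin{cases}q^{\operatorname{cl}(vC(w))/2}&\text{if } vC(w)\text{ is oriented},\\ 0&\text{otherwise;}\end{cases}$$ equivalently $\underline N_w=\sum_{v\in W^{\mathfrak p},\ vC(w)\text{ oriented}} q^{\operatorname{cl}(vC(w))/2}N_v$.
   Context: Let $n\ge 4$ and let $W$ be the Weyl group of type $D_n$: the Coxeter group on generators $S=\{s_0,\dots,s_{n-1}\}$ with $(s_is_j)^{m_{ij}}=e$, where $m_{ii}=1$, $m_{02}=m_{12}=3$, $m_{i,i+1}=3$ for $2\le i\le n-2$, and $m_{ij}=2$ otherwise. Let $l$ be the length, $S_{\mathfrak p}=\{s_1,\dots,s_{n-1}\}$, $W_{\mathfrak p}=\langle S_{\mathfrak p}\rangle$, and $W^{\mathfrak p}=\{w\in W\mid l(sw)>l(w)\ \forall s\in S_{\mathfrak p}\}$. Sequences: $W$ acts on the right on $\{+,-\}^n$: $s_i$ ($1\le i\le n-1$) swaps entries $i,i+1$; $s_0$ sends $(a_1,a_2,a_3,\dots)$ to $(-a_2,-a_1,a_3,\dots)$. For $w\in W^{\mathfrak p}$ let $(\alpha_1,\dots,\alpha_n)=(+,\dots,+)\cdot w$, $\alpha_{-i}=-\alpha_i$. On $P=\{-2n,\dots,-1,1,\dots,2n\}\subset\mathbb R$ the extended labeling of $w$ puts $+$ at $j<-n$, $-$ at $j>n$, $\alpha_j$ at $1\le|j|\le n$;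 the weight $\lambda(w)$ is this labeling with $+$ replaced by $\downarrow$ and $-$ by $\uparrow$. Cup diagram $C(w)$: take the unique set of $2n$ non-intersecting arcs in the lower half plane matching the points of $P$ in pairs, each arc joining a $+$ point to a $-$ point lying to its right. The arcs joining a negative to a positive point have the form $(-y,y)$; list them $y_1<\dots<y_{2k}$ (their number is even). For each $j$ replace $(-y_{2j-1},y_{2j-1})$, $(-y_{2j},y_{2j})$ by the arcs joining $-y_{2j}$ to $y_{2j-1}$ and $-y_{2j-1}$ to $y_{2j}$ (a linked pair). The resulting arcs are called cups. For $v,w\in W^{\mathfrak p}$, $vC(w)$ is $C(w)$ with the points labeled by $\lambda(v)$. A cup is oriented if one endpoint is labeled $\uparrow$ and the other $\downarrow$ (linked cups are treated as ordinary cups); $vC(w)$ is oriented if all cups are; then $\operatorname{cl}(vC(w))$ is the number of cups whose left endpoint is $\uparrow$ and right endpoint is $\downarrow$. Hecke module: $\mathcal L=\mathbb Z[q,q^{-1}]$; $\mathcal H$ the Hecke algebra of $W$, free over $\mathcal L$ on $H_w$ ($w\in W$) with $H_xH_y=H_{xy}$ if $l(xy)=l(x)+l(y)$ and $H_s^2=(q^{-1}-q)H_s+H_e$; $C_s=H_s+q$. $\mathcal H_{\mathfrak p}$ is the subalgebra spanned by $H_w$, $w\in W_{\mathfrak p}$; $\mathcal L$ is a right $\mathcal H_{\mathfrak p}$-module with $C_s$ acting by $0$ for $s\in S_{\mathfrak p}$. $\mathcal N=\mathcal L\otimes_{\mathcal H_{\mathfrak p}}\mathcal H$ has basis $N_w=1\otimes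 H_w$, $w\in W^{\mathfrak p}$. The involution $H_w\mapsto H_{w^{-1}}^{-1}$, $q\mapsto q^{-1}$ induces an involution of $\mathcal N$; the Kazhdan–Lusztig basis $\underline N_w$ ($w\in W^{\mathfrak p}$) is the unique basis of fixed elements with $\underline N_w\in N_w+\sum_{w'\ne w}q\mathbb Z[q]N_{w'}$, and $n_{w',w}$ is defined by $\underline N_w=\sum_{w'}n_{w',w}N_{w'}$. *)

theory Defs
  imports Main "HOL-Library.Poly_Mapping"
begin

type_synonym laur = "int \<Rightarrow>\<^sub>0 int"  (* coefficient of q^k is Poly_Mapping.lookup f k *)

definition qpow :: "int \<Rightarrow> laur" where "qpow k = Poly_Mapping.single k 1"
definition qq :: laur where "qq = qpow 1"
definition qinv :: laur where "qinv = qpow (-1)"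

definition barL :: "laur \<Rightarrow> laur" where
  "barL f = Abs_poly_mapping (\<lambda>k. Poly_Mapping.lookup f (- k))"

definition in_qZq :: "laur \<Rightarrow> bool" where
  "in_qZq f \<longleftrightarrow> (\<forall>k. Poly_Mapping.lookup f k \<noteq> 0 \<longrightarrow> k > 0)"

section \<open>The Weyl group of type D_n, realised by signed permutations of {-n..-1,1..n}\<close>

type_synonym sperm = "int \<Rightarrow> int"

text \<open>Generators s_0,...,s_{n-1}.  The product xy of the group is the composition x o y,
  and sequences are acted upon on the right by (a.w)_j = a_{w(j)} (with a_{-i} = -a_i).\<close>
definition gen :: "nat \<Rightarrow> sperm" where
  "gen i = (if i = 0 then
      (\<lambda>x. if x = 1 then -2 else if x = 2 then -1 else if x = -1 then 2
           else if x = -2 then 1 else x)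
    else
      (\<lambda>x. if x = int i then int i + 1 else if x = int i + 1 then int i
           else if x = - int i then - int i - 1 else if x = - int i - 1 then - int i else x))"

definition word_prod :: "nat list \<Rightarrow> sperm" where
  "word_prod ws = foldr (\<lambda>i f. gen i \<circ> f) ws id"

definition is_word :: "nat \<Rightarrow> nat list \<Rightarrow> bool" where
  "is_word n ws \<longleftrightarrow> set ws \<subseteq> {..<n}"

definition W :: "nat \<Rightarrow> sperm set" where
  "W n = {word_prod ws | ws. is_word n ws}"

definition len :: "nat \<Rightarrow> sperm \<Rightarrow> nat" where
  "len n w = (LEAST k. \<exists>ws. is_word n ws \<and> length ws = k \<and> word_prod ws = w)"

text \<open>S_p = {s_1,...,s_{n-1}};  W^p = minimal length representatives of W_p \ W\<close>
definition Wp :: "nat \<Rightarrow> sperm set" where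
  "Wp n = {w \<in> W n. \<forall>i\<in>{1..<n}. len n (gen i \<circ> w) > len n w}"

type_synonym hecke = "sperm \<Rightarrow> laur"

definition Hset :: "nat \<Rightarrow> hecke set" where
  "Hset n = {h. \<forall>x. x \<notin> W n \<longrightarrow> h x = 0}"

definition Hb :: "sperm \<Rightarrow> hecke" where
  "Hb w = (\<lambda>x. if x = w then 1 else 0)"

definition hadd :: "hecke \<Rightarrow> hecke \<Rightarrow> hecke" where
  "hadd h g = (\<lambda>x. h x + g x)"

definition hsmult :: "laur \<Rightarrow> hecke \<Rightarrow> hecke" where
  "hsmult c h = (\<lambda>x. c * h x)"

definition hsum :: "('a \<Rightarrow> hecke) \<Rightarrow> 'a set \<Rightarrow> hecke" where
  "hsum f A = (\<lambda>x. \<Sum>a\<in>A. f a x)"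

text \<open>right multiplication by H_s (s = gen i):
  H_w H_s = H_{ws} if l(ws) > l(w), and H_{ws} + (q^-1 - q) H_w otherwise\<close>
definition mulHs :: "nat \<Rightarrow> hecke \<Rightarrow> nat \<Rightarrow> hecke" where
  "mulHs n h i = (\<lambda>y. if y \<in> W n then
      h (y \<circ> gen i) + (if len n (y \<circ> gen i) < len n y then (qinv - qq) * h y else 0)
    else 0)"

definition red_word :: "nat \<Rightarrow> sperm \<Rightarrow> nat list" where
  "red_word n x = (SOME ws. is_word n ws \<and> word_prod ws = x \<and> length ws = len n x)"

definition mulH :: "nat \<Rightarrow> hecke \<Rightarrow> sperm \<Rightarrow> hecke" where
  "mulH n h x = foldl (mulHs n) h (red_word n x)"

definition hmul :: "nat \<Rightarrow> hecke \<Rightarrow> hecke \<Rightarrow> hecke" where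
  "hmul n h g = hsum (\<lambda>x. hsmult (g x) (mulH n h x)) (W n)"

definition hinv :: "nat \<Rightarrow> hecke \<Rightarrow> hecke" where
  "hinv n h = (THE g. g \<in> Hset n \<and> hmul n h g = Hb id \<and> hmul n g h = Hb id)"

definition hbar :: "nat \<Rightarrow> hecke \<Rightarrow> hecke" where
  "hbar n h = hsum (\<lambda>w. hsmult (barL (h w)) (hinv n (Hb (inv w)))) (W n)"

definition Cs :: "nat \<Rightarrow> hecke" where
  "Cs i = hadd (Hb (gen i)) (hsmult qq (Hb id))"

section \<open>The parabolic module N = L \<otimes>_{H_p} H,  realised as H / (sum_{s in S_p} C_s H)\<close>

definition Iker :: "nat \<Rightarrow> hecke set" where
  "Iker n = {hsum (\<lambda>i. hmul n (Cs i) (g i)) {1..<n} | g. \<forall>i. g i \<in> Hset n}"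

definition Nclass :: "nat \<Rightarrow> hecke \<Rightarrow> hecke set" where
  "Nclass n h = {g \<in> Hset n. (\<lambda>x. h x - g x) \<in> Iker n}"

definition Nmod :: "nat \<Rightarrow> hecke set set" where
  "Nmod n = Nclass n ` Hset n"

definition Nbar :: "nat \<Rightarrow> hecke set \<Rightarrow> hecke set" where
  "Nbar n X = Nclass n (hbar n (SOME h. h \<in> X))"

definition Ncomb :: "nat \<Rightarrow> (sperm \<Rightarrow> laur) \<Rightarrow> hecke set" where
  "Ncomb n c = Nclass n (hsum (\<lambda>v. hsmult (c v) (Hb v)) (Wp n))"

definition coeffs_on :: "nat \<Rightarrow> (sperm \<Rightarrow> laur) \<Rightarrow> bool" where
  "coeffs_on n c \<longleftrightarrow> (\<forall>v. v \<notin> Wp n \<longrightarrow> c v = 0)"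

definition KLN :: "nat \<Rightarrow> sperm \<Rightarrow> hecke set" where
  "KLN n w = (THE X. X \<in> Nmod n \<and> Nbar n X = X \<and>
      (\<exists>c. coeffs_on n c \<and> c w = 1 \<and> (\<forall>v\<in>Wp n. v \<noteq> w \<longrightarrow> in_qZq (c v)) \<and> X = Ncomb n c))"

definition nKL :: "nat \<Rightarrow> sperm \<Rightarrow> sperm \<Rightarrow> laur" where
  "nKL n v w = (THE c. coeffs_on n c \<and> KLN n w = Ncomb n c) v"

text \<open>signs: True = +, False = -;  extension a_{-i} = -a_i\<close>
definition ext_sign :: "(int \<Rightarrow> bool) \<Rightarrow> int \<Rightarrow> bool" where
  "ext_sign a k = (if k > 0 then a k else \<not> a (- k))"

definition act :: "(int \<Rightarrow> bool) \<Rightarrow> sperm \<Rightarrow> int \<Rightarrow> bool" where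
  "act a w j = ext_sign a (w j)"

definition alpha :: "sperm \<Rightarrow> int \<Rightarrow> bool" where
  "alpha w j = ext_sign (act (\<lambda>_. True) w) j"

definition Pts :: "nat \<Rightarrow> int set" where
  "Pts n = {- 2 * int n .. -1} \<union> {1 .. 2 * int n}"

text \<open>extended labeling (True = +, False = -); for the weight lambda(w), + is \<down> and - is \<up>\<close>
definition elab :: "nat \<Rightarrow> sperm \<Rightarrow> int \<Rightarrow> bool" where
  "elab n w j = (if j < - int n then True else if j > int n then False else alpha w j)"

definition arcs :: "nat \<Rightarrow> sperm \<Rightarrow> (int \<times> int) set" where
  "arcs n w = (THE A.
      (\<forall>(a,b)\<in>A. a \<in> Pts n \<and> b \<in> Pts n \<and> a < b \<and> elab n w a \<and> \<not> elab n w b) \<and>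
      (\<forall>j\<in>Pts n. \<exists>!p. p \<in> A \<and> (fst p = j \<or> snd p = j)) \<and>
      (\<forall>(a,b)\<in>A. \<forall>(c,d)\<in>A. \<not> (a < c \<and> c < b \<and> b < d)))"

definition sym_ys :: "nat \<Rightarrow> sperm \<Rightarrow> int list" where
  "sym_ys n w = sorted_list_of_set {y. y > 0 \<and> (- y, y) \<in> arcs n w}"

definition partner :: "nat \<Rightarrow> nat" where
  "partner i = (if even i then i + 1 else i - 1)"

definition cups :: "nat \<Rightarrow> sperm \<Rightarrow> (int \<times> int) set" where
  "cups n w = (arcs n w - {(- y, y) | y. y \<in> set (sym_ys n w)})
      \<union> {(- (sym_ys n w ! partner i), sym_ys n w ! i) | i. i < length (sym_ys n w)}"

definition oriented :: "nat \<Rightarrow> sperm \<Rightarrow> sperm \<Rightarrow> bool" where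
  "oriented n v w \<longleftrightarrow> (\<forall>(a,b)\<in>cups n w. elab n v a \<noteq> elab n v b)"

definition cl :: "nat \<Rightarrow> sperm \<Rightarrow> sperm \<Rightarrow> nat" where
  "cl n v w = card {(a,b) \<in> cups n w. \<not> elab n v a \<and> elab n v b}"

end

theory Submission
  imports Defs "HOL-Library.FuncSet"
begin

text \<open>Folding the symmetric diagram $C(w)$ at the origin gives an involution $\pi$ of
  $\{1, \dots, 2n\}$. All cups of $C(w)$ are anticlockwise for $w$ itself, so $vC(w)$ is oriented iff
  the set $D$ of positions where the signs of $v$ and $w$ differ is closed under $\pi$, and
  $\mathrm{cl}(vC(w)) = |D|$. For $ws > w$ in $W^{\mathfrak p}$ the involution of $ws$ arises from that of $w$
  by joining the two points exchanged by $s$ and joining their former partners. Comparing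
  coefficients, the graphical element of $ws$ is that of $w$ times $C_s$, hence it is fixed by the
  bar involution, and Kazhdan--Lusztig uniqueness applies.\<close>

section \<open>Signed permutations and lengths\<close>

text \<open>What shapes the proof is the concrete model: \<open>mulH\<close> picks an arbitrary
  reduced word, \<open>hinv\<close>, \<open>KLN\<close> and \<open>nKL\<close> are definite
  descriptions, and N is a quotient of H by a right ideal. Products are controlled by one fact: left
  and right multiplications by generators commute, so a linear operator commuting with the left ones
  is known from its value at H_e. Coefficients in N are read off by functionals: H_s acts on the
  left by -q in the quotient, so 1 \<otimes> H_x = (-q)^(l(x)-l(v)) N_v for the minimal v in the
  coset W_p x, and this coset consists of the elements with the sign pattern of x. Multiplying a
  graphical element by C_s needs no correction terms for the following reason. Let D be a difference
  set avoiding the two exchanged points p, r. It is closed under the new involution iff one of D and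
  D with p, r added was closed under the old one, and these two cases exclude each other. So every
  new coefficient comes from a single old monomial, and the constant term 1 occurs only for D
  empty.\<close>

definition lo :: "nat \<Rightarrow> int" where "lo i = (if i = 0 then -1 else int i)"
definition hi :: "nat \<Rightarrow> int" where "hi i = (if i = 0 then 2 else int i + 1)"

lemma lo_hi: "lo i < hi i" "hi i > 0" "lo i \<noteq> 0" "- hi i < lo i" "hi i \<noteq> 1"
  by (auto simp: lo_def hi_def)

text \<open>The choice \<open>lo 0 = -1\<close>, \<open>hi 0 = 2\<close> puts s_0 on the same
  footing as the other generators: each is the reflection swapping \<open>lo i\<close> and
  \<open>hi i\<close> and, by oddness, their negatives. Descents then have the uniform form
  \<open>x (hi i) < x (lo i)\<close>.\<close>

lemma gen_eq: "gen i x = (if x = lo i then hi i else if x = hi i then lo i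
    else if x = - lo i then - hi i else if x = - hi i then - lo i else x)"
  by (auto simp: gen_def lo_def hi_def)

lemma gen_lo [simp]: "gen i (lo i) = hi i" and gen_hi [simp]: "gen i (hi i) = lo i"
  using lo_hi[of i] by (auto simp: gen_eq)

lemma gen_minus [simp]: "gen i (- x) = - gen i x"
  using lo_hi[of i] by (auto simp: gen_eq)

lemma gen_gen [simp]: "gen i (gen i x) = x"
  using lo_hi[of i] by (auto simp: gen_eq)

lemma gen_comp_gen [simp]: "gen i \<circ> gen i = id"
  by auto

lemma comp_gen_gen [simp]: "x \<circ> gen i \<circ> gen i = x" and gen_gen_comp [simp]: "gen i \<circ> (gen i \<circ> x) = x"
  by auto

lemma bij_gen: "bij (gen i)"
  by (rule o_bij[of "gen i"]) auto

lemma inv_gen [simp]: "inv (gen i) = gen i"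
  by (rule inv_unique_comp) auto

lemma gen_eq_0_iff [simp]: "gen i x = 0 \<longleftrightarrow> x = 0"
  using lo_hi[of i] by (auto simp: gen_eq)

text \<open>A simple reflection permutes the positive roots other than its own. Its own root has two
  encodings as an ordered pair, \<open>(lo i, hi i)\<close> and the mirror image
  \<open>(- hi i, - lo i)\<close>.\<close>

lemma gen_less:
  assumes "p < r" "p \<noteq> 0" "r \<noteq> 0" "p \<noteq> - r" "(p, r) \<noteq> (lo i, hi i)" "(p, r) \<noteq> (- hi i, - lo i)"
  shows "gen i p < gen i r"
proof (cases "i = 0")
  case True
  have "lo i = -1" "hi i = 2" using True by (auto simp: lo_def hi_def)
  then show ?thesis using assms unfolding gen_eq by (smt (verit))
next
  case False
  then have "hi i = lo i + 1" "lo i > 0" by (auto simp: lo_def hi_def)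
  then show ?thesis using assms unfolding gen_eq by (smt (verit))
qed

lemma word_prod_Nil [simp]: "word_prod [] = id"
  and word_prod_Cons [simp]: "word_prod (i # ws) = gen i \<circ> word_prod ws"
  by (auto simp: word_prod_def)

lemma word_prod_append [simp]: "word_prod (us @ ws) = word_prod us \<circ> word_prod ws"
  by (induction us) (auto simp: o_assoc)

lemma word_prod_snoc: "word_prod (ws @ [i]) = word_prod ws \<circ> gen i"
  by (simp add: fun_eq_iff)

lemma is_word_simps [simp]:
  "is_word n []"
  "is_word n (i # ws) \<longleftrightarrow> i < n \<and> is_word n ws"
  "is_word n (us @ ws) \<longleftrightarrow> is_word n us \<and> is_word n ws"
  "is_word n (rev ws) \<longleftrightarrow> is_word n ws"
  by (auto simp: is_word_def)

lemma word_prod_rev: "word_prod (rev ws) \<circ> word_prod ws = id" "word_prod ws \<circ> word_prod (rev ws) = id"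
proof (induction ws)
  case (Cons i ws)
  show "word_prod (rev (i # ws)) \<circ> word_prod (i # ws) = id"
    using Cons(1) by (simp add: fun_eq_iff)
  show "word_prod (i # ws) \<circ> word_prod (rev (i # ws)) = id"
    using Cons(2) by (simp add: fun_eq_iff)
qed auto

lemma inv_word_prod: "inv (word_prod ws) = word_prod (rev ws)"
  by (rule inv_unique_comp) (rule word_prod_rev)+

lemma W_iff: "x \<in> W n \<longleftrightarrow> (\<exists>ws. is_word n ws \<and> word_prod ws = x)"
  by (auto simp: W_def)

lemma word_prod_W: "is_word n ws \<Longrightarrow> word_prod ws \<in> W n"
  by (auto simp: W_def)

lemma id_W [simp]: "id \<in> W n"
  by (metis is_word_simps(1) word_prod_Nil word_prod_W)

lemma comp_W: "x \<in> W n \<Longrightarrow> y \<in> W n \<Longrightarrow> x \<circ> y \<in> W n"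
  unfolding W_iff by (metis is_word_simps(3) word_prod_append)

lemma gen_W: "i < n \<Longrightarrow> gen i \<in> W n"
  using word_prod_W[of n "[i]"] by simp

lemma inv_W: "x \<in> W n \<Longrightarrow> inv x \<in> W n"
  unfolding W_iff by (metis is_word_simps(4) inv_word_prod)

lemma comp_gen_W_iff: "i < n \<Longrightarrow> x \<circ> gen i \<in> W n \<longleftrightarrow> x \<in> W n"
  by (metis comp_W gen_W comp_gen_gen)

lemma gen_comp_W_iff: "i < n \<Longrightarrow> gen i \<circ> x \<in> W n \<longleftrightarrow> x \<in> W n"
  by (metis comp_W gen_W gen_gen_comp)

lemma W_induct [consumes 1, case_names id gen]:
  assumes "x \<in> W n" "P id" "\<And>x i. x \<in> W n \<Longrightarrow> P x \<Longrightarrow> i < n \<Longrightarrow> P (x \<circ> gen i)"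
  shows "P x"
proof -
  obtain ws where "is_word n ws" "word_prod ws = x" using assms(1) by (auto simp: W_iff)
  then show ?thesis
  proof (induction ws arbitrary: x rule: rev_induct)
    case (snoc i ws)
    have "P (word_prod ws \<circ> gen i)" using snoc by (intro assms(3)) (auto simp: word_prod_W)
    then show ?case using snoc(3) by (simp only: word_prod_snoc)
  qed (use assms in auto)
qed

lemma W_bij: "x \<in> W n \<Longrightarrow> bij x"
  by (induction rule: W_induct) (blast intro: bij_id bij_comp bij_gen)+

lemma W_inj: "x \<in> W n \<Longrightarrow> x a = x b \<longleftrightarrow> a = b"
  using W_bij bij_is_inj by (metis inj_eq)

lemma W_minus: "x \<in> W n \<Longrightarrow> x (- j) = - x j"
  by (induction arbitrary: j rule: W_induct) auto

lemma W_0: "x \<in> W n \<Longrightarrow> x 0 = 0"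
  using W_minus[of x n 0] by simp

lemma W_eq_0_iff: "x \<in> W n \<Longrightarrow> x j = 0 \<longleftrightarrow> j = 0"
  using W_0 W_inj by metis

lemma W_inv_apply: "x \<in> W n \<Longrightarrow> inv x (x j) = j" "x \<in> W n \<Longrightarrow> x (inv x j) = j"
  using W_bij by (auto simp: bij_is_inj bij_is_surj surj_f_inv_f)

lemma inv_comp_gen: "x \<in> W n \<Longrightarrow> inv (x \<circ> gen i) = gen i \<circ> inv x"
  using o_inv_distrib[OF W_bij bij_gen] by simp

lemma inv_gen_comp: "x \<in> W n \<Longrightarrow> inv (gen i \<circ> x) = inv x \<circ> gen i"
  using o_inv_distrib[OF bij_gen W_bij] by simp

lemma inv_inv_W: "x \<in> W n \<Longrightarrow> inv (inv x) = x"
  using W_bij inv_inv_eq by blast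

lemma card_eq_by_involution:
  fixes g :: "'a \<Rightarrow> 'a"
  assumes "\<And>z. g (g z) = z" "\<And>z. z \<in> A \<Longrightarrow> g z \<in> B" "\<And>z. z \<in> B \<Longrightarrow> g z \<in> A"
  shows "card A = card B"
  by (rule bij_betw_same_card[of g], rule bij_betwI[of g _ _ g]) (use assms in auto)

section \<open>Inversions and the length function\<close>

locale type_D =
  fixes n :: nat
  assumes n_ge_2: "2 \<le> n"
begin

lemma lo_hi_le: "i < n \<Longrightarrow> \<bar>lo i\<bar> \<le> int n" "i < n \<Longrightarrow> hi i \<le> int n"
  using n_ge_2 by (auto simp: lo_def hi_def)

lemma gen_abs_le: "i < n \<Longrightarrow> \<bar>gen i j\<bar> \<le> int n \<longleftrightarrow> \<bar>j\<bar> \<le> int n"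
  using lo_hi_le[of i] lo_hi[of i] by (auto simp: gen_eq)

lemma gen_fix: "i < n \<Longrightarrow> int n < \<bar>j\<bar> \<Longrightarrow> gen i j = j"
  using lo_hi_le[of i] lo_hi[of i] by (auto simp: gen_eq)

lemma W_fix: "x \<in> W n \<Longrightarrow> int n < \<bar>j\<bar> \<Longrightarrow> x j = j"
  by (induction arbitrary: j rule: W_induct) (auto simp: gen_fix)

lemma W_abs_le: "x \<in> W n \<Longrightarrow> \<bar>x j\<bar> \<le> int n \<longleftrightarrow> \<bar>j\<bar> \<le> int n"
  by (induction arbitrary: j rule: W_induct) (auto simp: gen_abs_le)

lemma W_eqI:
  assumes "x \<in> W n" "y \<in> W n" "\<And>j. 1 \<le> j \<Longrightarrow> j \<le> int n \<Longrightarrow> x j = y j"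
  shows "x = y"
proof
  fix j
  consider "\<bar>j\<bar> > int n" | "j = 0" | "1 \<le> j" "j \<le> int n" | "1 \<le> -j" "-j \<le> int n" by linarith
  then show "x j = y j"
    using assms W_fix[of x j] W_fix[of y j] W_0[of x] W_0[of y] W_minus[of x n j] W_minus[of y n j]
    by cases auto
qed

lemma finite_W: "finite (W n)"
proof (rule inj_on_finite)
  show "inj_on (\<lambda>x. restrict x {- int n..int n}) (W n)"
  proof (rule inj_onI)
    fix x y assume "x \<in> W n" "y \<in> W n" and eq: "restrict x {- int n..int n} = restrict y {- int n..int n}"
    moreover have "x j = y j" if "1 \<le> j" "j \<le> int n" for j
      using fun_cong[OF eq, of j] that by simp
    ultimately show "x = y" by (intro W_eqI)
  qed
  show "(\<lambda>x. restrict x {- int n..int n}) ` W n \<subseteq> {- int n..int n} \<rightarrow>\<^sub>E {- int n..int n}"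
  proof (intro image_subsetI restrict_PiE_iff[THEN iffD2] ballI)
    fix x j assume "x \<in> W n" "j \<in> {- int n..int n}"
    then show "x j \<in> {- int n..int n}" using W_abs_le[of x j] by auto
  qed
qed (auto intro: finite_PiE)

text \<open>Positive roots of type D. Each is listed twice, as \<open>(p, r)\<close> and as
  \<open>(- r, - p)\<close>, which is why inversion counts are twice the length; the condition
  \<open>p \<noteq> - r\<close> leaves out the roots that type B would add.\<close>

definition roots :: "(int \<times> int) set" where
  "roots = {(p, r). p < r \<and> p \<noteq> 0 \<and> r \<noteq> 0 \<and> p \<noteq> - r \<and> \<bar>p\<bar> \<le> int n \<and> \<bar>r\<bar> \<le> int n}"

definition inversions :: "sperm \<Rightarrow> (int \<times> int) set" where
  "inversions x = {(p, r) \<in> roots. x r < x p}"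

lemma finite_inversions: "finite (inversions x)"
proof (rule finite_subset)
  show "inversions x \<subseteq> {- int n..int n} \<times> {- int n..int n}"
    by (auto simp: inversions_def roots_def)
qed simp

lemma inversions_id: "inversions id = {}"
  by (auto simp: inversions_def roots_def)

text \<open>Applying \<open>gen i\<close> to both components matches the inversions of
  \<open>x\<close> with those of \<open>x \<circ> gen i\<close>, apart from the two pairs encoding
  the root of \<open>gen i\<close>; these are inversions of \<open>x \<circ> gen i\<close>
  only.\<close>

lemma card_inversions_gen:
  assumes "x \<in> W n" "i < n" "x (lo i) < x (hi i)"
  shows "card (inversions (x \<circ> gen i)) = card (inversions x) + 2"
proof -
  define two where "two = {(lo i, hi i), (- hi i, - lo i)}"
  define g where "g = (\<lambda>(p, r). (gen i p, gen i r))"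
  have gg: "g (g z) = z" for z by (auto simp: g_def split: prod.splits)
  have gr: "g z \<in> roots - two" if "z \<in> roots - two" for z
  proof -
    obtain p r where z: "z = (p, r)" by force
    have "gen i p < gen i r" using that gen_less[of p r i] by (auto simp: z roots_def two_def)
    moreover have "(gen i p, gen i r) \<notin> two"
      using that \<open>gen i p < gen i r\<close> lo_hi[of i]
      by (auto simp: z two_def roots_def gen_eq split: if_splits)
    moreover have "gen i p \<noteq> - gen i r"
      using that by (metis (mono_tags, lifting) gen_gen gen_minus DiffD1 roots_def case_prodD mem_Collect_eq z)
    ultimately show ?thesis using that assms(2) by (auto simp: z g_def roots_def gen_abs_le)
  qed
  have "card (inversions x - two) = card (inversions (x \<circ> gen i) - two)"
    by (rule card_eq_by_involution[of g])
       (use gg gr in \<open>force simp: inversions_def g_def split: prod.splits\<close>)+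
  moreover have "inversions x \<inter> two = {}"
    using assms(3) by (auto simp: inversions_def two_def W_minus[OF assms(1)])
  then have "inversions x - two = inversions x" by auto
  moreover have sub: "two \<subseteq> inversions (x \<circ> gen i)"
    using assms lo_hi[of i] lo_hi_le[of i]
    by (auto simp: inversions_def two_def roots_def W_minus[OF assms(1)] abs_le_iff)
  moreover have "card two = 2" using lo_hi[of i] by (auto simp: two_def)
  ultimately show ?thesis
    using card_Diff_subset[OF _ sub] card_mono[OF finite_inversions sub]
    by (simp add: two_def)
qed

lemma card_inversions_gen':
  assumes "x \<in> W n" "i < n" "x (hi i) < x (lo i)"
  shows "card (inversions x) = card (inversions (x \<circ> gen i)) + 2"
  using card_inversions_gen[of "x \<circ> gen i" i] assms by (simp add: comp_gen_W_iff)

lemma W_lo_neq_hi: "x \<in> W n \<Longrightarrow> x (lo i) \<noteq> x (hi i)"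
  using lo_hi[of i] by (simp add: W_inj)

text \<open>An element makes an even number of sign changes: s_0 contributes two, the other
  generators only permute positions.\<close>

lemma W_signs: "x \<in> W n \<Longrightarrow> (\<Prod>j\<in>{1..int n}. sgn (x j)) = 1"
proof (induction rule: W_induct)
  case id
  show ?case by (rule prod.neutral) auto
next
  case (gen x i)
  show ?case
  proof (cases "i = 0")
    case True
    have split: "{1..int n} = insert 1 (insert 2 {3..int n})" using n_ge_2 by auto
    have "(\<Prod>j\<in>{3..int n}. sgn ((x \<circ> gen i) j)) = (\<Prod>j\<in>{3..int n}. sgn (x j))"
      by (rule prod.cong) (auto simp: True gen_def)
    then show ?thesis using gen W_minus[OF gen(1)]
      by (simp add: split True gen_def sgn_minus mult.left_commute)
  next
    case False
    have "bij_betw (gen i) {1..int n} {1..int n}"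
      by (rule bij_betwI[of _ _ _ "gen i"]) (use gen(2) False in \<open>auto simp: gen_def\<close>)
    then show ?thesis using prod.reindex_bij_betw[of "gen i" "{1..int n}" "{1..int n}" "\<lambda>j. sgn (x j)"] gen
      by simp
  qed
qed

lemma strict_mono_from_steps:
  fixes f :: "int \<Rightarrow> int"
  assumes "\<And>k. 1 \<le> k \<Longrightarrow> k < int n \<Longrightarrow> f k < f (k + 1)" "1 \<le> a" "a < b" "b \<le> int n"
  shows "f a < f b"
  using assms(3,4)
proof (induction b rule: int_gr_induct)
  case base
  then show ?case using assms by simp
next
  case (step b)
  then show ?case using assms(1)[of b] assms(2) by simp
qed

text \<open>Without descents, x(1) < ... < x(n) and -x(1) < x(2), so only x(1) could be negative,
  and the parity of the signs excludes this. An increasing sequence of n positive values at most n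
  is 1, ..., n.\<close>

lemma no_descent_id:
  assumes x: "x \<in> W n" and nd: "\<And>i. i < n \<Longrightarrow> x (lo i) < x (hi i)"
  shows "x = id"
proof -
  have step: "x k < x (k + 1)" if "1 \<le> k" "k < int n" for k
    using nd[of "nat k"] that by (auto simp: lo_def hi_def)
  note mono = strict_mono_from_steps[of x, OF step]
  have 0: "- x 1 < x 2" using nd[of 0] n_ge_2 W_minus[OF x, of 1] by (simp add: lo_def hi_def)
  have nz: "x j \<noteq> 0" if "j \<noteq> 0" for j using W_eq_0_iff[OF x] that by auto
  have "x 1 < x 2" using mono[of 1 2] n_ge_2 by simp
  with 0 have "x 2 > 0" by linarith
  have pos2: "x j > 0" if "2 \<le> j" "j \<le> int n" for j
    using mono[of 2 j] that \<open>x 2 > 0\<close> by (cases "j = 2") auto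
  have "{1..int n} = insert 1 {2..int n}" using n_ge_2 by auto
  moreover have "(\<Prod>j\<in>{2..int n}. sgn (x j)) = 1"
    using pos2 by (intro prod.neutral) auto
  ultimately have "sgn (x 1) = 1" using W_signs[OF x] by simp
  then have "x 1 > 0" by (simp add: sgn_1_pos)
  then have pos: "x j > 0" if "1 \<le> j" "j \<le> int n" for j
    using pos2 that by (cases "j = 1") auto
  have ge: "j \<le> x j" if "1 \<le> j" "j \<le> int n" for j
    using that
  proof (induction j rule: int_ge_induct)
    case base
    then show ?case using \<open>x 1 > 0\<close> by simp
  next
    case (step j)
    then show ?case using \<open>\<And>k. 1 \<le> k \<Longrightarrow> k < int n \<Longrightarrow> x k < x (k + 1)\<close>[of j] by simp
  qed
  have le: "x j \<le> j" if "1 \<le> j" "j \<le> int n" for j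
    using that(2,1)
  proof (induction j rule: int_le_induct)
    case base
    then show ?case using W_abs_le[OF x, of "int n"] by simp
  next
    case (step j)
    then show ?case using \<open>\<And>k. 1 \<le> k \<Longrightarrow> k < int n \<Longrightarrow> x k < x (k + 1)\<close>[of "j - 1"] by simp
  qed
  show ?thesis by (rule W_eqI[OF x]) (use ge le in \<open>auto intro: antisym\<close>)
qed

lemma card_inversions_word: "is_word n ws \<Longrightarrow> card (inversions (word_prod ws)) \<le> 2 * length ws"
proof (induction ws rule: rev_induct)
  case (snoc i ws)
  then have W: "word_prod ws \<in> W n" "i < n" and IH: "card (inversions (word_prod ws)) \<le> 2 * length ws"
    by (auto simp: word_prod_W)
  have "card (inversions (word_prod ws \<circ> gen i)) \<le> card (inversions (word_prod ws)) + 2"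
    using card_inversions_gen[OF W] card_inversions_gen'[OF W] W_lo_neq_hi[OF W(1), of i] by linarith
  then have "card (inversions (word_prod (ws @ [i]))) \<le> 2 * length ws + 2"
    using IH unfolding word_prod_snoc by linarith
  moreover have "2 * length (ws @ [i]) = 2 * length ws + 2" by simp
  ultimately show ?case by linarith
qed (simp add: inversions_id)

text \<open>Removing a descent lowers the inversion count by two, and by
  \<open>no_descent_id\<close> this stops only at the identity. Together with
  \<open>card_inversions_word\<close> it identifies the length.\<close>

lemma exists_word:
  "x \<in> W n \<Longrightarrow> \<exists>ws. is_word n ws \<and> word_prod ws = x \<and> 2 * length ws = card (inversions x)"
proof (induction "card (inversions x)" arbitrary: x rule: less_induct)
  case less
  show ?case
  proof (cases "\<exists>i<n. x (hi i) < x (lo i)")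
    case True
    then obtain i where i: "i < n" "x (hi i) < x (lo i)" by auto
    note c = card_inversions_gen'[OF less(2) i]
    with less(1)[of "x \<circ> gen i"] i less(2) obtain ws where
      "is_word n ws" "word_prod ws = x \<circ> gen i" "2 * length ws = card (inversions (x \<circ> gen i))"
      by (auto simp: comp_gen_W_iff)
    then show ?thesis using c i by (intro exI[of _ "ws @ [i]"]) auto
  next
    case False
    then have "x = id" using no_descent_id[OF less(2)] W_lo_neq_hi[OF less(2)]
      by (meson linorder_neqE_linordered_idom)
    then show ?thesis by (intro exI[of _ "[]"]) (auto simp: inversions_id)
  qed
qed

lemma len_eq:
  assumes "x \<in> W n"
  shows "2 * len n x = card (inversions x)"
proof -
  obtain ws where ws: "is_word n ws" "word_prod ws = x" "2 * length ws = card (inversions x)"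
    using exists_word[OF assms] by auto
  have "len n x = length ws"
    unfolding len_def
  proof (rule Least_equality)
    fix k assume "\<exists>us. is_word n us \<and> length us = k \<and> word_prod us = x"
    then show "length ws \<le> k" using card_inversions_word ws(3) by fastforce
  qed (use ws in auto)
  then show ?thesis using ws by simp
qed

lemma len_gen_up:
  assumes "x \<in> W n" "i < n" "x (lo i) < x (hi i)"
  shows "len n (x \<circ> gen i) = len n x + 1"
  using card_inversions_gen[OF assms] len_eq[OF assms(1)] len_eq[of "x \<circ> gen i"] assms
  by (simp add: comp_gen_W_iff)

lemma len_gen_down:
  assumes "x \<in> W n" "i < n" "x (hi i) < x (lo i)"
  shows "len n x = len n (x \<circ> gen i) + 1"
  using card_inversions_gen'[OF assms] len_eq[OF assms(1)] len_eq[of "x \<circ> gen i"] assms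
  by (simp add: comp_gen_W_iff)

lemma len_gen_less_iff:
  assumes "x \<in> W n" "i < n"
  shows "len n (x \<circ> gen i) < len n x \<longleftrightarrow> x (hi i) < x (lo i)"
  using len_gen_up[OF assms] len_gen_down[OF assms] W_lo_neq_hi[OF assms(1), of i]
  by linarith

lemma len_id [simp]: "len n id = 0"
  using len_eq[of id] by (simp add: inversions_id)

lemma len_le_length: "is_word n ws \<Longrightarrow> len n (word_prod ws) \<le> length ws"
  unfolding len_def by (rule Least_le) auto

lemma reduced_word:
  assumes "x \<in> W n"
  shows "\<exists>ws. is_word n ws \<and> word_prod ws = x \<and> length ws = len n x"
  using exists_word[OF assms] len_eq[OF assms] by auto

lemma len_inv:
  assumes "x \<in> W n" shows "len n (inv x) = len n x"
proof -
  have le: "len n (inv x) \<le> len n x" if "x \<in> W n" for x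
    using reduced_word[OF that] by (metis inv_word_prod len_le_length is_word_simps(4) length_rev)
  show ?thesis using le[OF assms] le[OF inv_W[OF assms]] inv_inv_W[OF assms] by simp
qed

lemma len_gen_left:
  assumes "x \<in> W n" "i < n"
  shows "len n (gen i \<circ> x) = len n (inv x \<circ> gen i)"
  using len_inv[of "gen i \<circ> x"] assms by (simp add: gen_comp_W_iff inv_gen_comp)

lemma len_left_less_iff:
  assumes "x \<in> W n" "i < n"
  shows "len n (gen i \<circ> x) < len n x \<longleftrightarrow> inv x (hi i) < inv x (lo i)"
  using len_gen_less_iff[OF inv_W[OF assms(1)] assms(2)] len_gen_left[OF assms] len_inv[OF assms(1)]
  by simp

lemma len_right_cases:
  assumes "x \<in> W n" "i < n"
  shows "(len n (x \<circ> gen i) < len n x \<and> len n x = len n (x \<circ> gen i) + 1) \<or>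
         (\<not> len n (x \<circ> gen i) < len n x \<and> len n (x \<circ> gen i) = len n x + 1)"
  using len_gen_up[OF assms] len_gen_down[OF assms] W_lo_neq_hi[OF assms(1), of i]
  by linarith

lemma len_left_cases:
  assumes "x \<in> W n" "i < n"
  shows "(len n (gen i \<circ> x) < len n x \<and> len n x = len n (gen i \<circ> x) + 1) \<or>
         (\<not> len n (gen i \<circ> x) < len n x \<and> len n (gen i \<circ> x) = len n x + 1)"
  using len_right_cases[OF inv_W[OF assms(1)] assms(2)] len_gen_left[OF assms] len_inv[OF assms(1)]
  by simp

text \<open>By \<open>gen_less\<close>, left multiplication by \<open>gen i\<close> can reverse the
  order of \<open>y (lo j)\<close> and \<open>y (hi j)\<close> only if they are \<open>lo i\<close>,
  \<open>hi i\<close> or the mirror pair. So \<open>y\<close> carries the root of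
  \<open>gen j\<close> to the root of \<open>gen i\<close>.\<close>

lemma right_descent_left_mult:
  assumes y: "y \<in> W n" and i: "i < n" and j: "j < n"
    and up: "y (lo j) < y (hi j)" and down: "(gen i \<circ> y) (hi j) < (gen i \<circ> y) (lo j)"
  shows "gen i \<circ> y = y \<circ> gen j"
proof -
  have nz: "y (lo j) \<noteq> 0" "y (hi j) \<noteq> 0" using lo_hi[of j] W_eq_0_iff[OF y] by auto
  have "y (lo j) \<noteq> y (- hi j)" using lo_hi[of j] W_inj[OF y] by auto
  then have "y (lo j) \<noteq> - y (hi j)" using W_minus[OF y] by simp
  then have c: "(y (lo j), y (hi j)) = (lo i, hi i) \<or> (y (lo j), y (hi j)) = (- hi i, - lo i)"
    using gen_less[OF up nz, of i] down by auto
  show ?thesis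
  proof
    fix z
    show "(gen i \<circ> y) z = (y \<circ> gen j) z"
    proof (cases "z = lo j \<or> z = hi j \<or> z = - lo j \<or> z = - hi j")
      case True
      then show ?thesis using c by (elim disjE) (simp_all add: W_minus[OF y])
    next
      case False
      have "y z \<noteq> y (lo j)" "y z \<noteq> y (hi j)" "y z \<noteq> y (- lo j)" "y z \<noteq> y (- hi j)"
        using False W_inj[OF y] by simp_all
      then have "y z \<noteq> lo i" "y z \<noteq> hi i" "y z \<noteq> - lo i" "y z \<noteq> - hi i"
        using c unfolding W_minus[OF y] by (elim disjE; simp)+
      then show ?thesis using False by (simp add: gen_eq)
    qed
  qed
qed

text \<open>The exchange condition in the form needed for left and right multiplications to commute.\<close>
lemma exchange_right:
  assumes y: "y \<in> W n" and i: "i < n" and j: "j < n"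
    and ne: "gen i \<circ> y \<noteq> y \<circ> gen j"
  shows "len n (gen i \<circ> y \<circ> gen j) < len n (gen i \<circ> y) \<longleftrightarrow> len n (y \<circ> gen j) < len n y"
proof -
  have 1: "gen i \<circ> y \<in> W n" using y i by (simp add: gen_comp_W_iff)
  have "gen i \<circ> (gen i \<circ> y) \<noteq> gen i \<circ> y \<circ> gen j"
    using ne by (metis comp_assoc gen_gen_comp)
  then show ?thesis
    using right_descent_left_mult[OF y i j] right_descent_left_mult[OF 1 i j] ne
      W_lo_neq_hi[OF y, of j] W_lo_neq_hi[OF 1, of j]
    unfolding len_gen_less_iff[OF y j] len_gen_less_iff[OF 1 j] gen_gen_comp by linarith
qed

text \<open>In the square y, s_i y, y s_j, s_i y s_j every edge changes the length by one. If one
  pair of opposite edges points the same way, as \<open>exchange_right\<close> says, so does the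
  other pair.\<close>

lemma exchange_left:
  assumes y: "y \<in> W n" and i: "i < n" and j: "j < n"
    and ne: "gen i \<circ> y \<noteq> y \<circ> gen j"
  shows "len n (gen i \<circ> y \<circ> gen j) < len n (y \<circ> gen j) \<longleftrightarrow> len n (gen i \<circ> y) < len n y"
  using exchange_right[OF y i j ne] len_right_cases[OF y j] len_left_cases[OF y i]
    len_right_cases[of "gen i \<circ> y" j] i j y
  by (auto simp: gen_comp_W_iff)

section \<open>Minimal coset representatives and sign patterns\<close>

lemma Wp_W: "v \<in> Wp n \<Longrightarrow> v \<in> W n"
  by (simp add: Wp_def)

lemma finite_Wp: "finite (Wp n)"
  by (rule finite_subset[OF _ finite_W]) (auto simp: Wp_def)

lemma Wp_inv_mono:
  assumes v: "v \<in> Wp n" and "1 \<le> a" "a < b" "b \<le> int n"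
  shows "inv v a < inv v b"
proof (rule strict_mono_from_steps[OF _ assms(2-4)])
  fix k assume k: "1 \<le> k" "k < int n"
  then have "len n (gen (nat k) \<circ> v) > len n v" using v unfolding Wp_def by force
  then have "\<not> inv v (hi (nat k)) < inv v (lo (nat k))"
    using len_left_less_iff[OF Wp_W[OF v], of "nat k"] k by auto
  then show "inv v k < inv v (k + 1)" using W_lo_neq_hi[OF inv_W[OF Wp_W[OF v]], of "nat k"] k
    by (auto simp: lo_def hi_def)
qed

text \<open>On \<open>W n\<close> the classes are the cosets W_p x: s_1, ..., s_{n-1} on the left
  permute values without changing signs, and by \<open>Wp_unique\<close> no class contains two
  minimal representatives.\<close>

definition same_signs :: "sperm \<Rightarrow> sperm \<Rightarrow> bool" where
  "same_signs x y \<longleftrightarrow> (\<forall>j. x j > 0 \<longleftrightarrow> y j > 0)"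

lemma same_signs_refl [simp]: "same_signs x x"
  and same_signs_sym: "same_signs x y \<longleftrightarrow> same_signs y x"
  and same_signs_trans: "same_signs x y \<Longrightarrow> same_signs y z \<Longrightarrow> same_signs x z"
  by (auto simp: same_signs_def)

lemma same_signs_comp: "same_signs x y \<Longrightarrow> same_signs (x \<circ> z) (y \<circ> z)"
  by (simp add: same_signs_def)

lemma same_signs_gen_left: "0 < i \<Longrightarrow> same_signs (gen i \<circ> x) x"
  by (auto simp: same_signs_def gen_def)

lemma W_pos_iff: "x \<in> W n \<Longrightarrow> j \<noteq> 0 \<Longrightarrow> x j > 0 \<longleftrightarrow> \<not> x (- j) > 0"
  using W_minus[of x n j] W_eq_0_iff[of x n j] by auto

lemma same_signsI:
  assumes "x \<in> W n" "y \<in> W n" "\<And>j. 1 \<le> j \<Longrightarrow> j \<le> int n \<Longrightarrow> x j > 0 \<longleftrightarrow> y j > 0"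
  shows "same_signs x y"
  unfolding same_signs_def
proof
  fix j
  consider "\<bar>j\<bar> > int n" | "j = 0" | "1 \<le> j" "j \<le> int n" | "1 \<le> -j" "-j \<le> int n" by linarith
  then show "x j > 0 \<longleftrightarrow> y j > 0"
    using assms W_fix[of x j] W_fix[of y j] W_0[of x] W_0[of y] W_pos_iff[of x j] W_pos_iff[of y j]
    by cases auto
qed

text \<open>For \<open>v\<close> in \<open>Wp n\<close> the sequence \<open>inv v 1\<close>, ...,
  \<open>inv v n\<close> lists in increasing order the positions in -n..n where \<open>v\<close> is
  positive, so the sign pattern recovers \<open>v\<close>.\<close>

lemma Wp_unique:
  assumes v: "v \<in> Wp n" and u: "u \<in> Wp n" and "same_signs v u"
  shows "v = u"
proof -
  have img: "inv x ` {1..int n} = {j. \<bar>j\<bar> \<le> int n \<and> x j > 0}" if "x \<in> W n" for x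
  proof -
    have "j \<in> inv x ` {1..int n}" if "\<bar>j\<bar> \<le> int n" "x j > 0" for j
      using that W_inv_apply[OF \<open>x \<in> W n\<close>, of j] W_abs_le[OF \<open>x \<in> W n\<close>, of j]
      by (intro image_eqI[of _ _ "x j"]) auto
    then show ?thesis
      using W_abs_le[OF inv_W[OF that]] W_inv_apply[OF that] by auto
  qed
  have set_eq: "inv v ` {1..int n} = inv u ` {1..int n}"
    using img[OF Wp_W[OF v]] img[OF Wp_W[OF u]] assms(3) by (simp add: same_signs_def)
  have srt: "sorted_wrt (<) (map (inv x) [1..int n])" if "x \<in> Wp n" for x
    unfolding sorted_wrt_iff_nth_less using Wp_inv_mono[OF that] by auto
  have "map (inv v) [1..int n] = map (inv u) [1..int n]"
    using strict_sorted_equal[OF srt[OF v] srt[OF u]] set_eq by simp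
  then have "inv v j = inv u j" if "1 \<le> j" "j \<le> int n" for j using that by simp
  then have "inv v = inv u" by (intro W_eqI inv_W Wp_W v u)
  then show ?thesis using inv_inv_W Wp_W v u by metis
qed

lemma exists_Wp:
  "x \<in> W n \<Longrightarrow> \<exists>v\<in>Wp n. same_signs v x \<and> len n v \<le> len n x"
proof (induction "len n x" arbitrary: x rule: less_induct)
  case less
  show ?case
  proof (cases "x \<in> Wp n")
    case False
    then obtain i where i: "1 \<le> i" "i < n" "\<not> len n (gen i \<circ> x) > len n x"
      using less(2) by (auto simp: Wp_def)
    then have "len n (gen i \<circ> x) < len n x" using len_left_cases[OF less(2), of i] by auto
    with less(1)[of "gen i \<circ> x"] less(2) i obtain v where
      "v \<in> Wp n" "same_signs v (gen i \<circ> x)" "len n v \<le> len n (gen i \<circ> x)"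
      by (auto simp: gen_comp_W_iff)
    then show ?thesis using \<open>len n (gen i \<circ> x) < len n x\<close> i same_signs_gen_left[of i x]
      by (intro bexI[of _ v]) (auto intro: same_signs_trans)
  qed (auto intro!: bexI[of _ x])
qed

lemma Wp_minimal: "v \<in> Wp n \<Longrightarrow> x \<in> W n \<Longrightarrow> same_signs v x \<Longrightarrow> len n v \<le> len n x"
  using exists_Wp[of x] Wp_unique by (metis same_signs_sym same_signs_trans)

lemma id_Wp: "id \<in> Wp n"
proof -
  have "len n (gen i \<circ> id) > 0" if "i < n" for i
    using len_left_cases[OF id_W that] by auto
  then show ?thesis by (auto simp: Wp_def)
qed

lemma same_signs_gen_iff:
  assumes "x \<in> W n"
  shows "same_signs (x \<circ> gen i) x \<longleftrightarrow> (x (lo i) > 0 \<longleftrightarrow> x (hi i) > 0)"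
proof
  assume "same_signs (x \<circ> gen i) x"
  then show "x (lo i) > 0 \<longleftrightarrow> x (hi i) > 0"
    unfolding same_signs_def by (metis comp_apply gen_lo)
next
  assume *: "x (lo i) > 0 \<longleftrightarrow> x (hi i) > 0"
  then have "x (- lo i) > 0 \<longleftrightarrow> x (- hi i) > 0"
    using W_pos_iff[OF assms] lo_hi[of i] by (metis less_irrefl)
  with * show "same_signs (x \<circ> gen i) x"
    by (auto simp: same_signs_def gen_eq)
qed

text \<open>A left descent s_i of v s_j with i >= 1 would force s_i v = v s_j by the exchange
  condition; but s_i on the left keeps the sign pattern, while s_j on the right changes it
  here.\<close>

lemma Wp_gen:
  assumes v: "v \<in> Wp n" and j: "j < n" and "(v (lo j) > 0) \<noteq> (v (hi j) > 0)"
  shows "v \<circ> gen j \<in> Wp n"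
proof (rule ccontr)
  note vW = Wp_W[OF v]
  assume "v \<circ> gen j \<notin> Wp n"
  then obtain i where i: "1 \<le> i" "i < n" "\<not> len n (v \<circ> gen j) < len n (gen i \<circ> (v \<circ> gen j))"
    using vW j by (auto simp: Wp_def comp_gen_W_iff)
  then have "len n (gen i \<circ> v \<circ> gen j) < len n (v \<circ> gen j)"
    using len_left_cases[of "v \<circ> gen j" i] vW j by (auto simp: comp_gen_W_iff comp_assoc)
  moreover have "\<not> len n (gen i \<circ> v) < len n v"
    using v i unfolding Wp_def by force
  ultimately have "gen i \<circ> v = v \<circ> gen j"
    using exchange_left[OF vW i(2) j] by blast
  then show False
    using same_signs_gen_left[of i v] same_signs_gen_iff[OF vW, of j] i assms(3) by simp
qed

text \<open>Any w other than the identity has a descent s, and ws, being shorter, must leave the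
  coset of the minimal element w. So the signs at \<open>lo i\<close> and \<open>hi i\<close>
  differ, and \<open>Wp_gen\<close> keeps ws in W^p.\<close>

lemma Wp_induct [consumes 1, case_names id gen]:
  assumes "w \<in> Wp n" and "P id"
    and "\<And>w i. w \<in> Wp n \<Longrightarrow> i < n \<Longrightarrow> w (lo i) < 0 \<Longrightarrow> 0 < w (hi i) \<Longrightarrow> w \<circ> gen i \<in> Wp n \<Longrightarrow> P w \<Longrightarrow> P (w \<circ> gen i)"
  shows "P w"
  using assms(1)
proof (induction "len n w" arbitrary: w rule: less_induct)
  case less
  note wW = Wp_W[OF less(2)]
  show ?case
  proof (cases "w = id")
    case False
    then obtain i where i: "i < n" "w (hi i) < w (lo i)"
      using no_descent_id[OF wW] W_lo_neq_hi[OF wW] by (meson linorder_neqE_linordered_idom)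
    have len: "len n w = len n (w \<circ> gen i) + 1" using len_gen_down[OF wW i] .
    have "\<not> same_signs (w \<circ> gen i) w"
      using Wp_minimal[OF less(2), of "w \<circ> gen i"] wW i len
      by (auto simp: comp_gen_W_iff same_signs_sym)
    then have "(w (lo i) > 0) \<noteq> (w (hi i) > 0)" using same_signs_gen_iff[OF wW, of i] by simp
    moreover have "w (hi i) \<noteq> 0" using W_eq_0_iff[OF wW, of "hi i"] lo_hi(2)[of i] by simp
    ultimately have sg: "w (lo i) > 0" "w (hi i) < 0" using i(2) by linarith+
    define u where "u = w \<circ> gen i"
    have u: "u \<in> Wp n" unfolding u_def using Wp_gen[OF less(2) i(1)] sg by simp
    have "P u" using less(1)[of u] u len by (simp add: u_def)
    then have "P (u \<circ> gen i)"
      using u i sg less(2) by (intro assms(3)) (simp_all add: u_def)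
    then show ?thesis by (simp add: u_def)
  qed (use assms in auto)
qed

end

section \<open>The Hecke algebra and its bar involution\<close>

lemma qpow_0 [simp]: "qpow 0 = 1"
  by (simp add: qpow_def)

lemma qpow_add: "qpow (a + b) = qpow a * qpow b"
  by (simp add: qpow_def mult_single)

lemma qinv_qq [simp]: "qinv * qq = 1" "qq * qinv = 1" "qinv * (qq * f) = f" "qq * (qinv * f) = f"
proof -
  show *: "qinv * qq = 1" "qq * qinv = 1"
    unfolding qinv_def qq_def qpow_add[symmetric] by simp_all
  show "qinv * (qq * f) = f" "qq * (qinv * f) = f"
    using * by (simp_all add: mult.assoc[symmetric])
qed

lemma lookup_barL: "Poly_Mapping.lookup (barL f) k = Poly_Mapping.lookup f (- k)"
proof -
  have "finite ((\<lambda>k. - k) -` {k. Poly_Mapping.lookup f k \<noteq> 0})"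
    by (rule finite_vimageI) (auto intro: injI)
  then show ?thesis by (simp add: barL_def vimage_def)
qed

lemma barL_0 [simp]: "barL 0 = 0"
  by (rule poly_mapping_eqI) (simp add: lookup_barL)

lemma barL_add: "barL (f + g) = barL f + barL g"
  and barL_diff: "barL (f - g) = barL f - barL g"
  by (rule poly_mapping_eqI; simp add: lookup_barL lookup_add lookup_minus)+

lemma barL_single: "barL (Poly_Mapping.single k c) = Poly_Mapping.single (- k) c"
  by (rule poly_mapping_eqI) (auto simp: lookup_barL lookup_single when_def)

lemma barL_1 [simp]: "barL 1 = 1"
  using barL_single[of 0 1] by simp

lemma barL_qq [simp]: "barL qq = qinv" and barL_qinv [simp]: "barL qinv = qq"
  by (simp_all add: qq_def qinv_def qpow_def barL_single)

text \<open>Laurent polynomials form the free abelian group on the exponents, so additivity in each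
  factor reduces the claim to monomials; \<open>frag_of a\<close> is q^a.\<close>

lemma barL_mult: "barL (f * g) = barL f * barL g"
proof -
  have 1: "barL (frag_of a * g) = barL (frag_of a) * barL g" for a :: int
    using subset_UNIV
    by (induction g rule: frag_induction)
       (auto simp: barL_single mult_single barL_diff algebra_simps)
  show ?thesis
    using subset_UNIV
    by (induction f rule: frag_induction)
       (auto simp: 1 barL_diff left_diff_distrib)
qed

definition zeta :: laur where "zeta = qinv - qq"

lemma barL_zeta [simp]: "barL zeta = - zeta"
  by (simp add: zeta_def barL_diff)

section \<open>Left and right multiplication operators and the product\<close>

context type_D
begin

lemma W_left_up_induct [consumes 1, case_names id gen]:
  assumes "x \<in> W n" and "P id"
    and "\<And>x i. x \<in> W n \<Longrightarrow> i < n \<Longrightarrow> len n x < len n (gen i \<circ> x) \<Longrightarrow> P x \<Longrightarrow> P (gen i \<circ> x)"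
  shows "P x"
proof -
  obtain ws where "is_word n ws" "word_prod ws = x" "length ws = len n x"
    using reduced_word[OF assms(1)] by auto
  then show ?thesis
  proof (induction ws arbitrary: x)
    case (Cons i ws)
    have W: "word_prod ws \<in> W n" "i < n" and x: "x = gen i \<circ> word_prod ws"
      using Cons.prems by (auto simp: word_prod_W)
    have "len n (word_prod ws) \<le> length ws" using Cons.prems by (intro len_le_length) auto
    moreover have "length (i # ws) = len n (gen i \<circ> word_prod ws)" using Cons.prems(3) x by metis
    ultimately have "length ws = len n (word_prod ws)" "len n (word_prod ws) < len n (gen i \<circ> word_prod ws)"
      using len_left_cases[OF W] by simp_all
    moreover have "is_word n ws" using Cons.prems(1) by simp
    ultimately have "P (gen i \<circ> word_prod ws)" using Cons.IH[OF _ refl] assms(3)[OF W] by metis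
    then show ?case using x by metis
  next
    case Nil
    then show ?case using assms(2) word_prod_Nil by metis
  qed
qed

lemma W_right_up_induct [consumes 1, case_names id gen]:
  assumes "x \<in> W n" and "P id"
    and "\<And>x i. x \<in> W n \<Longrightarrow> i < n \<Longrightarrow> len n x < len n (x \<circ> gen i) \<Longrightarrow> P x \<Longrightarrow> P (x \<circ> gen i)"
  shows "P x"
proof -
  have "P (inv y)" if "y \<in> W n" for y
    using that
  proof (induction rule: W_left_up_induct)
    case id
    show ?case using assms(2) by (simp only: inv_id)
  next
    case (gen y i)
    have "len n (inv y) < len n (inv y \<circ> gen i)"
      using gen(1-3) len_inv[of y] len_inv[of "gen i \<circ> y"] inv_gen_comp[OF gen(1)]
      by (metis gen_comp_W_iff)
    then show ?case using assms(3)[OF inv_W[OF gen(1)] gen(2) _ gen(4)] inv_gen_comp[OF gen(1)] by metis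
  qed
  from this[OF inv_W[OF assms(1)]] show ?thesis by (simp only: inv_inv_W[OF assms(1)])
qed

text \<open>Left multiplication by H_s in coordinates, the mirror image of \<open>mulHs\<close>. The
  product \<open>hmul\<close> is built from right multiplications only; \<open>hmul_gen_left\<close>
  later identifies this operator with a product.\<close>

definition Lmul :: "nat \<Rightarrow> hecke \<Rightarrow> hecke" where
  "Lmul i h = (\<lambda>y. if y \<in> W n then
      h (gen i \<circ> y) + (if len n (gen i \<circ> y) < len n y then zeta * h y else 0) else 0)"

lemma mulHs_apply:
  "mulHs n h i y = (if y \<in> W n then
      h (y \<circ> gen i) + (if len n (y \<circ> gen i) < len n y then zeta * h y else 0) else 0)"
  by (simp add: mulHs_def zeta_def)

lemma Lmul_apply:
  "Lmul i h y = (if y \<in> W n then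
      h (gen i \<circ> y) + (if len n (gen i \<circ> y) < len n y then zeta * h y else 0) else 0)"
  by (simp add: Lmul_def)

lemma Hb_Hset: "w \<in> W n \<Longrightarrow> Hb w \<in> Hset n"
  and hadd_Hset: "h \<in> Hset n \<Longrightarrow> g \<in> Hset n \<Longrightarrow> hadd h g \<in> Hset n"
  and hsmult_Hset: "h \<in> Hset n \<Longrightarrow> hsmult c h \<in> Hset n"
  and hsum_Hset: "(\<And>a. a \<in> A \<Longrightarrow> f a \<in> Hset n) \<Longrightarrow> hsum f A \<in> Hset n"
  and mulHs_Hset: "mulHs n h i \<in> Hset n"
  and Lmul_Hset: "Lmul i h \<in> Hset n"
  by (auto simp: Hset_def Hb_def hadd_def hsmult_def hsum_def mulHs_def Lmul_def)

lemmas Hset_intros = Hb_Hset hadd_Hset hsmult_Hset hsum_Hset mulHs_Hset Lmul_Hset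

lemma mulHs_Hb:
  assumes "w \<in> W n" "i < n" "len n w < len n (w \<circ> gen i)"
  shows "mulHs n (Hb w) i = Hb (w \<circ> gen i)"
proof -
  have "y \<circ> gen i = w \<longleftrightarrow> y = w \<circ> gen i" for y by auto
  then show ?thesis using assms by (auto simp: mulHs_apply Hb_def fun_eq_iff[of "mulHs _ _ _"] comp_gen_W_iff)
qed

lemma mulHs_Hb_down:
  assumes "w \<in> W n" "i < n" "len n (w \<circ> gen i) < len n w"
  shows "mulHs n (Hb w) i = hadd (Hb (w \<circ> gen i)) (hsmult zeta (Hb w))"
proof -
  have "y \<circ> gen i = w \<longleftrightarrow> y = w \<circ> gen i" for y by auto
  then show ?thesis using assms
    by (auto simp: mulHs_apply Hb_def hadd_def hsmult_def fun_eq_iff[of "mulHs _ _ _"] comp_gen_W_iff)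
qed

lemma Lmul_Hb:
  assumes "w \<in> W n" "i < n" "len n w < len n (gen i \<circ> w)"
  shows "Lmul i (Hb w) = Hb (gen i \<circ> w)"
proof -
  have "gen i \<circ> y = w \<longleftrightarrow> y = gen i \<circ> w" for y by auto
  then show ?thesis using assms by (auto simp: Lmul_apply Hb_def fun_eq_iff[of "Lmul _ _"] gen_comp_W_iff)
qed

lemma Lmul_Hb_down:
  assumes "w \<in> W n" "i < n" "len n (gen i \<circ> w) < len n w"
  shows "Lmul i (Hb w) = hadd (Hb (gen i \<circ> w)) (hsmult zeta (Hb w))"
proof -
  have "gen i \<circ> y = w \<longleftrightarrow> y = gen i \<circ> w" for y by auto
  then show ?thesis using assms
    by (auto simp: Lmul_apply Hb_def hadd_def hsmult_def fun_eq_iff[of "Lmul _ _"] gen_comp_W_iff)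
qed

lemma len_gen [simp]: "i < n \<Longrightarrow> len n (gen i) = 1"
  using len_right_cases[of id i] by simp

lemma Lmul_id: "i < n \<Longrightarrow> Lmul i (Hb id) = Hb (gen i)"
  using Lmul_Hb[of id i] by simp

lemma mulHs_id: "i < n \<Longrightarrow> mulHs n (Hb id) i = Hb (gen i)"
  using mulHs_Hb[of id i] by simp

text \<open>If s_i y and y s_j differ, the exchange condition makes left and right descents at y
  independent, and both orders give the same terms. If they coincide, both operators read the same
  entries under the same descent conditions.\<close>

lemma Lmul_mulHs_commute:
  assumes "i < n" "j < n"
  shows "Lmul i (mulHs n h j) = mulHs n (Lmul i h) j"
proof
  fix y
  show "Lmul i (mulHs n h j) y = mulHs n (Lmul i h) j y"
  proof (cases "y \<in> W n")
    case True
    show ?thesis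
    proof (cases "gen i \<circ> y = y \<circ> gen j")
      case eq: True
      then have "gen i \<circ> y \<circ> gen j = y" "gen i \<circ> (y \<circ> gen j) = y" by (metis comp_gen_gen, metis eq gen_gen_comp)
      then show ?thesis using True assms eq
        by (auto simp: Lmul_apply mulHs_apply comp_gen_W_iff gen_comp_W_iff)
    next
      case False
      show ?thesis using True assms exchange_left[OF True assms False] exchange_right[OF True assms False]
        by (auto simp: Lmul_apply mulHs_apply comp_gen_W_iff gen_comp_W_iff comp_assoc algebra_simps)
    qed
  qed (auto simp: Lmul_apply mulHs_apply)
qed

definition linear_op :: "(hecke \<Rightarrow> hecke) \<Rightarrow> bool" where
  "linear_op T \<longleftrightarrow> (\<forall>h g. T (hadd h g) = hadd (T h) (T g)) \<and> (\<forall>c h. T (hsmult c h) = hsmult c (T h))"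

lemma linear_opD:
  "linear_op T \<Longrightarrow> T (hadd h g) = hadd (T h) (T g)"
  "linear_op T \<Longrightarrow> T (hsmult c h) = hsmult c (T h)"
  by (auto simp: linear_op_def)

lemma hsmult_0 [simp]: "hsmult 0 h = (\<lambda>_. 0)" and hsmult_0' [simp]: "hsmult c (\<lambda>_. 0) = (\<lambda>_. 0)"
  and hadd_0 [simp]: "hadd (\<lambda>_. 0) h = h" "hadd h (\<lambda>_. 0) = h"
  and hsmult_1 [simp]: "hsmult 1 h = h"
  by (auto simp: hsmult_def hadd_def)

lemma hsum_simps: "hsum f {} = (\<lambda>_. 0)"
  "finite A \<Longrightarrow> a \<notin> A \<Longrightarrow> hsum f (insert a A) = hadd (f a) (hsum f A)"
  by (auto simp: hsum_def hadd_def)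

lemma linear_op_0: "linear_op T \<Longrightarrow> T (\<lambda>_. 0) = (\<lambda>_. 0)"
  using linear_opD(2)[of T 0 "\<lambda>_. 0"] by simp

lemma linear_op_hsum:
  assumes "linear_op T" "finite A"
  shows "T (hsum f A) = hsum (\<lambda>a. T (f a)) A"
  using assms(2,1) by (induction A rule: finite_induct) (auto simp: hsum_simps linear_op_0 linear_opD)

lemma linear_op_comp: "linear_op T \<Longrightarrow> linear_op S \<Longrightarrow> linear_op (\<lambda>h. T (S h))"
  by (simp add: linear_op_def)

lemma linear_op_mulHs: "linear_op (\<lambda>h. mulHs n h i)"
  and linear_op_Lmul: "linear_op (Lmul i)"
  by (auto simp: linear_op_def mulHs_def Lmul_def hadd_def hsmult_def algebra_simps)

lemma Hset_expand: "h \<in> Hset n \<Longrightarrow> h = hsum (\<lambda>w. hsmult (h w) (Hb w)) (W n)"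
  using finite_W by (auto simp: hsum_def hsmult_def Hb_def Hset_def if_distrib sum.delta' cong: if_cong)

lemma linear_op_eqI:
  assumes "linear_op T" "linear_op S" "\<And>w. w \<in> W n \<Longrightarrow> T (Hb w) = S (Hb w)" "h \<in> Hset n"
  shows "T h = S h"
proof -
  have *: "R h = hsum (\<lambda>w. hsmult (h w) (R (Hb w))) (W n)" if "linear_op R" for R
    using arg_cong[OF Hset_expand[OF assms(4)], of R]
    by (simp only: linear_op_hsum[OF that finite_W] linear_opD[OF that])
  show ?thesis unfolding *[OF assms(1)] *[OF assms(2)] using assms(3) by (simp add: hsum_def)
qed

text \<open>A linear operator commuting with all left multiplications is determined by its value at
  the unit: this replaces any appeal to the braid relations.\<close>
lemma commuting_op_eqI:
  assumes T: "linear_op T" "\<And>i h. i < n \<Longrightarrow> T (Lmul i h) = Lmul i (T h)"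
    and S: "linear_op S" "\<And>i h. i < n \<Longrightarrow> S (Lmul i h) = Lmul i (S h)"
    and "T (Hb id) = S (Hb id)" and "h \<in> Hset n"
  shows "T h = S h"
proof (rule linear_op_eqI[OF T(1) S(1) _ assms(6)])
  fix w assume "w \<in> W n"
  then show "T (Hb w) = S (Hb w)"
  proof (induction rule: W_left_up_induct)
    case (gen x i)
    then show ?case by (metis Lmul_Hb T(2) S(2))
  qed (rule assms(5))
qed

lemma foldl_mulHs:
  "linear_op (\<lambda>h. foldl (mulHs n) h ws)"
  "is_word n ws \<Longrightarrow> i < n \<Longrightarrow> foldl (mulHs n) (Lmul i h) ws = Lmul i (foldl (mulHs n) h ws)"
  "h \<in> Hset n \<Longrightarrow> foldl (mulHs n) h ws \<in> Hset n"
proof (induction ws arbitrary: h)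
  case (Cons j ws)
  { case 1 show ?case using linear_op_comp[OF Cons(1) linear_op_mulHs[of j]] by simp }
  { case 2 then show ?case using Cons(2) by (simp flip: Lmul_mulHs_commute) }
  { case 3 then show ?case using Cons(3) by (simp add: mulHs_Hset) }
qed (auto simp: linear_op_def)

lemma foldl_mulHs_reduced:
  "is_word n ws \<Longrightarrow> len n (word_prod ws) = length ws \<Longrightarrow> foldl (mulHs n) (Hb id) ws = Hb (word_prod ws)"
proof (induction ws rule: rev_induct)
  case (snoc i ws)
  have W: "word_prod ws \<in> W n" "i < n" using snoc.prems by (auto simp: word_prod_W)
  have "len n (word_prod ws) \<le> length ws" using snoc.prems by (intro len_le_length) auto
  moreover have "len n (word_prod ws \<circ> gen i) = length ws + 1"
    using snoc.prems(2) unfolding word_prod_snoc length_append by (metis length_Cons list.size(3) One_nat_def)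
  ultimately have "len n (word_prod ws) = length ws" "len n (word_prod ws) < len n (word_prod ws \<circ> gen i)"
    using len_right_cases[OF W] by linarith+
  moreover have "foldl (mulHs n) (Hb id) ws = Hb (word_prod ws)"
    using snoc.IH snoc.prems(1) calculation(1) is_word_simps(3) by metis
  ultimately have "foldl (mulHs n) (Hb id) (ws @ [i]) = Hb (word_prod ws \<circ> gen i)"
    using mulHs_Hb[OF W] by (simp only: foldl_append foldl_Cons foldl_Nil)
  then show ?case by (simp only: word_prod_snoc)
qed simp

lemma red_word:
  assumes "x \<in> W n"
  shows "is_word n (red_word n x)" "word_prod (red_word n x) = x" "length (red_word n x) = len n x"
  using someI_ex[OF reduced_word[OF assms]] unfolding red_word_def by auto

lemma mulH_id: "x \<in> W n \<Longrightarrow> mulH n (Hb id) x = Hb x"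
  unfolding mulH_def using foldl_mulHs_reduced[of "red_word n x"] red_word[of x] by simp

lemma mulH_by_id [simp]: "mulH n h id = h"
  using red_word[of id] by (simp add: mulH_def)

lemma linear_op_mulH: "linear_op (\<lambda>h. mulH n h x)"
  unfolding mulH_def by (rule foldl_mulHs)

text \<open>The reduced word inside \<open>mulH\<close> is an arbitrary choice. Commutation with
  left multiplications and the value \<open>mulH_id\<close> at the unit determine the operator
  whatever the choice.\<close>

lemma mulH_Lmul: "x \<in> W n \<Longrightarrow> i < n \<Longrightarrow> mulH n (Lmul i h) x = Lmul i (mulH n h x)"
  unfolding mulH_def using red_word foldl_mulHs by blast

lemma mulH_Hset: "h \<in> Hset n \<Longrightarrow> mulH n h x \<in> Hset n"
  unfolding mulH_def by (rule foldl_mulHs)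

lemma hmul_Hset: "h \<in> Hset n \<Longrightarrow> hmul n h g \<in> Hset n"
  unfolding hmul_def by (intro Hset_intros mulH_Hset)

lemma linear_op_hmul_left: "linear_op (\<lambda>h. hmul n h g)"
  using linear_opD[OF linear_op_mulH]
  by (auto simp: linear_op_def hmul_def hsum_def hsmult_def hadd_def fun_eq_iff
      sum.distrib sum_distrib_left algebra_simps)

lemma linear_op_hmul_right: "linear_op (\<lambda>g. hmul n h g)"
  by (auto simp: linear_op_def hmul_def hsum_def hsmult_def hadd_def fun_eq_iff
      sum.distrib sum_distrib_left algebra_simps)

lemma hmul_Lmul: "i < n \<Longrightarrow> hmul n (Lmul i h) g = Lmul i (hmul n h g)"
  by (simp add: hmul_def linear_op_hsum[OF linear_op_Lmul] linear_opD[OF linear_op_Lmul] finite_W)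
     (auto simp: hsum_def mulH_Lmul)

lemma hmul_Hb: "x \<in> W n \<Longrightarrow> hmul n h (Hb x) = mulH n h x"
  using finite_W by (auto simp: hmul_def hsum_def hsmult_def Hb_def if_distrib[of "\<lambda>c. c * _"] sum.delta cong: if_cong)

lemma hmul_id_right [simp]: "hmul n h (Hb id) = h"
  by (simp add: hmul_Hb)

lemma hmul_id_left [simp]: "g \<in> Hset n \<Longrightarrow> hmul n (Hb id) g = g"
  using Hset_expand[of g] by (simp add: hmul_def hsum_def hsmult_def mulH_id)

text \<open>As functions of \<open>h\<close> both sides are linear and commute with
  \<open>Lmul\<close>, and at the unit both equal \<open>hmul n g k\<close>.\<close>

lemma hmul_assoc:
  assumes "h \<in> Hset n" "g \<in> Hset n" "k \<in> Hset n"
  shows "hmul n (hmul n h g) k = hmul n h (hmul n g k)"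
  by (rule commuting_op_eqI[of "\<lambda>h. hmul n (hmul n h g) k" "\<lambda>h. hmul n h (hmul n g k)"])
     (auto simp: linear_op_hmul_left linear_op_comp[OF linear_op_hmul_left] hmul_Lmul hmul_Hset assms)

lemma hmul_gen_left: "i < n \<Longrightarrow> g \<in> Hset n \<Longrightarrow> hmul n (Hb (gen i)) g = Lmul i g"
  using hmul_Lmul[of i "Hb id" g] by (simp add: Lmul_id)

lemma hmul_gen_right: "i < n \<Longrightarrow> h \<in> Hset n \<Longrightarrow> hmul n h (Hb (gen i)) = mulHs n h i"
  by (rule commuting_op_eqI[of "\<lambda>h. hmul n h (Hb (gen i))" "\<lambda>h. mulHs n h i"])
     (auto simp: linear_op_hmul_left linear_op_mulHs hmul_Lmul Lmul_mulHs_commute mulHs_id Hset_intros gen_W)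

section \<open>Inverses and the bar involution\<close>

definition gen_inv :: "nat \<Rightarrow> hecke" where
  "gen_inv i = hadd (Hb (gen i)) (hsmult (- zeta) (Hb id))"

lemma gen_inv_Hset: "i < n \<Longrightarrow> gen_inv i \<in> Hset n"
  by (simp add: gen_inv_def Hset_intros gen_W)

lemma hmul_gen_inv_left: "i < n \<Longrightarrow> g \<in> Hset n \<Longrightarrow> hmul n (gen_inv i) g = hadd (Lmul i g) (hsmult (- zeta) g)"
  by (simp add: gen_inv_def linear_opD[OF linear_op_hmul_left] hmul_gen_left)

lemma hmul_gen_inv_right: "i < n \<Longrightarrow> h \<in> Hset n \<Longrightarrow> hmul n h (gen_inv i) = hadd (mulHs n h i) (hsmult (- zeta) h)"
  by (simp add: gen_inv_def linear_opD[OF linear_op_hmul_right] hmul_gen_right)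

definition is_inverse :: "hecke \<Rightarrow> hecke \<Rightarrow> bool" where
  "is_inverse h g \<longleftrightarrow> h \<in> Hset n \<and> g \<in> Hset n \<and> hmul n h g = Hb id \<and> hmul n g h = Hb id"

text \<open>The quadratic relation H_s^2 = zeta H_s + 1 reads H_s (H_s - zeta) = 1.\<close>

lemma is_inverse_gen: "i < n \<Longrightarrow> is_inverse (Hb (gen i)) (gen_inv i)"
  using mulHs_Hb_down[of "gen i" i] Lmul_Hb_down[of "gen i" i]
  by (auto simp: is_inverse_def hmul_gen_inv_left hmul_gen_inv_right gen_inv_Hset Hset_intros gen_W
      hadd_def hsmult_def)

lemma is_inverse_hmul:
  assumes "is_inverse h h'" "is_inverse g g'"
  shows "is_inverse (hmul n h g) (hmul n g' h')"
proof -
  note H = assms[unfolded is_inverse_def]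
  then have mem: "h \<in> Hset n" "h' \<in> Hset n" "g \<in> Hset n" "g' \<in> Hset n" by auto
  have "hmul n (hmul n h g) (hmul n g' h') = hmul n h (hmul n (hmul n g g') h')"
    by (simp only: hmul_assoc hmul_Hset mem)
  moreover have "hmul n (hmul n g' h') (hmul n h g) = hmul n g' (hmul n (hmul n h' h) g)"
    by (simp only: hmul_assoc hmul_Hset mem)
  ultimately show ?thesis using H by (simp add: is_inverse_def hmul_Hset)
qed

lemma hinv_eq:
  assumes "is_inverse h g"
  shows "hinv n h = g"
  unfolding hinv_def
proof (rule the_equality)
  note H = assms[unfolded is_inverse_def]
  show "g \<in> Hset n \<and> hmul n h g = Hb id \<and> hmul n g h = Hb id" using H by simp
  fix k assume k: "k \<in> Hset n \<and> hmul n h k = Hb id \<and> hmul n k h = Hb id"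
  then have "k = hmul n k (hmul n h g)" using H by simp
  also have "\<dots> = hmul n (hmul n k h) g" using H k hmul_assoc by metis
  also have "\<dots> = g" using H k by simp
  finally show "k = g" .
qed

definition Hbar :: "sperm \<Rightarrow> hecke" where
  "Hbar w = hinv n (Hb (inv w))"

lemma Hbar_inverse: "w \<in> W n \<Longrightarrow> is_inverse (Hb (inv w)) (Hbar w)"
proof -
  have "\<exists>g. is_inverse (Hb w) g" if "w \<in> W n" for w
    using that
  proof (induction rule: W_left_up_induct)
    case id
    have "is_inverse (Hb id) (Hb id)" by (simp add: is_inverse_def Hset_intros)
    then show ?case by blast
  next
    case (gen x i)
    then obtain g where "is_inverse (Hb x) g" by auto
    then show ?case
      using is_inverse_hmul[OF is_inverse_gen[OF gen(2)]] gen by (metis Hb_Hset Lmul_Hb hmul_gen_left)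
  qed
  then show "w \<in> W n \<Longrightarrow> is_inverse (Hb (inv w)) (Hbar w)"
    unfolding Hbar_def using inv_W hinv_eq by metis
qed

lemma Hbar_Hset: "w \<in> W n \<Longrightarrow> Hbar w \<in> Hset n"
  using Hbar_inverse by (auto simp: is_inverse_def)

lemma Hbar_id [simp]: "Hbar id = Hb id"
  unfolding Hbar_def by (rule hinv_eq) (simp add: is_inverse_def Hset_intros inv_id)

lemma Hbar_gen_right:
  assumes "w \<in> W n" "i < n" "len n w < len n (w \<circ> gen i)"
  shows "Hbar (w \<circ> gen i) = hmul n (Hbar w) (gen_inv i)"
proof -
  have "len n (inv w) < len n (gen i \<circ> inv w)"
    using len_inv[OF assms(1)] len_inv[of "w \<circ> gen i"] assms by (simp add: comp_gen_W_iff inv_comp_gen)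
  then have "hmul n (Hb (gen i)) (Hb (inv w)) = Hb (inv (w \<circ> gen i))"
    using assms by (simp add: hmul_gen_left Hb_Hset inv_W Lmul_Hb inv_comp_gen)
  then show ?thesis
    using is_inverse_hmul[OF is_inverse_gen[OF assms(2)] Hbar_inverse[OF assms(1)]] hinv_eq
    by (simp add: Hbar_def)
qed

lemma Hbar_gen_left:
  assumes "w \<in> W n" "i < n" "len n w < len n (gen i \<circ> w)"
  shows "Hbar (gen i \<circ> w) = hmul n (gen_inv i) (Hbar w)"
proof -
  have "len n (inv w) < len n (inv w \<circ> gen i)"
    using len_inv[OF assms(1)] len_inv[of "gen i \<circ> w"] assms by (simp add: gen_comp_W_iff inv_gen_comp)
  then have "hmul n (Hb (inv w)) (Hb (gen i)) = Hb (inv (gen i \<circ> w))"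
    using assms by (simp add: hmul_gen_right Hb_Hset inv_W mulHs_Hb inv_gen_comp)
  then show ?thesis
    using is_inverse_hmul[OF Hbar_inverse[OF assms(1)] is_inverse_gen[OF assms(2)]] hinv_eq
    by (simp add: Hbar_def)
qed

text \<open>Passing from w to ws multiplies by H_s - zeta on the right. Only the leading term H_w
  reaches ws; all other terms have length at most l(w).\<close>

lemma Hbar_triangular:
  "w \<in> W n \<Longrightarrow> Hbar w w = 1 \<and> (\<forall>x. Hbar w x \<noteq> 0 \<longrightarrow> x = w \<or> len n x < len n w)"
proof (induction rule: W_right_up_induct)
  case id
  have "Hbar id id = 1 \<and> (\<forall>x. Hbar id x \<noteq> 0 \<longrightarrow> x = id)" by (simp add: Hb_def)
  then show ?case by blast
next
  case (gen w i)
  have eq: "Hbar (w \<circ> gen i) = hadd (mulHs n (Hbar w) i) (hsmult (- zeta) (Hbar w))"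
    using Hbar_gen_right[OF gen(1-3)] hmul_gen_inv_right[OF gen(2) Hbar_Hset[OF gen(1)]] by simp
  have 0: "Hbar w x = 0" if "x \<noteq> w" "len n w \<le> len n x" for x
    using gen(4) that by (metis leD)
  have up: "len n (w \<circ> gen i) = len n w + 1" using len_right_cases[OF gen(1,2)] gen(3) by linarith
  have ne: "w \<circ> gen i \<noteq> w" using gen(3) by auto
  have wsW: "w \<circ> gen i \<in> W n" using gen by (simp add: comp_gen_W_iff)
  have "Hbar (w \<circ> gen i) (w \<circ> gen i) = 1"
    using gen(4) 0[OF ne] up wsW unfolding eq by (simp add: hadd_def hsmult_def mulHs_apply)
  moreover have "Hbar (w \<circ> gen i) x = 0" if x: "x \<noteq> w \<circ> gen i" "len n (w \<circ> gen i) \<le> len n x" for x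
  proof (cases "x \<in> W n")
    case True
    have "Hbar w x = 0" using x up by (intro 0) auto
    moreover have "Hbar w (x \<circ> gen i) = 0"
      using x up len_right_cases[OF True gen(2)] by (intro 0) (metis comp_gen_gen, linarith)
    ultimately show ?thesis unfolding eq by (simp add: hadd_def hsmult_def mulHs_apply)
  next
    case False
    then show ?thesis using Hbar_Hset[OF wsW] by (simp add: Hset_def)
  qed
  ultimately show ?case by (meson not_less)
qed

lemma hbar_eq: "hbar n h = hsum (\<lambda>w. hsmult (barL (h w)) (Hbar w)) (W n)"
  by (simp add: hbar_def Hbar_def)

lemma hbar_Hset: "hbar n h \<in> Hset n"
  unfolding hbar_eq by (intro Hset_intros Hbar_Hset)

lemma hbar_hadd: "hbar n (hadd h g) = hadd (hbar n h) (hbar n g)"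
  and hbar_hsmult: "hbar n (hsmult c h) = hsmult (barL c) (hbar n h)"
  by (auto simp: hbar_eq hsum_def hsmult_def hadd_def barL_add barL_mult sum.distrib sum_distrib_left algebra_simps)

lemma hbar_Hb: "w \<in> W n \<Longrightarrow> hbar n (Hb w) = Hbar w"
  using finite_W by (auto simp: hbar_eq hsum_def hsmult_def Hb_def if_distrib[of barL]
    if_distrib[of "\<lambda>c. c * _"] sum.delta cong: if_cong)

lemma semilinear_hsum:
  assumes "\<And>h g. T (hadd h g) = hadd (T h) (T g)" "\<And>c h. T (hsmult c h) = hsmult (barL c) (T h)" "finite A"
  shows "T (hsum (\<lambda>w. hsmult (c w) (f w)) A) = hsum (\<lambda>w. hsmult (barL (c w)) (T (f w))) A"
  using assms(3)
proof (induction A rule: finite_induct)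
  case empty
  show ?case using assms(2)[of 0 "\<lambda>_. 0"] by (simp add: hsum_simps)
qed (simp add: hsum_simps assms)

lemma semilinear_eqI:
  assumes T: "\<And>h g. T (hadd h g) = hadd (T h) (T g)" "\<And>c h. T (hsmult c h) = hsmult (barL c) (T h)"
    and S: "\<And>h g. S (hadd h g) = hadd (S h) (S g)" "\<And>c h. S (hsmult c h) = hsmult (barL c) (S h)"
    and "\<And>w. w \<in> W n \<Longrightarrow> T (Hb w) = S (Hb w)" "h \<in> Hset n"
  shows "T h = S h"
proof -
  have "T h = hsum (\<lambda>w. hsmult (barL (h w)) (T (Hb w))) (W n)"
    using arg_cong[OF Hset_expand[OF assms(6)], of T] by (simp only: semilinear_hsum[of T, OF T finite_W])
  moreover have "S h = hsum (\<lambda>w. hsmult (barL (h w)) (S (Hb w))) (W n)"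
    using arg_cong[OF Hset_expand[OF assms(6)], of S] by (simp only: semilinear_hsum[of S, OF S finite_W])
  ultimately show ?thesis using assms(5) by (simp add: hsum_def)
qed

text \<open>From $\zeta = q^{-1} - q$ one has $H_s^{-2} = 1 - \zeta H_s^{-1}$.\<close>
lemma hbar_mulHs:
  assumes "i < n" "h \<in> Hset n"
  shows "hbar n (mulHs n h i) = hmul n (hbar n h) (gen_inv i)"
proof (rule semilinear_eqI[of "\<lambda>h. hbar n (mulHs n h i)" "\<lambda>h. hmul n (hbar n h) (gen_inv i)"])
  fix w assume w: "w \<in> W n"
  show "hbar n (mulHs n (Hb w) i) = hmul n (hbar n (Hb w)) (gen_inv i)"
  proof (cases "len n (w \<circ> gen i) < len n w")
    case False
    then have "len n w < len n (w \<circ> gen i)" using len_right_cases[OF w assms(1)] by linarith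
    then show ?thesis using w assms by (simp add: mulHs_Hb hbar_Hb comp_gen_W_iff Hbar_gen_right)
  next
    case True
    define u where "u = w \<circ> gen i"
    have u: "u \<in> W n" "w = u \<circ> gen i" "len n u < len n (u \<circ> gen i)"
      using True w assms by (auto simp: u_def comp_gen_W_iff)
    define b where "b = Hbar u"
    have b: "b \<in> Hset n" using Hbar_Hset[OF u(1)] by (simp add: b_def)
    \<comment> \<open>With w = us, bar(H_w) = b H_s^{-1}, so right multiplication by H_s gives back
      b. Since H_w H_s = H_u + zeta H_w and bar(zeta) = -zeta, both sides of the claim become b -
      zeta bar(H_w).\<close>
    have inv: "mulHs n (hadd (mulHs n b i) (hsmult (- zeta) b)) i = b"
    proof -
      have "mulHs n (hmul n b (gen_inv i)) i = hmul n b (hmul n (gen_inv i) (Hb (gen i)))"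
        using b assms(1) by (simp flip: hmul_assoc hmul_gen_right add: hmul_Hset gen_inv_Hset Hb_Hset gen_W)
      then show ?thesis using is_inverse_gen[OF assms(1)] b assms(1)
        by (simp add: is_inverse_def hmul_gen_inv_right)
    qed
    have Bw: "Hbar w = hadd (mulHs n b i) (hsmult (- zeta) b)"
      using Hbar_gen_right[OF u(1) assms(1) u(3)] b assms(1) u(2) by (simp add: b_def hmul_gen_inv_right)
    have "hbar n (mulHs n (Hb w) i) = hadd b (hsmult (- zeta) (Hbar w))"
      using mulHs_Hb_down[OF w assms(1) True] w u(1)
      by (simp add: hbar_hadd hbar_hsmult hbar_Hb u_def[symmetric] b_def)
    also have "\<dots> = hmul n (Hbar w) (gen_inv i)"
      using hmul_gen_inv_right[OF assms(1) Hbar_Hset[OF w]] inv Bw by simp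
    finally show ?thesis using w by (simp add: hbar_Hb)
  qed
qed (auto simp: linear_opD[OF linear_op_mulHs] linear_opD[OF linear_op_hmul_left] hbar_hadd hbar_hsmult assms)

lemma hbar_Lmul:
  assumes "i < n" "h \<in> Hset n"
  shows "hbar n (Lmul i h) = hmul n (gen_inv i) (hbar n h)"
proof (rule semilinear_eqI[of "\<lambda>h. hbar n (Lmul i h)" "\<lambda>h. hmul n (gen_inv i) (hbar n h)"])
  fix w assume w: "w \<in> W n"
  show "hbar n (Lmul i (Hb w)) = hmul n (gen_inv i) (hbar n (Hb w))"
  proof (cases "len n (gen i \<circ> w) < len n w")
    case False
    then have "len n w < len n (gen i \<circ> w)" using len_left_cases[OF w assms(1)] by linarith
    then show ?thesis using w assms by (simp add: Lmul_Hb hbar_Hb gen_comp_W_iff Hbar_gen_left)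
  next
    case True
    define u where "u = gen i \<circ> w"
    have u: "u \<in> W n" "w = gen i \<circ> u" "len n u < len n (gen i \<circ> u)"
      using True w assms by (auto simp: u_def gen_comp_W_iff)
    define b where "b = Hbar u"
    have b: "b \<in> Hset n" using Hbar_Hset[OF u(1)] by (simp add: b_def)
    have inv: "Lmul i (hadd (Lmul i b) (hsmult (- zeta) b)) = b"
    proof -
      have "Lmul i (hmul n (gen_inv i) b) = hmul n (hmul n (Hb (gen i)) (gen_inv i)) b"
        using b assms(1) by (simp add: hmul_gen_left hmul_Lmul gen_inv_Hset)
      then show ?thesis using is_inverse_gen[OF assms(1)] b assms(1)
        by (simp add: is_inverse_def hmul_gen_inv_left)
    qed
    have Bw: "Hbar w = hadd (Lmul i b) (hsmult (- zeta) b)"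
      using Hbar_gen_left[OF u(1) assms(1) u(3)] b assms(1) u(2) by (simp add: b_def hmul_gen_inv_left)
    have "hbar n (Lmul i (Hb w)) = hadd b (hsmult (- zeta) (Hbar w))"
      using Lmul_Hb_down[OF w assms(1) True] w u(1)
      by (simp add: hbar_hadd hbar_hsmult hbar_Hb u_def[symmetric] b_def)
    also have "\<dots> = hmul n (gen_inv i) (Hbar w)"
      using hmul_gen_inv_left[OF assms(1) Hbar_Hset[OF w]] inv Bw by simp
    finally show ?thesis using w by (simp add: hbar_Hb)
  qed
qed (auto simp: linear_opD[OF linear_op_Lmul] linear_opD[OF linear_op_hmul_right] hbar_hadd hbar_hsmult assms)

lemma hmul_Cs_right: "i < n \<Longrightarrow> h \<in> Hset n \<Longrightarrow> hmul n h (Cs i) = hadd (mulHs n h i) (hsmult qq h)"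
  by (simp add: Cs_def linear_opD[OF linear_op_hmul_right] hmul_gen_right)

lemma hmul_Cs_left: "i < n \<Longrightarrow> h \<in> Hset n \<Longrightarrow> hmul n (Cs i) h = hadd (Lmul i h) (hsmult qq h)"
  by (simp add: Cs_def linear_opD[OF linear_op_hmul_left] hmul_gen_left)

text \<open>C_s is bar invariant: H_s^{-1} + q^{-1} = H_s - zeta + q^{-1} = H_s + q.\<close>

lemma hbar_Cs_right: "i < n \<Longrightarrow> h \<in> Hset n \<Longrightarrow> hbar n (hmul n h (Cs i)) = hmul n (hbar n h) (Cs i)"
  by (simp add: hmul_Cs_right hbar_hadd hbar_hsmult hbar_mulHs hmul_gen_inv_right hbar_Hset)
     (simp add: hadd_def hsmult_def zeta_def algebra_simps)

lemma hbar_Cs_left: "i < n \<Longrightarrow> h \<in> Hset n \<Longrightarrow> hbar n (hmul n (Cs i) h) = hmul n (Cs i) (hbar n h)"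
  by (simp add: hmul_Cs_left hbar_hadd hbar_hsmult hbar_Lmul hmul_gen_inv_left hbar_Hset)
     (simp add: hadd_def hsmult_def zeta_def algebra_simps)

end

section \<open>The parabolic module\<close>

lemma qq_nonzero [simp]: "qq \<noteq> 0"
  using qinv_qq(1) by (metis mult_zero_right zero_neq_one)

lemma in_qZq_0: "in_qZq 0"
  and in_qZq_diff: "in_qZq f \<Longrightarrow> in_qZq g \<Longrightarrow> in_qZq (f - g)"
  unfolding in_qZq_def lookup_minus by (simp, metis diff_self)

lemma in_qZq_qpow: "k > 0 \<Longrightarrow> in_qZq (qpow k)"
  by (auto simp: in_qZq_def qpow_def lookup_single when_def)

lemma in_qZq_barL_eq_0:
  assumes "in_qZq f" "barL f = f"
  shows "f = 0"
proof (rule poly_mapping_eqI)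
  fix k
  have "Poly_Mapping.lookup f (- k) = Poly_Mapping.lookup f k"
    using lookup_barL[of f k] assms(2) by simp
  then show "Poly_Mapping.lookup f k = Poly_Mapping.lookup 0 k"
    using assms(1) unfolding in_qZq_def by (metis less_asym lookup_zero neg_0_less_iff_less neg_less_0_iff_less)
qed

section \<open>Coefficient functionals on the parabolic module\<close>

context type_D
begin

definition sign_class :: "sperm \<Rightarrow> sperm set" where
  "sign_class v = {x \<in> W n. same_signs v x}"

lemma finite_sign_class: "finite (sign_class v)"
  by (rule finite_subset[OF _ finite_W]) (auto simp: sign_class_def)

text \<open>The coefficient of $N_v$ in $1 \otimes h$, multiplied by the unit $(-q)^{l(v)}$.\<close>
definition Phi :: "hecke \<Rightarrow> sperm \<Rightarrow> laur" where
  "Phi h v = (\<Sum>x\<in>sign_class v. (- qq) ^ len n x * h x)"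

lemma Phi_hadd: "Phi (hadd h g) v = Phi h v + Phi g v"
  and Phi_hsmult: "Phi (hsmult c h) v = c * Phi h v"
  by (auto simp: Phi_def hadd_def hsmult_def sum.distrib sum_distrib_left algebra_simps)

lemma Phi_hsum: "finite A \<Longrightarrow> Phi (hsum f A) v = (\<Sum>a\<in>A. Phi (f a) v)"
proof (induction A rule: finite_induct)
  case empty
  show ?case by (simp add: hsum_simps Phi_def)
qed (simp add: hsum_simps Phi_hadd)

text \<open>-q is a root of X^2 = zeta X + 1, the quadratic relation of H_s; it is the scalar by
  which H_s acts when C_s = H_s + q acts by zero.\<close>

lemma q_quadratic: "(- qq) ^ k + zeta * (- qq) ^ Suc k = - qq * (- qq) ^ Suc k"
  by (simp add: zeta_def algebra_simps)

text \<open>Reindexing by \<open>s\<close> puts the two terms at each x together, and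
  \<open>q_quadratic\<close> combines them. The abstract form, with \<open>d\<close> marking
  descents, serves both left multiplication by S_p and those right multiplications that keep the
  sign pattern.\<close>

lemma sum_quadratic_relation:
  assumes s: "\<And>x. x \<in> C \<Longrightarrow> s x \<in> C" "\<And>x. x \<in> C \<Longrightarrow> s (s x) = x"
    and l: "\<And>x. x \<in> C \<Longrightarrow> (d x \<and> l x = Suc (l (s x))) \<or> (\<not> d x \<and> l (s x) = Suc (l x))"
  shows "(\<Sum>x\<in>C. (- qq) ^ l x * (h (s x) + (if d x then zeta * h x else 0))) = - qq * (\<Sum>x\<in>C. (- qq) ^ l x * h x)"
proof -
  have "(\<Sum>x\<in>C. (- qq) ^ l x * h (s x)) = (\<Sum>x\<in>C. (- qq) ^ l (s x) * h x)"
    by (rule sum.reindex_bij_witness[of _ s s]) (use s in auto)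
  then have "(\<Sum>x\<in>C. (- qq) ^ l x * (h (s x) + (if d x then zeta * h x else 0))) =
    (\<Sum>x\<in>C. (- qq) ^ l (s x) * h x + (- qq) ^ l x * (if d x then zeta * h x else 0))"
    by (simp add: distrib_left sum.distrib)
  also have "\<dots> = (\<Sum>x\<in>C. - qq * ((- qq) ^ l x * h x))"
  proof (rule sum.cong)
    fix x assume "x \<in> C"
    consider "d x" "l x = Suc (l (s x))" | "\<not> d x" "l (s x) = Suc (l x)" using l[OF \<open>x \<in> C\<close>] by auto
    then show "(- qq) ^ l (s x) * h x + (- qq) ^ l x * (if d x then zeta * h x else 0) = - qq * ((- qq) ^ l x * h x)"
    proof cases
      case 1
      have "(- qq) ^ l (s x) * h x + (- qq) ^ l x * (if d x then zeta * h x else 0)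
        = ((- qq) ^ l (s x) + zeta * (- qq) ^ Suc (l (s x))) * h x"
        using 1 by (simp add: algebra_simps)
      also have "\<dots> = - qq * (- qq) ^ l x * h x" unfolding q_quadratic 1(2) ..
      finally show ?thesis by (simp only: mult.assoc)
    qed (simp add: algebra_simps)
  qed simp
  finally show ?thesis by (simp add: sum_distrib_left)
qed

text \<open>Left multiplication by s in S_p preserves every sign class, so the eigenvalue -q appears
  on each. Hence \<open>Phi\<close> vanishes on the right ideal generated by the C_s.\<close>

lemma Phi_Lmul:
  assumes "0 < i" "i < n"
  shows "Phi (Lmul i h) v = - qq * Phi h v"
proof -
  have "Phi (Lmul i h) v = (\<Sum>x\<in>sign_class v. (- qq) ^ len n x *
      (h (gen i \<circ> x) + (if len n (gen i \<circ> x) < len n x then zeta * h x else 0)))"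
    unfolding Phi_def by (rule sum.cong) (auto simp: Lmul_apply sign_class_def)
  also have "\<dots> = - qq * Phi h v"
    unfolding Phi_def
  proof (rule sum_quadratic_relation)
    fix x assume "x \<in> sign_class v"
    then have x: "x \<in> W n" "same_signs v x" by (auto simp: sign_class_def)
    then show "gen i \<circ> x \<in> sign_class v"
      using same_signs_gen_left[OF assms(1), of x] assms
      by (auto simp: sign_class_def gen_comp_W_iff intro: same_signs_trans same_signs_sym[THEN iffD1])
    show "(len n (gen i \<circ> x) < len n x \<and> len n x = Suc (len n (gen i \<circ> x))) \<or>
       (\<not> len n (gen i \<circ> x) < len n x \<and> len n (gen i \<circ> x) = Suc (len n x))"
      using len_left_cases[OF x(1) assms(2)] by simp
  qed simp
  finally show ?thesis .
qed

lemma Phi_mulHs_expand: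
  "Phi (mulHs n h i) v = (\<Sum>x\<in>sign_class v. (- qq) ^ len n x *
      (h (x \<circ> gen i) + (if len n (x \<circ> gen i) < len n x then zeta * h x else 0)))"
  unfolding Phi_def by (rule sum.cong) (auto simp: mulHs_apply sign_class_def)

lemma Phi_mulHs_same:
  assumes "v \<in> W n" "i < n" "v (lo i) > 0 \<longleftrightarrow> v (hi i) > 0"
  shows "Phi (mulHs n h i) v = - qq * Phi h v"
  unfolding Phi_mulHs_expand unfolding Phi_def
proof (rule sum_quadratic_relation)
  fix x assume "x \<in> sign_class v"
  then have x: "x \<in> W n" "same_signs v x" by (auto simp: sign_class_def)
  then have "same_signs (x \<circ> gen i) x"
    using assms(3) same_signs_gen_iff[OF x(1), of i] by (simp add: same_signs_def)
  then show "x \<circ> gen i \<in> sign_class v"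
    using x assms by (auto simp: sign_class_def comp_gen_W_iff intro: same_signs_trans same_signs_sym[THEN iffD1])
  show "(len n (x \<circ> gen i) < len n x \<and> len n x = Suc (len n (x \<circ> gen i))) \<or>
     (\<not> len n (x \<circ> gen i) < len n x \<and> len n (x \<circ> gen i) = Suc (len n x))"
    using len_right_cases[OF x(1) assms(2)] by simp
qed simp

lemma sign_class_gen:
  assumes "i < n" "x \<in> sign_class v"
  shows "x \<circ> gen i \<in> sign_class (v \<circ> gen i)"
  using assms by (auto simp: sign_class_def comp_gen_W_iff intro: same_signs_comp)

text \<open>All members of a sign class share the signs at \<open>lo i\<close> and
  \<open>hi i\<close>, so right multiplication by s moves the whole class to that of vs and raises
  every length by one. The factor -q accounts for the changed normalisation (-q)^l.\<close>

lemma Phi_mulHs_up: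
  assumes "v \<in> W n" "i < n" "v (lo i) < 0" "0 < v (hi i)"
  shows "- qq * Phi (mulHs n h i) v = Phi h (v \<circ> gen i)"
proof -
  have up: "len n (x \<circ> gen i) = Suc (len n x)" if "x \<in> sign_class v" for x
  proof -
    have "x \<in> W n" and s: "\<And>j. (0 < v j) = (0 < x j)"
      using that by (auto simp: sign_class_def same_signs_def)
    moreover have "\<not> x (lo i) > 0" "x (hi i) > 0" unfolding s[symmetric] using assms by auto
    ultimately show ?thesis using len_gen_up[of x i] assms by simp
  qed
  have "- qq * Phi (mulHs n h i) v = (\<Sum>x\<in>sign_class v. (- qq) ^ len n (x \<circ> gen i) * h (x \<circ> gen i))"
    unfolding Phi_mulHs_expand sum_distrib_left by (rule sum.cong) (auto simp: up)
  also have "\<dots> = Phi h (v \<circ> gen i)"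
    unfolding Phi_def
    by (rule sum.reindex_bij_witness[of _ "\<lambda>x. x \<circ> gen i" "\<lambda>x. x \<circ> gen i"])
       (use sign_class_gen[OF assms(2)] sign_class_gen[OF assms(2), where v = "v \<circ> gen i"] in auto)
  finally show ?thesis .
qed

lemma Phi_mulHs_down:
  assumes "v \<in> W n" "i < n" "0 < v (lo i)" "v (hi i) < 0"
  shows "Phi (mulHs n h i) v = - qq * Phi h (v \<circ> gen i) + zeta * Phi h v"
proof -
  have down: "len n x = Suc (len n (x \<circ> gen i))" if "x \<in> sign_class v" for x
  proof -
    have "x \<in> W n" and s: "\<And>j. (0 < v j) = (0 < x j)"
      using that by (auto simp: sign_class_def same_signs_def)
    moreover have "x (lo i) > 0" "\<not> x (hi i) > 0" unfolding s[symmetric] using assms by auto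
    ultimately show ?thesis using len_gen_down[of x i] assms by simp
  qed
  have "Phi (mulHs n h i) v = (\<Sum>x\<in>sign_class v. - qq * ((- qq) ^ len n (x \<circ> gen i) * h (x \<circ> gen i))
      + zeta * ((- qq) ^ len n x * h x))"
    unfolding Phi_mulHs_expand by (rule sum.cong) (auto simp: down algebra_simps)
  also have "\<dots> = - qq * (\<Sum>x\<in>sign_class v. (- qq) ^ len n (x \<circ> gen i) * h (x \<circ> gen i)) + zeta * Phi h v"
    unfolding Phi_def sum.distrib sum_distrib_left by simp
  also have "(\<Sum>x\<in>sign_class v. (- qq) ^ len n (x \<circ> gen i) * h (x \<circ> gen i)) = Phi h (v \<circ> gen i)"
    unfolding Phi_def
    by (rule sum.reindex_bij_witness[of _ "\<lambda>x. x \<circ> gen i" "\<lambda>x. x \<circ> gen i"])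
       (use sign_class_gen[OF assms(2)] sign_class_gen[OF assms(2), where v = "v \<circ> gen i"] in auto)
  finally show ?thesis .
qed

text \<open>This is the action of C_s on the standard basis, seen on coefficients: N_v C_s is N_{vs}
  + q N_v or N_{vs} + q^{-1} N_v if vs lies in W^p and is longer or shorter than v, and 0 if vs is
  not in W^p.\<close>

lemma Phi_Cs:
  assumes v: "v \<in> Wp n" and i: "i < n" and h: "h \<in> Hset n"
    and m: "\<And>u. u \<in> Wp n \<Longrightarrow> Phi h u = (- qq) ^ len n u * m u"
  shows "Phi (hmul n h (Cs i)) v = (- qq) ^ len n v *
    (if v (lo i) < 0 \<and> 0 < v (hi i) then m (v \<circ> gen i) + qq * m v
     else if 0 < v (lo i) \<and> v (hi i) < 0 then m (v \<circ> gen i) + qinv * m v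
     else 0)"
proof -
  note vW = Wp_W[OF v]
  have nz: "v (lo i) \<noteq> 0" "v (hi i) \<noteq> 0" using W_eq_0_iff[OF vW] lo_hi[of i] by auto
  have Phi: "Phi (hmul n h (Cs i)) v = Phi (mulHs n h i) v + qq * Phi h v"
    by (simp add: hmul_Cs_right i h Phi_hadd Phi_hsmult)
  consider "v (lo i) < 0" "0 < v (hi i)" | "0 < v (lo i)" "v (hi i) < 0" | "v (lo i) > 0 \<longleftrightarrow> v (hi i) > 0"
    using nz by linarith
  then show ?thesis
  proof cases
    case 1
    then have "v \<circ> gen i \<in> Wp n" using Wp_gen[OF v i] by simp
    moreover have "len n (v \<circ> gen i) = Suc (len n v)" using len_gen_up[OF vW i] 1 by simp
    ultimately have "- qq * Phi (hmul n h (Cs i)) v = - qq * ((- qq) ^ len n v * (m (v \<circ> gen i) + qq * m v))"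
      using Phi_mulHs_up[OF vW i 1, of h] m[OF v] m[of "v \<circ> gen i"]
      unfolding Phi by (simp add: algebra_simps)
    \<comment> \<open>The factor -q brought in by \<open>Phi_mulHs_up\<close> is cancelled.\<close>
    then have "Phi (hmul n h (Cs i)) v = (- qq) ^ len n v * (m (v \<circ> gen i) + qq * m v)"
      by (metis mult_cancel_left neg_equal_0_iff_equal qq_nonzero)
    then show ?thesis using 1 by simp
  next
    case 2
    then have "v \<circ> gen i \<in> Wp n" using Wp_gen[OF v i] by simp
    moreover have "len n v = Suc (len n (v \<circ> gen i))" using len_gen_down[OF vW i] 2 by simp
    ultimately have "Phi (hmul n h (Cs i)) v = (- qq) ^ len n v * (m (v \<circ> gen i) + qinv * m v)"
      using Phi_mulHs_down[OF vW i 2, of h] m[OF v] m[of "v \<circ> gen i"]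
      unfolding Phi by (simp add: zeta_def algebra_simps)
    then show ?thesis using 2 by simp
  next
    case 3
    then have "Phi (hmul n h (Cs i)) v = 0"
      using Phi_mulHs_same[OF vW i 3, of h] unfolding Phi by simp
    moreover have "\<not> (v (lo i) < 0 \<and> 0 < v (hi i))" "\<not> (0 < v (lo i) \<and> v (hi i) < 0)" using 3 by auto
    ultimately show ?thesis by (simp only: if_False mult_zero_right)
  qed
qed

section \<open>The kernel, congruence modulo it, and the bar involution on classes\<close>

lemma Hset_0 [simp]: "(\<lambda>_. 0) \<in> Hset n"
  by (simp add: Hset_def)

lemma Iker_iff:
  "k \<in> Iker n \<longleftrightarrow> (\<exists>g. (\<forall>i. g i \<in> Hset n) \<and> k = hsum (\<lambda>i. hmul n (Cs i) (g i)) {1..<n})"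
  by (auto simp: Iker_def)

lemma Iker_hadd:
  assumes "k \<in> Iker n" "k' \<in> Iker n"
  shows "hadd k k' \<in> Iker n"
proof -
  obtain g g' where g: "\<forall>i. g i \<in> Hset n" "k = hsum (\<lambda>i. hmul n (Cs i) (g i)) {1..<n}"
    and g': "\<forall>i. g' i \<in> Hset n" "k' = hsum (\<lambda>i. hmul n (Cs i) (g' i)) {1..<n}"
    using assms unfolding Iker_iff by auto
  have "hadd k k' = hsum (\<lambda>i. hmul n (Cs i) (hadd (g i) (g' i))) {1..<n}"
    using g g' by (simp add: linear_opD[OF linear_op_hmul_right] hsum_def) (simp add: hadd_def sum.distrib)
  then show ?thesis unfolding Iker_iff using g g' hadd_Hset
    by (intro exI[of _ "\<lambda>i. hadd (g i) (g' i)"]) auto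
qed

lemma Iker_hsmult:
  assumes "k \<in> Iker n"
  shows "hsmult c k \<in> Iker n"
proof -
  obtain g where g: "\<forall>i. g i \<in> Hset n" "k = hsum (\<lambda>i. hmul n (Cs i) (g i)) {1..<n}"
    using assms unfolding Iker_iff by auto
  have "hsmult c k = hsum (\<lambda>i. hmul n (Cs i) (hsmult c (g i))) {1..<n}"
    using g by (simp add: linear_opD[OF linear_op_hmul_right] hsum_def) (simp add: hsmult_def sum_distrib_left)
  then show ?thesis unfolding Iker_iff using g hsmult_Hset
    by (intro exI[of _ "\<lambda>i. hsmult c (g i)"]) auto
qed

lemma Iker_0 [simp]: "(\<lambda>_. 0) \<in> Iker n"
proof -
  have "(\<lambda>_. 0) = hsum (\<lambda>i. hmul n (Cs i) (\<lambda>_. 0)) {1..<n}"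
    by (simp add: linear_op_0[OF linear_op_hmul_right] hsum_def)
  then show ?thesis unfolding Iker_iff by (intro exI[of _ "\<lambda>_ _. 0"]) simp
qed

lemma Iker_Cs:
  assumes "0 < i" "i < n" "h \<in> Hset n"
  shows "hadd (Lmul i h) (hsmult qq h) \<in> Iker n"
proof -
  define g where "g = (\<lambda>j. if j = i then h else (\<lambda>_. 0))"
  have "hsum (\<lambda>j. hmul n (Cs j) (g j)) {1..<n} = (\<lambda>x. \<Sum>j\<in>{1..<n}. if j = i then hmul n (Cs i) h x else 0)"
    unfolding hsum_def g_def by (intro ext sum.cong) (auto simp: linear_op_0[OF linear_op_hmul_right])
  also have "\<dots> = hadd (Lmul i h) (hsmult qq h)"
    using assms by (simp add: hmul_Cs_left)
  finally show ?thesis unfolding Iker_iff using assms by (intro exI[of _ g]) (auto simp: g_def)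
qed

text \<open>Each C_s is bar invariant, so the bar involution maps the right ideal generated by them
  to itself and descends to N.\<close>

lemma Iker_hbar:
  assumes "k \<in> Iker n"
  shows "hbar n k \<in> Iker n"
proof -
  obtain g where g: "\<forall>i. g i \<in> Hset n" "k = hsum (\<lambda>i. hmul n (Cs i) (g i)) {1..<n}"
    using assms unfolding Iker_iff by auto
  have "k = hsum (\<lambda>i. hsmult 1 (hmul n (Cs i) (g i))) {1..<n}" using g by simp
  then have "hbar n k = hsum (\<lambda>i. hsmult (barL 1) (hbar n (hmul n (Cs i) (g i)))) {1..<n}"
    using semilinear_hsum[of "hbar n" "{1..<n}" "\<lambda>_. 1", OF hbar_hadd hbar_hsmult] by simp
  also have "\<dots> = hsum (\<lambda>i. hmul n (Cs i) (hbar n (g i))) {1..<n}"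
    using g by (simp add: hsum_def hbar_Cs_left)
  finally show ?thesis unfolding Iker_iff using hbar_Hset by (intro exI[of _ "\<lambda>i. hbar n (g i)"]) auto
qed

lemma Phi_Iker: "k \<in> Iker n \<Longrightarrow> Phi k v = 0"
  unfolding Iker_iff by (auto simp: Phi_hsum hmul_Cs_left Phi_hadd Phi_hsmult Phi_Lmul)

definition equivI :: "hecke \<Rightarrow> hecke \<Rightarrow> bool" where
  "equivI h g \<longleftrightarrow> (\<lambda>x. h x - g x) \<in> Iker n"

lemma equivI_refl [simp]: "equivI h h"
  by (simp add: equivI_def)

lemma equivI_sym: "equivI h g \<Longrightarrow> equivI g h"
  unfolding equivI_def using Iker_hsmult[of "\<lambda>x. h x - g x" "-1"] by (simp add: hsmult_def)

lemma equivI_hadd: "equivI h g \<Longrightarrow> equivI h' g' \<Longrightarrow> equivI (hadd h h') (hadd g g')"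
  unfolding equivI_def using Iker_hadd[of "\<lambda>x. h x - g x" "\<lambda>x. h' x - g' x"]
  by (simp add: hadd_def algebra_simps)

lemma equivI_trans: "equivI h g \<Longrightarrow> equivI g k \<Longrightarrow> equivI h k"
  unfolding equivI_def using Iker_hadd[of "\<lambda>x. h x - g x" "\<lambda>x. g x - k x"] by (simp add: hadd_def)

lemma equivI_hsmult: "equivI h g \<Longrightarrow> equivI (hsmult c h) (hsmult c g)"
  unfolding equivI_def using Iker_hsmult[of "\<lambda>x. h x - g x" c] by (simp add: hsmult_def algebra_simps)

lemma equivI_hbar:
  assumes "equivI h g"
  shows "equivI (hbar n h) (hbar n g)"
proof -
  have "(\<lambda>x. h x - g x) = hadd h (hsmult (-1) g)" by (simp add: hadd_def hsmult_def)
  moreover have "hbar n (hadd h (hsmult (-1) g)) = (\<lambda>x. hbar n h x - hbar n g x)"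
    unfolding hbar_hadd hbar_hsmult using barL_diff[of 0 1] by (simp add: hadd_def hsmult_def)
  ultimately show ?thesis using Iker_hbar assms by (metis equivI_def)
qed

lemma equivI_Phi: "equivI h g \<Longrightarrow> Phi h v = Phi g v"
  using Phi_Iker[of "\<lambda>x. h x - g x" v] by (simp add: equivI_def Phi_def sum_subtractf right_diff_distrib)

lemma Nclass_eq_iff: "h \<in> Hset n \<Longrightarrow> g \<in> Hset n \<Longrightarrow> Nclass n h = Nclass n g \<longleftrightarrow> equivI h g"
  unfolding Nclass_def equivI_def[symmetric]
  by (auto intro: equivI_trans equivI_sym)

text \<open>\<open>Nbar\<close> applies the involution to an arbitrarily chosen representative; by
  \<open>equivI_hbar\<close> another choice gives a congruent result.\<close>

lemma Nbar_Nclass: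
  assumes "h \<in> Hset n"
  shows "Nbar n (Nclass n h) = Nclass n (hbar n h)"
proof -
  define g where "g = (SOME g. g \<in> Nclass n h)"
  have "h \<in> Nclass n h" using assms by (simp add: Nclass_def)
  then have "g \<in> Nclass n h" unfolding g_def by (rule someI[of "\<lambda>g. g \<in> Nclass n h"])
  then have "equivI h g" by (simp add: Nclass_def equivI_def)
  then show ?thesis unfolding Nbar_def g_def[symmetric]
    using Nclass_eq_iff[OF hbar_Hset hbar_Hset] equivI_hbar equivI_sym by blast
qed

section \<open>The standard basis of the module\<close>

definition Nvec :: "(sperm \<Rightarrow> laur) \<Rightarrow> hecke" where
  "Nvec c = hsum (\<lambda>v. hsmult (c v) (Hb v)) (Wp n)"

lemma Ncomb_eq: "Ncomb n c = Nclass n (Nvec c)"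
  by (simp add: Ncomb_def Nvec_def)

lemma Nvec_Hset: "Nvec c \<in> Hset n"
  unfolding Nvec_def by (intro Hset_intros Wp_W)

lemma Nvec_add: "Nvec (\<lambda>v. c v + d v) = hadd (Nvec c) (Nvec d)"
  and Nvec_smult: "Nvec (\<lambda>v. a * c v) = hsmult a (Nvec c)"
  by (auto simp: Nvec_def hsum_def hsmult_def hadd_def sum.distrib sum_distrib_left algebra_simps)

lemma Phi_Hb: "x \<in> W n \<Longrightarrow> Phi (Hb x) v = (if same_signs v x then (- qq) ^ len n x else 0)"
  unfolding Phi_def Hb_def using finite_sign_class[of v]
  by (auto simp: if_distrib[of "\<lambda>c. _ * c"] sum.delta sign_class_def cong: if_cong)

lemma Phi_Nvec:
  assumes "v \<in> Wp n"
  shows "Phi (Nvec c) v = (- qq) ^ len n v * c v"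
proof -
  have "Phi (Nvec c) v = (\<Sum>u\<in>Wp n. c u * Phi (Hb u) v)"
    unfolding Nvec_def by (simp add: Phi_hsum finite_Wp Phi_hsmult)
  also have "\<dots> = (\<Sum>u\<in>Wp n. if u = v then (- qq) ^ len n v * c v else 0)"
    by (rule sum.cong) (use Wp_unique[OF assms] in \<open>auto simp: Phi_Hb Wp_W\<close>)
  also have "\<dots> = (- qq) ^ len n v * c v" using assms finite_Wp by simp
  finally show ?thesis .
qed

definition spanned :: "hecke \<Rightarrow> bool" where
  "spanned h \<longleftrightarrow> (\<exists>c. coeffs_on n c \<and> equivI h (Nvec c))"

lemma spanned_hadd: "spanned h \<Longrightarrow> spanned g \<Longrightarrow> spanned (hadd h g)"
  unfolding spanned_def
proof (elim exE conjE)
  fix c d assume "coeffs_on n c" "equivI h (Nvec c)" "coeffs_on n d" "equivI g (Nvec d)"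
  then show "\<exists>c. coeffs_on n c \<and> equivI (hadd h g) (Nvec c)"
    by (intro exI[of _ "\<lambda>v. c v + d v"]) (auto simp: coeffs_on_def Nvec_add equivI_hadd)
qed

lemma spanned_hsmult: "spanned h \<Longrightarrow> spanned (hsmult a h)"
  unfolding spanned_def
proof (elim exE conjE)
  fix c assume "coeffs_on n c" "equivI h (Nvec c)"
  then show "\<exists>c. coeffs_on n c \<and> equivI (hsmult a h) (Nvec c)"
    by (intro exI[of _ "\<lambda>v. a * c v"]) (auto simp: coeffs_on_def Nvec_smult equivI_hsmult)
qed

lemma spanned_equivI: "equivI h g \<Longrightarrow> spanned g \<Longrightarrow> spanned h"
  unfolding spanned_def using equivI_trans by blast

text \<open>If s in S_p shortens x and y = sx, then H_x = H_s H_y is congruent to -q H_y; the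
  descent ends at a minimal representative.\<close>

lemma spanned_Hb: "x \<in> W n \<Longrightarrow> spanned (Hb x)"
proof (induction "len n x" arbitrary: x rule: less_induct)
  case less
  show ?case
  proof (cases "x \<in> Wp n")
    case True
    have "Nvec (Hb x) = Hb x"
      using True finite_Wp by (auto simp: Nvec_def hsum_def hsmult_def Hb_def if_distrib[of "\<lambda>c. c * _"] sum.delta cong: if_cong)
    then show ?thesis unfolding spanned_def using True
      by (intro exI[of _ "Hb x"]) (auto simp: coeffs_on_def Hb_def)
  next
    case False
    then obtain i where i: "1 \<le> i" "i < n" "\<not> len n (gen i \<circ> x) > len n x"
      using less(2) by (auto simp: Wp_def)
    then have l: "len n (gen i \<circ> x) < len n x" using len_left_cases[OF less(2), of i] by auto
    define y where "y = gen i \<circ> x"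
    have y: "y \<in> W n" "x = gen i \<circ> y" "len n y < len n (gen i \<circ> y)"
      using less(2) i l by (auto simp: y_def gen_comp_W_iff)
    have "hadd (Hb x) (hsmult qq (Hb y)) \<in> Iker n"
      using Iker_Cs[of i "Hb y"] i y by (simp add: Lmul_Hb Hb_Hset)
    then have "equivI (Hb x) (hsmult (- qq) (Hb y))"
      by (simp add: equivI_def hadd_def hsmult_def)
    moreover have "spanned (Hb y)" using less(1) l y(1) unfolding y_def by blast
    ultimately show ?thesis using spanned_equivI spanned_hsmult by blast
  qed
qed

lemma spanned_Hset:
  assumes "h \<in> Hset n"
  shows "spanned h"
proof -
  have "spanned (hsum (\<lambda>w. hsmult (h w) (Hb w)) A)" if "finite A" "A \<subseteq> W n" for A
    using that
  proof (induction A rule: finite_induct)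
    case empty
    have "Nvec (\<lambda>_. 0) = (\<lambda>_. 0)" by (simp add: Nvec_def hsum_def)
    then show ?case unfolding spanned_def hsum_simps
      by (intro exI[of _ "\<lambda>_. 0"]) (auto simp: coeffs_on_def)
  qed (auto simp: hsum_simps intro: spanned_hadd spanned_hsmult spanned_Hb)
  from this[OF finite_W] show ?thesis using Hset_expand[OF assms] by simp
qed

text \<open>Spanning provides some coefficients for the class of \<open>h\<close>, and the
  functionals \<open>Phi\<close> force them to be \<open>m\<close>.\<close>

lemma Ncomb_eq_Nclass:
  assumes "h \<in> Hset n" "coeffs_on n m" "\<And>v. v \<in> Wp n \<Longrightarrow> Phi h v = (- qq) ^ len n v * m v"
  shows "Ncomb n m = Nclass n h"
proof -
  obtain c where c: "coeffs_on n c" "equivI h (Nvec c)"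
    using spanned_Hset[OF assms(1)] by (auto simp: spanned_def)
  have "c = m"
  proof
    fix v show "c v = m v"
      using equivI_Phi[OF c(2), of v] assms(2,3) c(1) Phi_Nvec[of v c]
      by (cases "v \<in> Wp n") (auto simp: coeffs_on_def)
  qed
  then show ?thesis unfolding Ncomb_eq using c Nclass_eq_iff[OF Nvec_Hset assms(1)] equivI_sym by blast
qed

lemma Ncomb_inj:
  assumes "coeffs_on n c" "coeffs_on n d" "Ncomb n c = Ncomb n d"
  shows "c = d"
proof
  fix v
  have "equivI (Nvec c) (Nvec d)"
    using assms(3) Nclass_eq_iff[OF Nvec_Hset Nvec_Hset] by (simp add: Ncomb_eq)
  from equivI_Phi[OF this, of v] show "c v = d v"
    using assms(1,2) Phi_Nvec[of v] by (cases "v \<in> Wp n") (auto simp: coeffs_on_def)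
qed

text \<open>Every x in the class of v has l(x) >= l(v) >= l(u), whereas bar(H_u) is supported on u
  and on elements shorter than u. Only x = u can contribute.\<close>

lemma Phi_Hbar:
  assumes u: "u \<in> Wp n" and v: "v \<in> Wp n" and le: "len n u \<le> len n v"
  shows "Phi (Hbar u) v = (if u = v then (- qq) ^ len n v else 0)"
proof -
  have "Phi (Hbar u) v = (\<Sum>x\<in>sign_class v. if x = u then (- qq) ^ len n u else 0)"
    unfolding Phi_def
  proof (rule sum.cong)
    fix x assume "x \<in> sign_class v"
    then have "len n u \<le> len n x" using Wp_minimal[OF v, of x] le by (auto simp: sign_class_def)
    then show "(- qq) ^ len n x * Hbar u x = (if x = u then (- qq) ^ len n u else 0)"
      using Hbar_triangular[OF Wp_W[OF u]] by (auto simp: leD)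
  qed simp
  also have "\<dots> = (if u = v then (- qq) ^ len n v else 0)"
    using Wp_unique[OF v u] Wp_W[OF u] finite_sign_class[of v] by (auto simp: sign_class_def)
  finally show ?thesis .
qed

text \<open>At a v of maximal length with d(v) nonzero, the bar of the combination has coefficient
  bar(d(v)). So d(v) is bar invariant, and an element of qZ[q] with this property is zero.\<close>

lemma bar_invariant_in_qZq_eq_0:
  assumes d: "coeffs_on n d" "\<And>v. v \<in> Wp n \<Longrightarrow> in_qZq (d v)" and inv: "equivI (hbar n (Nvec d)) (Nvec d)"
  shows "d = (\<lambda>_. 0)"
proof (rule ccontr)
  assume "d \<noteq> (\<lambda>_. 0)"
  define A where "A = {v \<in> Wp n. d v \<noteq> 0}"
  have "finite A" "A \<noteq> {}"
    using \<open>d \<noteq> (\<lambda>_. 0)\<close> d(1) finite_Wp by (auto simp: A_def coeffs_on_def)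
  then obtain v where v: "v \<in> A" "\<And>u. u \<in> A \<Longrightarrow> len n u \<le> len n v"
    using Max_in[of "len n ` A"] Max_ge[of "len n ` A"] by (metis (no_types, lifting) finite_imageI imageE imageI image_is_empty)
  have vW: "v \<in> Wp n" "d v \<noteq> 0" using v by (auto simp: A_def)
  have "hbar n (Nvec d) = hsum (\<lambda>u. hsmult (barL (d u)) (hbar n (Hb u))) (Wp n)"
    unfolding Nvec_def by (rule semilinear_hsum[OF hbar_hadd hbar_hsmult finite_Wp])
  then have "Phi (hbar n (Nvec d)) v = (\<Sum>u\<in>Wp n. barL (d u) * Phi (Hbar u) v)"
    by (simp add: Phi_hsum finite_Wp Phi_hsmult hbar_Hb Wp_W)
  also have "\<dots> = (\<Sum>u\<in>Wp n. if u = v then barL (d v) * (- qq) ^ len n v else 0)"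
  proof (rule sum.cong)
    fix u assume u: "u \<in> Wp n"
    show "barL (d u) * Phi (Hbar u) v = (if u = v then barL (d v) * (- qq) ^ len n v else 0)"
    proof (cases "d u = 0")
      case False
      then show ?thesis using Phi_Hbar[OF u vW(1)] v(2)[of u] u by (auto simp: A_def)
    qed (use vW in auto)
  qed simp
  also have "\<dots> = (- qq) ^ len n v * barL (d v)" using vW finite_Wp by simp
  finally have "(- qq) ^ len n v * barL (d v) = (- qq) ^ len n v * d v"
    using equivI_Phi[OF inv, of v] Phi_Nvec[OF vW(1)] by simp
  then have "barL (d v) = d v" by simp
  then show False using in_qZq_barL_eq_0 d(2) vW by blast
qed

text \<open>The difference of two candidates for the Kazhdan-Lusztig element is bar invariant with
  all coefficients in qZ[q], hence zero. This evaluates the definite description in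
  \<open>KLN\<close>, and the independence of the N_v evaluates the one in
  \<open>nKL\<close>.\<close>

theorem nKL_eqI:
  assumes w: "w \<in> Wp n" and h: "h \<in> Hset n" "hbar n h = h"
    and m: "coeffs_on n m" "\<And>v. v \<in> Wp n \<Longrightarrow> Phi h v = (- qq) ^ len n v * m v"
    and mw: "m w = 1" "\<And>v. v \<in> Wp n \<Longrightarrow> v \<noteq> w \<Longrightarrow> in_qZq (m v)"
  shows "nKL n v w = m v"
proof -
  note Nm = Ncomb_eq_Nclass[OF h(1) m]
  have bar: "Nbar n (Ncomb n m) = Ncomb n m"
    using Nbar_Nclass[OF h(1)] h(2) by (simp add: Nm)
  have inv: "equivI (hbar n (Nvec c)) (Nvec c)" if "Nbar n (Ncomb n c) = Ncomb n c" for c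
    using that Nbar_Nclass[OF Nvec_Hset] Nclass_eq_iff[OF hbar_Hset Nvec_Hset] by (simp add: Ncomb_eq)
  have "KLN n w = Ncomb n m"
    unfolding KLN_def
  proof (rule the_equality)
    show "Ncomb n m \<in> Nmod n \<and> Nbar n (Ncomb n m) = Ncomb n m \<and>
      (\<exists>c. coeffs_on n c \<and> c w = 1 \<and> (\<forall>v\<in>Wp n. v \<noteq> w \<longrightarrow> in_qZq (c v)) \<and> Ncomb n m = Ncomb n c)"
      using bar m mw Nvec_Hset by (auto simp: Nmod_def Ncomb_eq)
    fix X assume "X \<in> Nmod n \<and> Nbar n X = X \<and>
      (\<exists>c. coeffs_on n c \<and> c w = 1 \<and> (\<forall>v\<in>Wp n. v \<noteq> w \<longrightarrow> in_qZq (c v)) \<and> X = Ncomb n c)"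
    then obtain c where c: "coeffs_on n c" "c w = 1" "\<And>v. v \<in> Wp n \<Longrightarrow> v \<noteq> w \<Longrightarrow> in_qZq (c v)"
      "X = Ncomb n c" "Nbar n (Ncomb n c) = Ncomb n c" by auto
    define d where "d = (\<lambda>v. c v + (-1) * m v)"
    have Nd: "Nvec d = hadd (Nvec c) (hsmult (-1) (Nvec m))"
      unfolding d_def Nvec_add Nvec_smult by simp
    have "barL (-1) = -1" using barL_diff[of 0 1] by simp
    then have "hbar n (Nvec d) = hadd (hbar n (Nvec c)) (hsmult (-1) (hbar n (Nvec m)))"
      unfolding Nd hbar_hadd hbar_hsmult by simp
    then have "equivI (hbar n (Nvec d)) (Nvec d)"
      unfolding Nd using inv[OF c(5)] inv[OF bar] by (auto intro: equivI_hadd equivI_hsmult)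
    moreover have "coeffs_on n d" using c(1) m(1) by (auto simp: coeffs_on_def d_def)
    moreover have "in_qZq (d v)" if "v \<in> Wp n" for v
      using that c(2,3) mw in_qZq_diff[of "c v" "m v"] in_qZq_0 by (cases "v = w") (auto simp: d_def)
    ultimately have "d = (\<lambda>_. 0)" by (rule bar_invariant_in_qZq_eq_0[rotated 2])
    then have "c = m" by (auto simp: d_def fun_eq_iff)
    then show "X = Ncomb n m" using c(4) by simp
  qed
  then have "(THE c. coeffs_on n c \<and> KLN n w = Ncomb n c) = m"
    using m(1) Ncomb_inj by (intro the_equality) auto
  then show ?thesis by (simp add: nKL_def)
qed

end

section \<open>Noncrossing matchings\<close>

definition noncrossing_matching :: "int set \<Rightarrow> (int \<Rightarrow> bool) \<Rightarrow> (int \<times> int) set \<Rightarrow> bool" where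
  "noncrossing_matching P \<sigma> A \<longleftrightarrow>
      (\<forall>(a,b)\<in>A. a \<in> P \<and> b \<in> P \<and> a < b \<and> \<sigma> a \<and> \<not> \<sigma> b) \<and>
      (\<forall>j\<in>P. \<exists>!p. p \<in> A \<and> (fst p = j \<or> snd p = j)) \<and>
      (\<forall>(a,b)\<in>A. \<forall>(c,d)\<in>A. \<not> (a < c \<and> c < b \<and> b < d))"

lemma noncrossing_matchingD:
  assumes "noncrossing_matching P \<sigma> A"
  shows "(a, b) \<in> A \<Longrightarrow> a \<in> P \<and> b \<in> P \<and> a < b \<and> \<sigma> a \<and> \<not> \<sigma> b"
    and "(a, b) \<in> A \<Longrightarrow> (c, d) \<in> A \<Longrightarrow> a < c \<Longrightarrow> c < b \<Longrightarrow> b < d \<Longrightarrow> False"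
    and "(a, b) \<in> A \<Longrightarrow> (a, d) \<in> A \<Longrightarrow> b = d"
    and "(a, b) \<in> A \<Longrightarrow> (c, b) \<in> A \<Longrightarrow> a = c"
    and "a \<in> P \<Longrightarrow> \<sigma> a \<Longrightarrow> \<exists>b. (a, b) \<in> A"
    and "b \<in> P \<Longrightarrow> \<not> \<sigma> b \<Longrightarrow> \<exists>a. (a, b) \<in> A"
proof -
  show 1: "a \<in> P \<and> b \<in> P \<and> a < b \<and> \<sigma> a \<and> \<not> \<sigma> b" if "(a, b) \<in> A" for a b
    using assms that unfolding noncrossing_matching_def by blast
  show "(a, b) \<in> A \<Longrightarrow> (c, d) \<in> A \<Longrightarrow> a < c \<Longrightarrow> c < b \<Longrightarrow> b < d \<Longrightarrow> False"
    using assms unfolding noncrossing_matching_def by blast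
  have 2: "\<exists>!p. p \<in> A \<and> (fst p = j \<or> snd p = j)" if "j \<in> P" for j
    using assms that unfolding noncrossing_matching_def by blast
  show "(a, b) \<in> A \<Longrightarrow> (a, d) \<in> A \<Longrightarrow> b = d"
    using 1[of a b] 2[of a] by (metis fst_conv snd_conv)
  show "(a, b) \<in> A \<Longrightarrow> (c, b) \<in> A \<Longrightarrow> a = c"
    using 1[of a b] 2[of b] by (metis fst_conv snd_conv)
  show "a \<in> P \<Longrightarrow> \<sigma> a \<Longrightarrow> \<exists>b. (a, b) \<in> A"
    using 1 2[of a] by (metis prod.collapse)
  show "b \<in> P \<Longrightarrow> \<not> \<sigma> b \<Longrightarrow> \<exists>a. (a, b) \<in> A"
    using 1 2[of b] by (metis prod.collapse)
qed

text \<open>Induction on the length of the arc. If \<open>B\<close> matched a differently, some end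
  of a \<open>B\<close>-arc strictly inside (a, b) would carry a shorter \<open>A\<close>-arc; by
  induction that arc is in \<open>B\<close> and conflicts with the \<open>B\<close>-arc already
  there.\<close>

lemma noncrossing_matching_subset:
  assumes A: "noncrossing_matching P \<sigma> A" and B: "noncrossing_matching P \<sigma> B"
  shows "(a, b) \<in> A \<Longrightarrow> (a, b) \<in> B"
proof (induction "nat (b - a)" arbitrary: a b rule: less_induct)
  case less
  note AD = noncrossing_matchingD[OF A] and BD = noncrossing_matchingD[OF B]
  have ab: "a \<in> P" "b \<in> P" "a < b" "\<sigma> a" "\<not> \<sigma> b" using AD(1)[OF less(2)] by auto
  obtain b' where b': "(a, b') \<in> B" using BD(5) ab by blast
  obtain a' where a': "(a', b) \<in> B" using BD(6) ab by blast
  note Bb' = BD(1)[OF b'] and Ba' = BD(1)[OF a']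
  consider "b' = b" | "b' < b" | "b < b'" by linarith
  then show ?case
  proof cases
    case 2
    obtain c where c: "(c, b') \<in> A" using AD(6) Bb' by blast
    then have "c \<noteq> a" using AD(3)[OF less(2), of b'] 2 by auto
    moreover have "\<not> c < a" using AD(2)[OF c less(2)] Bb' 2 by auto
    ultimately have "(c, b') \<in> B" using less(1)[of b' c] c AD(1)[OF c] 2 ab(3) by auto
    then show ?thesis using BD(4)[OF b'] \<open>c \<noteq> a\<close> by blast
  next
    case 3
    have "a' \<noteq> a" using BD(3)[OF b', of b] a' 3 by auto
    moreover have "\<not> a' < a" using BD(2)[OF a' b'] ab 3 by auto
    ultimately have "a < a'" "a' < b" using Ba' by auto
    obtain d where d: "(a', d) \<in> A" using AD(5) Ba' by blast
    have "d \<noteq> b" using AD(4)[OF less(2), of a'] d \<open>a' \<noteq> a\<close> by auto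
    moreover have "\<not> b < d" using AD(2)[OF less(2) d] \<open>a < a'\<close> \<open>a' < b\<close> by auto
    ultimately have "(a', d) \<in> B" using less(1)[of d a'] d \<open>a < a'\<close> AD(1)[OF d] by auto
    then show ?thesis using BD(3)[OF a'] \<open>d \<noteq> b\<close> by blast
  qed (use b' in simp)
qed

lemma noncrossing_matching_unique:
  "noncrossing_matching P \<sigma> A \<Longrightarrow> noncrossing_matching P \<sigma> B \<Longrightarrow> A = B"
  using noncrossing_matching_subset by (metis subsetI subset_antisym surj_pair)

lemma noncrossing_matching_involution:
  assumes inv: "\<And>a. a \<in> P \<Longrightarrow> \<rho> a \<in> P \<and> \<rho> a \<noteq> a \<and> \<rho> (\<rho> a) = a"
    and sgn: "\<And>a. a \<in> P \<Longrightarrow> a < \<rho> a \<Longrightarrow> \<sigma> a \<and> \<not> \<sigma> (\<rho> a)"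
    and nc: "\<And>a c. a \<in> P \<Longrightarrow> c \<in> P \<Longrightarrow> a < c \<Longrightarrow> c < \<rho> a \<Longrightarrow> \<rho> a < \<rho> c \<Longrightarrow> False"
  shows "noncrossing_matching P \<sigma> {(a, \<rho> a) | a. a \<in> P \<and> a < \<rho> a}"
  unfolding noncrossing_matching_def
proof (intro conjI ballI)
  fix j assume j: "j \<in> P"
  show "\<exists>!p. p \<in> {(a, \<rho> a) | a. a \<in> P \<and> a < \<rho> a} \<and> (fst p = j \<or> snd p = j)"
  proof (rule ex1I[of _ "if j < \<rho> j then (j, \<rho> j) else (\<rho> j, j)"])
    show "(if j < \<rho> j then (j, \<rho> j) else (\<rho> j, j)) \<in> {(a, \<rho> a) | a. a \<in> P \<and> a < \<rho> a} \<and>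
      (fst (if j < \<rho> j then (j, \<rho> j) else (\<rho> j, j)) = j \<or> snd (if j < \<rho> j then (j, \<rho> j) else (\<rho> j, j)) = j)"
      using inv[OF j] j by auto
    fix p assume p: "p \<in> {(a, \<rho> a) | a. a \<in> P \<and> a < \<rho> a} \<and> (fst p = j \<or> snd p = j)"
    then obtain a where a: "p = (a, \<rho> a)" "a \<in> P" "a < \<rho> a" by auto
    then show "p = (if j < \<rho> j then (j, \<rho> j) else (\<rho> j, j))"
      using p inv[OF a(2)] by auto
  qed
qed (use inv sgn nc in fastforce)+

text \<open>Half of a symmetric cup diagram on $\{1, \dots, N\}$, as the involution $\pi$ exchanging the
  ends of each cup. Since every right end is labeled $-$, a cup is dotted (comes from a
  linked pair) iff its left end is labeled $-$; dotted cups are not nested inside other cups.\<close>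
definition half_matching :: "int \<Rightarrow> (int \<Rightarrow> bool) \<Rightarrow> (int \<Rightarrow> int) \<Rightarrow> bool" where
  "half_matching N \<sigma> \<pi> \<longleftrightarrow>
     (\<forall>x\<in>{1..N}. \<pi> x \<in> {1..N} \<and> \<pi> x \<noteq> x \<and> \<pi> (\<pi> x) = x) \<and>
     (\<forall>x\<in>{1..N}. x < \<pi> x \<longrightarrow> \<not> \<sigma> (\<pi> x)) \<and>
     (\<forall>x\<in>{1..N}. \<forall>y\<in>{1..N}. \<not> (x < y \<and> y < \<pi> x \<and> \<pi> x < \<pi> y)) \<and>
     (\<forall>x\<in>{1..N}. \<forall>y\<in>{1..N}. y < \<pi> y \<and> \<not> \<sigma> y \<longrightarrow> \<not> (x < y \<and> y < \<pi> x))"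

lemma half_matchingD:
  assumes "half_matching N \<sigma> \<pi>" "x \<in> {1..N}"
  shows "\<pi> x \<in> {1..N}" "\<pi> x \<noteq> x" "\<pi> (\<pi> x) = x" "x < \<pi> x \<Longrightarrow> \<not> \<sigma> (\<pi> x)" "\<pi> x < x \<Longrightarrow> \<not> \<sigma> x"
    and "y \<in> {1..N} \<Longrightarrow> x < y \<Longrightarrow> y < \<pi> x \<Longrightarrow> \<pi> x < \<pi> y \<Longrightarrow> False"
    and "y \<in> {1..N} \<Longrightarrow> y < \<pi> y \<Longrightarrow> \<not> \<sigma> y \<Longrightarrow> x < y \<Longrightarrow> y < \<pi> x \<Longrightarrow> False"
proof -
  show inv: "\<pi> x \<in> {1..N}" "\<pi> x \<noteq> x" "\<pi> (\<pi> x) = x" using assms unfolding half_matching_def by blast+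
  show "x < \<pi> x \<Longrightarrow> \<not> \<sigma> (\<pi> x)" using assms unfolding half_matching_def by blast
  show "\<pi> x < x \<Longrightarrow> \<not> \<sigma> x" using inv assms unfolding half_matching_def by metis
  show "y \<in> {1..N} \<Longrightarrow> x < y \<Longrightarrow> y < \<pi> x \<Longrightarrow> \<pi> x < \<pi> y \<Longrightarrow> False"
    using assms unfolding half_matching_def by blast
  show "y \<in> {1..N} \<Longrightarrow> y < \<pi> y \<Longrightarrow> \<not> \<sigma> y \<Longrightarrow> x < y \<Longrightarrow> y < \<pi> x \<Longrightarrow> False"
    using assms unfolding half_matching_def by blast
qed

definition between :: "int \<Rightarrow> int \<Rightarrow> int \<Rightarrow> bool" where
  "between a b t \<longleftrightarrow> a < t \<and> t < b \<or> b < t \<and> t < a"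

lemma between_commute: "between a b t \<longleftrightarrow> between b a t"
  by (auto simp: between_def)

text \<open>Surgery can turn left ends into right ends, so noncrossing is restated here without
  reference to which end of a cup is the left one.\<close>

lemma half_matching_between:
  assumes hm: "half_matching N \<sigma> \<pi>" and s: "s \<in> {1..N}" and t: "t \<in> {1..N}" and "t \<noteq> s" "t \<noteq> \<pi> s"
  shows "between s (\<pi> s) t \<longleftrightarrow> between s (\<pi> s) (\<pi> t)"
proof -
  note D = half_matchingD[OF hm]
  have step: "between s (\<pi> s) (\<pi> t)"
    if s: "s \<in> {1..N}" and t: "t \<in> {1..N}" and ne: "t \<noteq> s" "t \<noteq> \<pi> s" and b: "s < t" "t < \<pi> s" for s t
  proof (rule ccontr)
    assume "\<not> between s (\<pi> s) (\<pi> t)"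
    moreover have "\<pi> t \<noteq> s" "\<pi> t \<noteq> \<pi> s" using D(3)[OF s] D(3)[OF t] ne by auto
    ultimately have "\<pi> t < s \<or> \<pi> s < \<pi> t" using b by (auto simp: between_def)
    then show False
      using D(6)[OF s t] D(6)[OF D(1)[OF t] s] D(3)[OF t] b by auto
  qed
  have all: "between s (\<pi> s) t \<Longrightarrow> between s (\<pi> s) (\<pi> t)"
    if "s \<in> {1..N}" "t \<in> {1..N}" "t \<noteq> s" "t \<noteq> \<pi> s" for s t
    using step[OF that] step[OF D(1)[OF that(1)] that(2) that(4)] D(3)[OF that(1)] that
    by (auto simp: between_def)
  have "\<pi> t \<noteq> s" "\<pi> t \<noteq> \<pi> s" using D(3)[OF s] D(3)[OF t] assms(4,5) by auto
  then show ?thesis using all[OF s t assms(4,5)] all[OF s D(1)[OF t]] D(3)[OF t] by auto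
qed

text \<open>The definition keeps only the left end of a dotted cup from lying under another cup;
  noncrossing extends this to the right end.\<close>

lemma half_matching_unnested:
  assumes hm: "half_matching N \<sigma> \<pi>" and y: "y \<in> {1..N}" "\<not> \<sigma> y" "\<not> \<sigma> (\<pi> y)" and x: "x \<in> {1..N}"
  shows "\<not> (x < y \<and> y < \<pi> x)"
proof
  assume xy: "x < y \<and> y < \<pi> x"
  note D = half_matchingD[OF hm]
  show False
  proof (cases "y < \<pi> y")
    case True
    then show ?thesis using D(7)[OF x y(1)] y xy by auto
  next
    case False
    then have l: "\<pi> y < y" using D(2)[OF y(1)] by auto
    have ne: "\<pi> y \<noteq> x" "y \<noteq> x" "y \<noteq> \<pi> x" using D(3)[OF y(1)] xy by auto
    have "between x (\<pi> x) (\<pi> y)"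
      using half_matching_between[OF hm x y(1) ne(2,3)] xy by (auto simp: between_def)
    then have "x < \<pi> y" "\<pi> y < \<pi> x" using xy by (auto simp: between_def)
    then show ?thesis using D(7)[OF x D(1)[OF y(1)]] D(3)[OF y(1)] l y by auto
  qed
qed

lemma half_matchingI:
  assumes "\<And>x. x \<in> {1..N} \<Longrightarrow> \<pi> x \<in> {1..N} \<and> \<pi> x \<noteq> x \<and> \<pi> (\<pi> x) = x"
    and "\<And>x. x \<in> {1..N} \<Longrightarrow> x < \<pi> x \<Longrightarrow> \<not> \<sigma> (\<pi> x)"
    and bt: "\<And>x y. x \<in> {1..N} \<Longrightarrow> y \<in> {1..N} \<Longrightarrow> y \<noteq> x \<Longrightarrow> y \<noteq> \<pi> x \<Longrightarrow>
      between x (\<pi> x) y = between x (\<pi> x) (\<pi> y)"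
    and "\<And>x y. x \<in> {1..N} \<Longrightarrow> y \<in> {1..N} \<Longrightarrow> y < \<pi> y \<Longrightarrow> \<not> \<sigma> y \<Longrightarrow> x < y \<Longrightarrow> y < \<pi> x \<Longrightarrow> False"
  shows "half_matching N \<sigma> \<pi>"
  unfolding half_matching_def
proof (intro conjI ballI notI impI)
  fix x y assume "x \<in> {1..N}" "y \<in> {1..N}" "x < y \<and> y < \<pi> x \<and> \<pi> x < \<pi> y"
  then show False using bt[of x y] by (auto simp: between_def)
qed (use assms in blast)+

text \<open>Passing from $w$ to $ws$ changes the labels of the adjacent points $p$, $r$; they get
  joined, and so do their former partners. This is multiplication by a Temperley--Lieb generator.\<close>
definition surgery :: "int \<Rightarrow> int \<Rightarrow> (int \<Rightarrow> int) \<Rightarrow> int \<Rightarrow> int" where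
  "surgery p r \<pi> = \<pi>(p := r, r := p, \<pi> p := \<pi> r, \<pi> r := \<pi> p)"

text \<open>The last hypothesis covers two situations: for s_i with i >= 1, \<open>p\<close> changes
  from - to + and the new cup at \<open>p\<close>, \<open>r\<close> is undotted; for s_0, p = 1
  changes from + to - and the new cup is dotted, which is allowed since nothing lies to the left of
  1.\<close>

lemma half_matching_surgery:
  assumes hm: "half_matching N \<sigma> \<pi>" and pr: "p \<in> {1..N}" "r \<in> {1..N}" "r = p + 1"
    and \<sigma>': "\<And>z. z \<in> {1..N} \<Longrightarrow> z \<noteq> p \<Longrightarrow> z \<noteq> r \<Longrightarrow> \<sigma>' z = \<sigma> z"
    and r: "\<sigma> r" "\<not> \<sigma>' r"
    and p: "\<not> \<sigma> p \<and> \<sigma>' p \<or> p = 1 \<and> \<sigma> p \<and> \<not> \<sigma>' p"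
  shows "half_matching N \<sigma>' (surgery p r \<pi>)"
proof -
  note D = half_matchingD[OF hm]
  define x b where "x = \<pi> p" and "b = \<pi> r"
  have xb: "x \<in> {1..N}" "b \<in> {1..N}" "\<pi> x = p" "\<pi> b = r" "x \<noteq> p" "b \<noteq> r"
    using D(1-3) pr by (auto simp: x_def b_def)
  have rb: "r < b" using D(5)[OF pr(2)] r(1) xb(6) by (metis b_def linorder_neqE_linordered_idom)
  have "\<not> \<sigma> b" using D(4)[OF pr(2)] rb by (auto simp: b_def)
  have "x \<noteq> r" using D(4)[OF pr(1)] pr(3) r(1) by (auto simp: x_def)
  have "b \<noteq> x" using xb(3,4) pr(3) by auto
  have neq: "x \<noteq> p" "x \<noteq> r" "b \<noteq> p" "b \<noteq> r" "b \<noteq> x" "p \<noteq> r"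
    using \<open>x \<noteq> r\<close> \<open>b \<noteq> x\<close> xb rb pr by auto
  have bx: "b < x" if "p < x"
  proof (rule ccontr)
    assume "\<not> b < x"
    then have "x < b" "r < x" using neq pr(3) that by auto
    then show False using D(6)[OF pr(1,2)] pr(3) unfolding x_def[symmetric] b_def[symmetric] by auto
  qed
  define \<pi>' where "\<pi>' = surgery p r \<pi>"
  have \<pi>': "\<pi>' p = r" "\<pi>' r = p" "\<pi>' x = b" "\<pi>' b = x"
    and \<pi>'_other: "\<And>z. z \<noteq> p \<Longrightarrow> z \<noteq> r \<Longrightarrow> z \<noteq> x \<Longrightarrow> z \<noteq> b \<Longrightarrow> \<pi>' z = \<pi> z"
    using neq by (auto simp: \<pi>'_def surgery_def x_def[symmetric] b_def[symmetric])
  have other: "\<pi> z \<noteq> p" "\<pi> z \<noteq> r" "\<pi> z \<noteq> x" "\<pi> z \<noteq> b"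
    if "z \<in> {1..N}" "z \<noteq> p" "z \<noteq> r" "z \<noteq> x" "z \<noteq> b" for z
    using D(3)[OF that(1)] that xb by (auto simp: x_def b_def)
  have cases: "\<lbrakk>z = p \<Longrightarrow> Q; z = r \<Longrightarrow> Q; z = x \<Longrightarrow> Q; z = b \<Longrightarrow> Q;
      \<lbrakk>z \<noteq> p; z \<noteq> r; z \<noteq> x; z \<noteq> b\<rbrakk> \<Longrightarrow> Q\<rbrakk> \<Longrightarrow> Q" for z Q by blast
  have "half_matching N \<sigma>' \<pi>'"
  proof (rule half_matchingI)
    fix z assume z: "z \<in> {1..N}"
    show "\<pi>' z \<in> {1..N} \<and> \<pi>' z \<noteq> z \<and> \<pi>' (\<pi>' z) = z"
    proof (rule cases[of z])
      assume ne: "z \<noteq> p" "z \<noteq> r" "z \<noteq> x" "z \<noteq> b"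
      show ?thesis using \<pi>'_other[OF ne] \<pi>'_other[OF other[OF z ne]] D(1-3)[OF z] by simp
    qed (use neq pr(1,2) xb(1,2) \<pi>' in auto)
    show "\<not> \<sigma>' (\<pi>' z)" if "z < \<pi>' z"
    proof -
      have "\<not> \<sigma> x" if "b < x" using that D(4)[OF pr(1)] rb pr(3) by (auto simp: x_def)
      show ?thesis
      proof (rule cases[of z])
        assume ne: "z \<noteq> p" "z \<noteq> r" "z \<noteq> x" "z \<noteq> b"
        show ?thesis using \<pi>'_other[OF ne] \<sigma>'[OF D(1)[OF z] other(1,2)[OF z ne]] D(4)[OF z] that by simp
      next
        assume "z = b"
        then show ?thesis using \<open>b < x \<Longrightarrow> \<not> \<sigma> x\<close> that \<sigma>'[OF xb(1)] neq \<pi>' by simp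
      next
        assume "z = x"
        then show ?thesis using \<open>\<not> \<sigma> b\<close> \<sigma>'[OF xb(2)] neq \<pi>' by simp
      qed (use that pr(3) r \<pi>' in auto)
    qed
  next
    fix s t assume s: "s \<in> {1..N}" and t: "t \<in> {1..N}" and ne: "t \<noteq> s" "t \<noteq> \<pi>' s"
    have adj: "between u v p = between u v r" if "u \<noteq> p" "u \<noteq> r" "v \<noteq> p" "v \<noteq> r" for u v
      using that pr(3) by (auto simp: between_def)
    have none: "\<not> between p r z" for z using pr(3) by (auto simp: between_def)
    have xbt: "between x b t = between x b (\<pi>' t)" if ne: "t \<noteq> x" "t \<noteq> b"
    proof (cases "t = p \<or> t = r")
      case True
      then show ?thesis using adj[of x b] neq by (auto simp: \<pi>')
    next
      case False
      then have eq: "\<pi>' t = \<pi> t" using ne \<pi>'_other by auto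
      \<comment> \<open>As \<open>p\<close> and \<open>r\<close> are adjacent, the interval between
        \<open>x\<close> and \<open>b\<close> is, away from these four points, the symmetric
        difference of the intervals of the two old cups. Noncrossing with the new cup thus follows
        from noncrossing with both old ones.\<close>
      have split: "between x b z = (between p x z \<noteq> between r b z)"
        if "z \<noteq> p" "z \<noteq> r" "z \<noteq> x" "z \<noteq> b" for z
        using that pr(3) neq(1) rb bx unfolding between_def by smt
      show ?thesis unfolding eq using split[of t] split[of "\<pi> t"] other[OF t] False ne
          half_matching_between[OF hm pr(1) t] half_matching_between[OF hm pr(2) t]
        by (auto simp: x_def[symmetric] b_def[symmetric])
    qed
    show "between s (\<pi>' s) t = between s (\<pi>' s) (\<pi>' t)"
    proof (cases "s = p \<or> s = r \<or> s = x \<or> s = b")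
      case True
      then show ?thesis using ne none between_commute xbt by (metis \<pi>')
    next
      case False
      then have eq: "\<pi>' s = \<pi> s" and os: "\<pi> s \<noteq> p" "\<pi> s \<noteq> r" "\<pi> s \<noteq> x" "\<pi> s \<noteq> b"
        using \<pi>'_other other[OF s] by auto
      have "between s (\<pi> s) p = between s (\<pi> s) x" "between s (\<pi> s) r = between s (\<pi> s) b"
        using half_matching_between[OF hm s pr(1)] half_matching_between[OF hm s pr(2)] False os
        by (auto simp: x_def[symmetric] b_def[symmetric])
      moreover have "between s (\<pi> s) p = between s (\<pi> s) r" using adj[of s "\<pi> s"] False os by blast
      ultimately have pxrb: "between s (\<pi> s) x = between s (\<pi> s) p" "between s (\<pi> s) r = between s (\<pi> s) p"
        "between s (\<pi> s) b = between s (\<pi> s) p" by blast+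
      show ?thesis unfolding eq
      proof (rule cases[of t])
        assume nt: "t \<noteq> p" "t \<noteq> r" "t \<noteq> x" "t \<noteq> b"
        show "between s (\<pi> s) t = between s (\<pi> s) (\<pi>' t)"
          using half_matching_between[OF hm s t] ne \<pi>'_other[OF nt] by (simp add: eq)
      qed (simp_all only: \<pi>' pxrb)
    qed
  next
    fix z y assume z: "z \<in> {1..N}" and y: "y \<in> {1..N}" and dot: "y < \<pi>' y" "\<not> \<sigma>' y" and nest: "z < y" "y < \<pi>' z"
    have z_ne: "z \<noteq> p" "z \<noteq> r" using nest pr(3) \<pi>' by auto
    have y_ne: "y \<noteq> r" using dot pr(3) \<pi>' by auto
    \<comment> \<open>\<open>p\<close> starts a dotted cup only if p = 1, and then no z < p
      exists.\<close>
    have y_ne': "y \<noteq> p" using dot p nest z by auto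
    show False
    proof (cases "y = x \<or> y = b")
      case False
      then have y': "\<pi>' y = \<pi> y" "\<sigma>' y = \<sigma> y" using \<pi>'_other[of y] \<sigma>'[OF y] y_ne y_ne' by auto
      then have old: "\<not> (u < y \<and> y < \<pi> u)" if "u \<in> {1..N}" for u
        using D(7)[OF that y] dot by auto
      have "\<not> (x < y \<and> y < p)" using old[OF xb(1)] unfolding xb(3) .
      moreover have "\<not> (r < y \<and> y < b)" using old[OF pr(2)] unfolding b_def .
      moreover have old_p: "\<not> (p < y \<and> y < x)" using old[OF pr(1)] unfolding x_def .
      ultimately have "\<not> (x < y \<and> y < b)" "\<not> (b < y \<and> y < x)" using y_ne y_ne' pr(3) rb by linarith+
      then have "z \<noteq> x" "z \<noteq> b" using nest \<pi>' by auto
      then show False using nest \<pi>'_other z_ne old[OF z] by simp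
    next
      case True
      have z_ne': "z \<noteq> x" "z \<noteq> b" using True nest dot \<pi>' by auto
      then have z': "\<pi>' z = \<pi> z" using \<pi>'_other z_ne by auto
      show False
      \<comment> \<open>If x < p, the old cup from x to p was dotted with the same left end. If p <
        x, the new left end is b, and a cup covering b starts left of p and covers p as well; then p
        > 1, so the old cup at p was dotted and nested, a contradiction.\<close>
      proof (cases "p < x")
        case False
        then have "x < p" using neq by auto
        then have "y = x" using True dot rb pr(3) \<pi>' by auto
        have "\<not> \<sigma> x" using dot(2) \<open>y = x\<close> \<sigma>'[OF xb(1)] neq by simp
        moreover have "x < \<pi> x" using \<open>x < p\<close> xb(3) by simp
        ultimately show False using D(7)[OF z xb(1)] nest z' \<open>y = x\<close> by simp
      next
        case True
        then have "y = b" using \<open>y = x \<or> y = b\<close> bx dot \<pi>' by auto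
        then have zb: "z < b" "b < \<pi> z" using nest z' by auto
        have "\<not> r < z" using D(6)[OF pr(2) z] zb unfolding b_def by blast
        then have "z < p" using z_ne pr(3) by auto
        then have "p \<noteq> 1" using z by auto
        then have "\<not> \<sigma> p" using p by auto
        moreover have "p < \<pi> z" using zb rb pr(3) by linarith
        ultimately show False using D(7)[OF z pr(1)] True \<open>z < p\<close> unfolding x_def by blast
      qed
    qed
  qed
  then show ?thesis by (simp add: \<pi>'_def)
qed

text \<open>All depends on which old partners of \<open>p\<close> and \<open>r\<close> lie in
  \<open>D\<close>: neither if \<open>D\<close> is closed under \<open>\<pi>\<close>, both if
  \<open>D \<union> {p, r}\<close> is, and both or neither if \<open>D\<close> is closed under the
  surgery.\<close>

lemma closed_surgery_iff:
  assumes inv: "\<forall>z\<in>I. \<pi> z \<in> I \<and> \<pi> z \<noteq> z \<and> \<pi> (\<pi> z) = z"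
    and pr: "p \<in> I" "r \<in> I" "p \<noteq> r" "\<pi> p \<noteq> r" and D: "D \<subseteq> I" "p \<notin> D" "r \<notin> D"
  shows "surgery p r \<pi> ` D \<subseteq> D \<longleftrightarrow> \<pi> ` D \<subseteq> D \<or> \<pi> ` (D \<union> {p, r}) \<subseteq> D \<union> {p, r}"
    and "\<not> (\<pi> ` D \<subseteq> D \<and> \<pi> ` (D \<union> {p, r}) \<subseteq> D \<union> {p, r})"
    and "surgery p r \<pi> ` (D \<union> {p, r}) \<subseteq> D \<union> {p, r} \<longleftrightarrow> surgery p r \<pi> ` D \<subseteq> D"
proof -
  have ne: "\<pi> p \<noteq> p" "\<pi> r \<noteq> r" "\<pi> r \<noteq> p" "\<pi> r \<noteq> \<pi> p" "\<pi> (\<pi> p) = p" "\<pi> (\<pi> r) = r"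
    using inv pr by metis+
  have S: "surgery p r \<pi> p = r" "surgery p r \<pi> r = p" "surgery p r \<pi> (\<pi> p) = \<pi> r" "surgery p r \<pi> (\<pi> r) = \<pi> p"
    using ne pr by (auto simp: surgery_def)
  have S': "surgery p r \<pi> z = (if z = \<pi> p then \<pi> r else if z = \<pi> r then \<pi> p else \<pi> z)" if "z \<in> D" for z
  proof -
    have "z \<noteq> p" "z \<noteq> r" using that D by auto
    then show ?thesis using ne by (simp add: surgery_def)
  qed
  have pi: "\<pi> z = p \<longleftrightarrow> z = \<pi> p" "\<pi> z = r \<longleftrightarrow> z = \<pi> r" if "z \<in> D" for z
    using inv that D(1) ne by (metis subsetD)+
  have A: "surgery p r \<pi> ` D \<subseteq> D \<longleftrightarrow> (\<pi> p \<in> D \<longleftrightarrow> \<pi> r \<in> D) \<and> (\<forall>z\<in>D - {\<pi> p, \<pi> r}. \<pi> z \<in> D)"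
  proof -
    have "surgery p r \<pi> z \<in> D \<longleftrightarrow>
        (if z = \<pi> p then \<pi> r \<in> D else if z = \<pi> r then \<pi> p \<in> D else \<pi> z \<in> D)" if "z \<in> D" for z
      using S'[OF that] by simp
    then show ?thesis unfolding image_subset_iff by (metis DiffD1 DiffD2 DiffI insert_iff singletonD)
  qed
  have B: "\<pi> ` D \<subseteq> D \<longleftrightarrow> \<pi> p \<notin> D \<and> \<pi> r \<notin> D \<and> (\<forall>z\<in>D - {\<pi> p, \<pi> r}. \<pi> z \<in> D)"
  proof
    assume l: "\<pi> ` D \<subseteq> D"
    have "\<pi> p \<notin> D" "\<pi> r \<notin> D" using l ne(5,6) D(2,3) by (metis image_subset_iff)+
    then show "\<pi> p \<notin> D \<and> \<pi> r \<notin> D \<and> (\<forall>z\<in>D - {\<pi> p, \<pi> r}. \<pi> z \<in> D)" using l by auto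
  next
    assume "\<pi> p \<notin> D \<and> \<pi> r \<notin> D \<and> (\<forall>z\<in>D - {\<pi> p, \<pi> r}. \<pi> z \<in> D)"
    then show "\<pi> ` D \<subseteq> D" by blast
  qed
  have C: "\<pi> ` (D \<union> {p, r}) \<subseteq> D \<union> {p, r} \<longleftrightarrow> \<pi> p \<in> D \<and> \<pi> r \<in> D \<and> (\<forall>z\<in>D - {\<pi> p, \<pi> r}. \<pi> z \<in> D)"
    using ne pr pi by (auto simp: image_subset_iff)
  show "surgery p r \<pi> ` D \<subseteq> D \<longleftrightarrow> \<pi> ` D \<subseteq> D \<or> \<pi> ` (D \<union> {p, r}) \<subseteq> D \<union> {p, r}"
    "\<not> (\<pi> ` D \<subseteq> D \<and> \<pi> ` (D \<union> {p, r}) \<subseteq> D \<union> {p, r})"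
    unfolding A B C by blast+
  have "surgery p r \<pi> z \<noteq> p \<and> surgery p r \<pi> z \<noteq> r" if "z \<in> D" for z
    using S'[OF that] pi[OF that] ne pr by auto
  then show "surgery p r \<pi> ` (D \<union> {p, r}) \<subseteq> D \<union> {p, r} \<longleftrightarrow> surgery p r \<pi> ` D \<subseteq> D"
    using S by (auto simp: image_subset_iff)
qed

lemma even_card_involution:
  assumes "finite S" "\<And>z. z \<in> S \<Longrightarrow> f z \<in> S \<and> f z \<noteq> z \<and> f (f z) = z"
  shows "even (card S)"
  using assms
proof (induction "card S" arbitrary: S rule: less_induct)
  case less
  show ?case
  proof (cases "S = {}")
    case False
    then obtain z where z: "z \<in> S" by auto
    define T where "T = S - {z, f z}"
    have sub: "{z, f z} \<subseteq> S" and c2: "card {z, f z} = 2" using less(3)[OF z] z by auto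
    then have card: "card S = card T + 2"
      unfolding T_def using card_Diff_subset[OF _ sub] card_mono[OF less(2) sub] by simp
    have "f u \<in> T \<and> f u \<noteq> u \<and> f (f u) = u" if "u \<in> T" for u
      using that less(3)[of u] less(3)[OF z] unfolding T_def by (metis DiffD1 DiffD2 DiffI insert_iff singletonD)
    then have "even (card T)" using less(1)[of T] card less(2) by (simp add: T_def)
    then show ?thesis using card by simp
  qed simp
qed

lemma strict_sorted_index:
  fixes ys :: "int list"
  assumes "sorted_wrt (<) ys" "i < length ys"
  shows "card {z \<in> set ys. z < ys ! i} = i"
proof -
  have d: "distinct ys" using assms(1) by (simp add: strict_sorted_iff)
  have "{z \<in> set ys. z < ys ! i} = (!) ys ` {..<i}"
  proof (intro equalityI subsetI)
    fix z assume "z \<in> {z \<in> set ys. z < ys ! i}"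
    then obtain j where j: "j < length ys" "z = ys ! j" "ys ! j < ys ! i" by (auto simp: in_set_conv_nth)
    then have "j < i" using assms sorted_wrt_nth_less[OF assms(1), of i j]
      by (metis less_asym linorder_neqE_nat less_irrefl)
    then show "z \<in> (!) ys ` {..<i}" using j by auto
  qed (use assms sorted_wrt_nth_less[OF assms(1)] in auto)
  moreover have "inj_on ((!) ys) {..<i}" using d assms(2) by (auto simp: inj_on_def nth_eq_iff_index_eq)
  ultimately show ?thesis by (simp add: card_image)
qed

section \<open>Cup diagrams\<close>

context type_D
begin

abbreviation pts :: "int set" where "pts \<equiv> {1..2 * int n}"

text \<open>The ends of dotted cups, that is, the y for which (-y, y) is an arc before linking.
  Right ends are always labeled -, so a dotted cup is one with both ends labeled -.\<close>

definition free :: "(int \<Rightarrow> bool) \<Rightarrow> (int \<Rightarrow> int) \<Rightarrow> int set" where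
  "free \<sigma> \<pi> = {y \<in> pts. \<not> \<sigma> y \<and> \<not> \<sigma> (\<pi> y)}"

lemma finite_free: "finite (free \<sigma> \<pi>)"
  by (rule finite_subset[of _ pts]) (auto simp: free_def)

lemma elab_pos: "j \<in> pts \<Longrightarrow> elab n w j \<longleftrightarrow> j \<le> int n \<and> w j > 0"
  by (auto simp: elab_def alpha_def act_def ext_sign_def)

lemma elab_minus: "w \<in> W n \<Longrightarrow> j \<in> pts \<Longrightarrow> elab n w (- j) \<longleftrightarrow> \<not> elab n w j"
  by (auto simp: elab_def alpha_def act_def ext_sign_def)

text \<open>The partner map of the unlinked diagram on \<open>Pts n\<close>: a dotted cup on x and y
  comes from the symmetric arcs (-x, x) and (-y, y), any other cup comes together with its mirror
  image.\<close>

definition unfold_matching :: "(int \<Rightarrow> bool) \<Rightarrow> (int \<Rightarrow> int) \<Rightarrow> int \<Rightarrow> int" where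
  "unfold_matching \<sigma> \<pi> a = (let r = (\<lambda>x. if x \<in> free \<sigma> \<pi> then - x else \<pi> x) in if a > 0 then r a else - r (- a))"

lemma Pts_cases:
  assumes "a \<in> Pts n"
  obtains "a \<in> pts" "a \<in> free \<sigma> \<pi>" | "a \<in> pts" "a \<notin> free \<sigma> \<pi>"
    | "- a \<in> pts" "- a \<in> free \<sigma> \<pi>" | "- a \<in> pts" "- a \<notin> free \<sigma> \<pi>"
  using assms by (force simp: Pts_def)

lemma pts_Pts: "a \<in> pts \<Longrightarrow> a \<in> Pts n" "a \<in> pts \<Longrightarrow> - a \<in> Pts n"
  by (auto simp: Pts_def)

text \<open>Indexes the 2n cups by the points 1, ..., 2n: the two ends of a folded cup account for
  the cup and its mirror image. This turns the count of clockwise cups into a count of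
  points.\<close>

definition cup_of :: "(int \<Rightarrow> bool) \<Rightarrow> (int \<Rightarrow> int) \<Rightarrow> int \<Rightarrow> int \<times> int" where
  "cup_of \<sigma> \<pi> x = (if x \<in> free \<sigma> \<pi> then (- \<pi> x, x) else if x < \<pi> x then (x, \<pi> x) else (- x, - \<pi> x))"

definition diff_pts :: "sperm \<Rightarrow> sperm \<Rightarrow> int set" where
  "diff_pts w v = {x \<in> pts. elab n v x \<noteq> elab n w x}"

context
  fixes w \<pi>
  assumes w: "w \<in> W n" and hm: "half_matching (2 * int n) (elab n w) \<pi>"
begin

private abbreviation (input) "Y \<equiv> free (elab n w) \<pi>"
private abbreviation (input) "\<rho> \<equiv> unfold_matching (elab n w) \<pi>"

private abbreviation (input) "cup \<equiv> cup_of (elab n w) \<pi>"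

private lemma free_pi: "x \<in> pts \<Longrightarrow> \<pi> x \<in> Y \<longleftrightarrow> x \<in> Y"
  using half_matchingD(1-3)[OF hm] by (auto simp: free_def)

private lemma rho:
  "a \<in> pts \<Longrightarrow> a \<in> Y \<Longrightarrow> \<rho> a = - a" "a \<in> pts \<Longrightarrow> a \<notin> Y \<Longrightarrow> \<rho> a = \<pi> a"
  "- a \<in> pts \<Longrightarrow> - a \<in> Y \<Longrightarrow> \<rho> a = - a" "- a \<in> pts \<Longrightarrow> - a \<notin> Y \<Longrightarrow> \<rho> a = - \<pi> (- a)"
  by (auto simp: unfold_matching_def)

text \<open>The unfolded involution is a noncrossing matching with the right signs, so uniqueness
  evaluates the definite description in \<open>arcs\<close>. Symmetric arcs cross no other arc
  because dotted cups are not nested.\<close>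

lemma arcs_eq: "arcs n w = {(a, \<rho> a) | a. a \<in> Pts n \<and> a < \<rho> a}"
proof -
  note D = half_matchingD[OF hm]
  have "noncrossing_matching (Pts n) (elab n w) {(a, \<rho> a) | a. a \<in> Pts n \<and> a < \<rho> a}"
  proof (rule noncrossing_matching_involution)
    fix a assume a: "a \<in> Pts n"
    show "\<rho> a \<in> Pts n \<and> \<rho> a \<noteq> a \<and> \<rho> (\<rho> a) = a"
    proof (rule Pts_cases[OF a, where \<sigma> = "elab n w" and \<pi> = \<pi>])
      assume a: "a \<in> pts" "a \<in> Y"
      then have "\<rho> (- a) = a" using rho(3)[of "- a"] by simp
      then show ?thesis using a rho(1)[OF a] pts_Pts by auto
    next
      assume a: "a \<in> pts" "a \<notin> Y"
      then have "\<rho> (\<pi> a) = a" using rho(2)[of "\<pi> a"] free_pi[OF a(1)] D(1-3)[OF a(1)] by auto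
      then show ?thesis using a rho(2)[OF a] pts_Pts D(1-2)[OF a(1)] by auto
    next
      assume a: "- a \<in> pts" "- a \<in> Y"
      then have "\<rho> (- a) = a" using rho(1)[of "- a"] by simp
      then show ?thesis using a rho(3)[OF a] pts_Pts by auto
    next
      assume a: "- a \<in> pts" "- a \<notin> Y"
      then have "\<rho> (- \<pi> (- a)) = a" using rho(4)[of "- \<pi> (- a)"] free_pi[OF a(1)] D(1-3)[OF a(1)] by simp
      then show ?thesis using a rho(4)[OF a] pts_Pts D(1-2)[OF a(1)] by auto
    qed
  next
    fix a assume a: "a \<in> Pts n" and lt: "a < \<rho> a"
    show "elab n w a \<and> \<not> elab n w (\<rho> a)"
    proof (rule Pts_cases[OF a, where \<sigma> = "elab n w" and \<pi> = \<pi>])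
      assume a: "a \<in> pts" "a \<in> Y"
      then show ?thesis using rho(1)[OF a] lt by auto
    next
      assume a: "a \<in> pts" "a \<notin> Y"
      then show ?thesis using rho(2)[OF a] lt D(4)[OF a(1)] by (auto simp: free_def)
    next
      assume a: "- a \<in> pts" "- a \<in> Y"
      then show ?thesis using rho(3)[OF a] elab_minus[OF w a(1)] by (auto simp: free_def)
    next
      assume a: "- a \<in> pts" "- a \<notin> Y"
      have "\<not> elab n w (- a)" using rho(4)[OF a] lt D(5)[OF a(1)] by auto
      then show ?thesis using rho(4)[OF a] elab_minus[OF w a(1)] elab_minus[OF w D(1)[OF a(1)]] a
        by (auto simp: free_def)
    qed
  next
    fix a c assume a: "a \<in> Pts n" and c: "c \<in> Pts n" and cr: "a < c" "c < \<rho> a" "\<rho> a < \<rho> c"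
    have un: False if "y \<in> Y" "x \<in> pts" "x < y" "y < \<pi> x" for x y
      using half_matching_unnested[OF hm _ _ _ that(2), of y] that by (auto simp: free_def)
    show False
    proof (rule Pts_cases[OF a, where \<sigma> = "elab n w" and \<pi> = \<pi>])
      assume a: "a \<in> pts" "a \<in> Y"
      then show ?thesis using rho(1)[OF a] cr by auto
    next
      assume a: "a \<in> pts" "a \<notin> Y"
      then have c: "c \<in> pts" using cr c by (auto simp: Pts_def)
      show ?thesis
      proof (cases "c \<in> Y")
        case True
        then show ?thesis using rho(1)[OF c] rho(2)[OF a] cr c D(1)[OF a(1)] by auto
      next
        case False
        then show ?thesis using rho(2)[OF c] rho(2)[OF a] cr D(6)[OF a(1) c] by auto
      qed
    next
      assume a: "- a \<in> pts" "- a \<in> Y"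
      show ?thesis
      proof (rule Pts_cases[OF c, where \<sigma> = "elab n w" and \<pi> = \<pi>])
        assume c: "c \<in> pts" "c \<in> Y"
        then show ?thesis using rho(1)[OF c] cr by auto
      next
        assume c: "c \<in> pts" "c \<notin> Y"
        then show ?thesis using rho(2)[OF c] rho(3)[OF a] cr un[OF a(2) c(1)] by auto
      next
        assume c: "- c \<in> pts" "- c \<in> Y"
        then show ?thesis using rho(3)[OF c] rho(3)[OF a] cr by auto
      next
        assume c: "- c \<in> pts" "- c \<notin> Y"
        then show ?thesis using rho(4)[OF c] rho(3)[OF a] cr D(1)[OF c(1)] a by auto
      qed
    next
      assume a: "- a \<in> pts" "- a \<notin> Y"
      have xa: "\<pi> (- a) \<in> pts" "\<pi> (\<pi> (- a)) = - a" using D(1,3)[OF a(1)] by auto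
      then have "- c \<in> pts" using rho(4)[OF a] cr c by (auto simp: Pts_def)
      show ?thesis
      proof (cases "- c \<in> Y")
        case True
        then show ?thesis using rho(4)[OF a] cr un[OF True xa(1)] xa(2) by auto
      next
        case False
        note c = \<open>- c \<in> pts\<close> False
        have "\<pi> (- c) \<in> pts" "\<pi> (\<pi> (- c)) = - c" using D(1,3)[OF c(1)] by auto
        then show ?thesis using rho(4)[OF a] rho(4)[OF c] cr D(6)[OF _ xa(1), of "\<pi> (- c)"] xa(2) by auto
      qed
    qed
  qed
  then show ?thesis
    unfolding arcs_def noncrossing_matching_def[symmetric]
    by (intro the_equality noncrossing_matching_unique)
qed

lemma set_sym_ys: "set (sym_ys n w) = Y" and sorted_sym_ys: "sorted_wrt (<) (sym_ys n w)"
proof -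
  have "{y. y > 0 \<and> (- y, y) \<in> arcs n w} = Y"
  proof (intro equalityI subsetI)
    fix y assume "y \<in> {y. y > 0 \<and> (- y, y) \<in> arcs n w}"
    then have y: "y \<in> pts" "\<rho> (- y) = y" by (auto simp: arcs_eq Pts_def)
    show "y \<in> Y"
    proof (rule ccontr)
      assume "y \<notin> Y"
      then show False using rho(4)[of "- y"] y half_matchingD(1)[OF hm y(1)] by auto
    qed
  next
    fix y assume y: "y \<in> Y"
    then have "y \<in> pts" by (auto simp: free_def)
    then show "y \<in> {y. y > 0 \<and> (- y, y) \<in> arcs n w}"
      using rho(3)[of "- y"] y pts_Pts by (auto simp: arcs_eq)
  qed
  then show "set (sym_ys n w) = Y" "sorted_wrt (<) (sym_ys n w)"
    by (simp_all add: sym_ys_def finite_free)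
qed

text \<open>Dotted cups are never covered, so no free point lies between the ends of one, and the
  free points to its left are paired among themselves. Counted from 0, its left end has an even
  index and its right end the next one, as in \<open>partner\<close>.\<close>

lemma sym_ys_partner:
  assumes "i < length (sym_ys n w)"
  shows "sym_ys n w ! partner i = \<pi> (sym_ys n w ! i)"
proof -
  note D = half_matchingD[OF hm]
  have un: False if "y \<in> Y" "x \<in> pts" "x < y" "y < \<pi> x" for x y
    using half_matching_unnested[OF hm _ _ _ that(2), of y] that by (auto simp: free_def)
  have Yp: "y \<in> pts" "\<pi> y \<in> Y" if "y \<in> Y" for y using that free_pi by (auto simp: free_def)
  have fin: "finite {z \<in> Y. z < y}" for y using finite_free by simp
  have ev: "even (card {z \<in> Y. z < y})" "card {z \<in> Y. z < \<pi> y} = card {z \<in> Y. z < y} + 1"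
    if y: "y \<in> Y" "y < \<pi> y" for y
  proof -
    show "even (card {z \<in> Y. z < y})"
    proof (rule even_card_involution[OF fin])
      fix z assume "z \<in> {z \<in> Y. z < y}"
      then have z: "z \<in> Y" "z < y" by auto
      note zp = Yp[OF z(1)]
      have "\<pi> z \<noteq> y" using D(3)[OF zp(1)] z y by auto
      then have "\<pi> z < y" using un[OF y(1) zp(1) z(2)] by force
      then show "\<pi> z \<in> {z \<in> Y. z < y} \<and> \<pi> z \<noteq> z \<and> \<pi> (\<pi> z) = z" using zp D(2,3)[OF zp(1)] by auto
    qed
    have "{z \<in> Y. z < \<pi> y} = insert y {z \<in> Y. z < y}"
      using un[OF _ Yp(1)[OF y(1)]] y by force
    then show "card {z \<in> Y. z < \<pi> y} = card {z \<in> Y. z < y} + 1" using fin by simp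
  qed
  define ys where "ys = sym_ys n w"
  have idx: "card {z \<in> Y. z < ys ! i} = i" if "i < length ys" for i
    using strict_sorted_index[OF sorted_sym_ys, of i] that by (simp add: ys_def set_sym_ys)
  have nth: "ys ! card {z \<in> Y. z < y} = y" if "y \<in> Y" for y
  proof -
    have "y \<in> set ys" using that by (simp add: ys_def set_sym_ys)
    then obtain j where j: "j < length ys" "ys ! j = y" by (auto simp: in_set_conv_nth)
    then have "card {z \<in> Y. z < y} = j" using idx[of j] by simp
    then show ?thesis using j by simp
  qed
  have i: "i < length ys" using assms by (simp add: ys_def)
  define y where "y = ys ! i"
  have y: "y \<in> Y" using i set_sym_ys nth_mem unfolding y_def ys_def by blast
  note yp = Yp[OF y]
  show ?thesis
  proof (cases "y < \<pi> y")
    case True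
    then show ?thesis using ev[OF y True] idx[OF i] nth[OF yp(2)]
      by (simp add: partner_def y_def ys_def)
  next
    case False
    then have "\<pi> y < \<pi> (\<pi> y)" using D(2,3)[OF yp(1)] by auto
    then have e: "even (card {z \<in> Y. z < \<pi> y})" and c: "card {z \<in> Y. z < y} = card {z \<in> Y. z < \<pi> y} + 1"
      using ev[OF yp(2)] unfolding D(3)[OF yp(1)] by blast+
    have "card {z \<in> Y. z < y} = i" using idx[OF i] by (simp only: y_def)
    then have "partner i = card {z \<in> Y. z < \<pi> y}" using e c by (auto simp: partner_def)
    then show ?thesis using nth[OF yp(2)] by (simp only: y_def ys_def)
  qed
qed

lemma cups_eq: "cups n w = cup ` pts"
proof -
  note D = half_matchingD[OF hm]
  have linked: "{(- (sym_ys n w ! partner i), sym_ys n w ! i) | i. i < length (sym_ys n w)} = cup ` Y"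
  proof -
    have "{(- (sym_ys n w ! partner i), sym_ys n w ! i) | i. i < length (sym_ys n w)}
      = (\<lambda>y. (- \<pi> y, y)) ` set (sym_ys n w)"
      using sym_ys_partner by (force simp: set_conv_nth)
    then show ?thesis by (simp add: set_sym_ys cup_of_def)
  qed
  have "arcs n w - {(- y, y) | y. y \<in> set (sym_ys n w)} = cup ` (pts - Y)"
  proof (intro equalityI subsetI)
    fix p assume "p \<in> arcs n w - {(- y, y) | y. y \<in> set (sym_ys n w)}"
    then obtain a where a: "p = (a, \<rho> a)" "a \<in> Pts n" "a < \<rho> a" and "p \<notin> {(- y, y) | y. y \<in> Y}"
      unfolding arcs_eq set_sym_ys by blast
    then have a': "- a \<in> Y \<longrightarrow> \<rho> a \<noteq> - a" by force
    show "p \<in> cup ` (pts - Y)"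
    proof (rule Pts_cases[OF a(2), where \<sigma> = "elab n w" and \<pi> = \<pi>])
      assume "a \<in> pts" "a \<notin> Y"
      then show ?thesis using rho(2)[of a] a by (intro image_eqI[of _ _ a]) (auto simp: cup_of_def)
    next
      assume "- a \<in> pts" "- a \<notin> Y"
      then show ?thesis using rho(4)[of a] a by (intro image_eqI[of _ _ "- a"]) (auto simp: cup_of_def)
    qed (use rho a a' in auto)
  next
    fix p assume "p \<in> cup ` (pts - Y)"
    then obtain x where x: "x \<in> pts" "x \<notin> Y" "p = cup x" by auto
    then have lt: "x < \<pi> x \<or> \<pi> x < x" using D(2)[OF x(1)] by auto
    have "p \<in> arcs n w"
      using x lt rho(2)[of x] rho(4)[of "- x"] pts_Pts[OF x(1)] by (auto simp: arcs_eq cup_of_def)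
    moreover have "p \<noteq> (- y, y)" if "y \<in> Y" for y
      using x that D(1)[OF x(1)] by (auto simp: cup_of_def free_def)
    ultimately show "p \<in> arcs n w - {(- y, y) | y. y \<in> set (sym_ys n w)}" by (auto simp: set_sym_ys)
  qed
  moreover have "pts = (pts - Y) \<union> Y" by (auto simp: free_def)
  ultimately show ?thesis unfolding cups_def linked by (metis image_Un)
qed

lemma inj_on_cup_of: "inj_on cup pts"
proof (rule inj_onI)
  fix x y assume x: "x \<in> pts" and y: "y \<in> pts" and eq: "cup x = cup y"
  show "x = y"
    using eq x y half_matchingD(1)[OF hm x] half_matchingD(1)[OF hm y]
    by (auto simp: cup_of_def split: if_splits)
qed

text \<open>Under the labels of \<open>w\<close> itself every cup has left end + and right end -, so
  for \<open>v\<close> it is oriented iff both labels change or neither does; the label at -x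
  changes together with the one at x.\<close>

lemma cup_of_oriented:
  assumes v: "v \<in> W n" and x: "x \<in> pts"
  shows "(elab n v (fst (cup x)) \<noteq> elab n v (snd (cup x))) \<longleftrightarrow> (x \<in> diff_pts w v \<longleftrightarrow> \<pi> x \<in> diff_pts w v)"
  using x half_matchingD(1-5)[OF hm x] elab_minus[OF v x] elab_minus[OF v half_matchingD(1)[OF hm x]]
  by (auto simp: cup_of_def diff_pts_def free_def)

lemma cup_of_clockwise:
  assumes v: "v \<in> W n" and x: "x \<in> pts" and o: "x \<in> diff_pts w v \<longleftrightarrow> \<pi> x \<in> diff_pts w v"
  shows "(\<not> elab n v (fst (cup x)) \<and> elab n v (snd (cup x))) \<longleftrightarrow> x \<in> diff_pts w v"
  using x o half_matchingD(1-5)[OF hm x] elab_minus[OF v x] elab_minus[OF v half_matchingD(1)[OF hm x]]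
  by (auto simp: cup_of_def diff_pts_def free_def)

lemma oriented_iff:
  assumes v: "v \<in> W n"
  shows "oriented n v w \<longleftrightarrow> \<pi> ` diff_pts w v \<subseteq> diff_pts w v"
proof -
  have "oriented n v w \<longleftrightarrow> (\<forall>x\<in>pts. elab n v (fst (cup x)) \<noteq> elab n v (snd (cup x)))"
    unfolding oriented_def cups_eq by (simp add: case_prod_beta)
  also have "\<dots> \<longleftrightarrow> (\<forall>x\<in>pts. x \<in> diff_pts w v \<longleftrightarrow> \<pi> x \<in> diff_pts w v)"
    using cup_of_oriented[OF v] by simp
  also have "\<dots> \<longleftrightarrow> \<pi> ` diff_pts w v \<subseteq> diff_pts w v"
  proof (intro iffI ballI image_subsetI)
    fix x assume "\<forall>x\<in>pts. x \<in> diff_pts w v \<longleftrightarrow> \<pi> x \<in> diff_pts w v" "x \<in> diff_pts w v"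
    then show "\<pi> x \<in> diff_pts w v" unfolding diff_pts_def by blast
  next
    fix x assume sub: "\<pi> ` diff_pts w v \<subseteq> diff_pts w v" and x: "x \<in> pts"
    show "x \<in> diff_pts w v" if "\<pi> x \<in> diff_pts w v"
      using subsetD[OF sub imageI[OF that]] half_matchingD(3)[OF hm x] by simp
  qed (use half_matchingD(3)[OF hm] in blast)
  finally show ?thesis .
qed

lemma cl_eq:
  assumes v: "v \<in> W n" and o: "oriented n v w"
  shows "cl n v w = card (diff_pts w v)"
proof -
  have "x \<in> diff_pts w v \<longleftrightarrow> \<pi> x \<in> diff_pts w v" if "x \<in> pts" for x
    using o oriented_iff[OF v] half_matchingD(3)[OF hm that] by (metis image_subset_iff)
  then have clockwise: "(\<not> elab n v (fst (cup x)) \<and> elab n v (snd (cup x))) \<longleftrightarrow> x \<in> diff_pts w v"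
    if "x \<in> pts" for x using cup_of_clockwise[OF v that] that by blast
  have "{(a, b) \<in> cups n w. \<not> elab n v a \<and> elab n v b} =
      {c \<in> cups n w. \<not> elab n v (fst c) \<and> elab n v (snd c)}" by auto
  also have "\<dots> = cup ` {x \<in> pts. \<not> elab n v (fst (cup x)) \<and> elab n v (snd (cup x))}"
    unfolding cups_eq by blast
  also have "\<dots> = cup ` {x \<in> pts. x \<in> diff_pts w v}"
    using clockwise by (intro arg_cong[of _ _ "image cup"] Collect_cong) blast
  also have "{x \<in> pts. x \<in> diff_pts w v} = diff_pts w v" by (auto simp: diff_pts_def)
  finally have "cl n v w = card (cup ` diff_pts w v)" unfolding cl_def by (rule arg_cong)
  moreover have "diff_pts w v \<subseteq> pts" by (auto simp: diff_pts_def)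
  ultimately show ?thesis using card_image[OF inj_on_subset[OF inj_on_cup_of]] by metis
qed

end

end

section \<open>The graphical basis\<close>

context type_D
begin

lemma diff_pts_eq: "diff_pts w v = {x. 1 \<le> x \<and> x \<le> int n \<and> (v x > 0) \<noteq> (w x > 0)}"
  unfolding diff_pts_def using elab_pos[of _ v] elab_pos[of _ w] by auto

lemma diff_pts_subset: "diff_pts w v \<subseteq> pts"
  by (auto simp: diff_pts_def)

lemma finite_diff_pts: "finite (diff_pts w v)"
  by (rule finite_subset[OF diff_pts_subset]) simp

text \<open>For s_0 the two points are 1 and 2, and because of \<open>lo 0 = -1\<close> the
  hypothesis says that \<open>v\<close> has equal signs there, which s_0 then reverses.\<close>

lemma sign_flip:
  assumes v: "v \<in> W n" and ne: "(v (lo i) > 0) \<noteq> (v (hi i) > 0)" and z: "1 \<le> z"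
  shows "(v \<circ> gen i) z > 0 \<longleftrightarrow> (if z = \<bar>lo i\<bar> \<or> z = hi i then \<not> v z > 0 else v z > 0)"
proof -
  consider "z = lo i" | "z = hi i" | "z = - lo i" | "z \<noteq> \<bar>lo i\<bar>" "z \<noteq> hi i" by linarith
  then show ?thesis
  proof cases
    case 3
    have "v (- lo i) > 0 \<longleftrightarrow> \<not> v (lo i) > 0" "v (- hi i) > 0 \<longleftrightarrow> \<not> v (hi i) > 0"
      using W_pos_iff[OF v] lo_hi[of i] by (metis less_irrefl)+
    then show ?thesis using 3 ne z by (auto simp: gen_minus)
  next
    case 4
    then have "gen i z = z" using lo_hi(2)[of i] z by (auto simp: gen_eq)
    then show ?thesis using 4 by simp
  qed (use z ne in auto)
qed

text \<open>The claimed polynomial in terms of the folded diagram. The halving is exact: a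
  difference set closed under the fixed point free involution \<open>\<pi>\<close> has even
  size.\<close>

definition KLcoef :: "sperm \<Rightarrow> (int \<Rightarrow> int) \<Rightarrow> sperm \<Rightarrow> laur" where
  "KLcoef w \<pi> v = (if \<pi> ` diff_pts w v \<subseteq> diff_pts w v then qpow (int (card (diff_pts w v)) div 2) else 0)"

section \<open>The step from w to ws\<close>

context
  fixes w i \<pi>
  assumes w: "w \<in> W n" and i: "i < n" and up: "w (lo i) < 0" "0 < w (hi i)"
    and hm: "half_matching (2 * int n) (elab n w) \<pi>"
begin

private abbreviation (input) "p \<equiv> \<bar>lo i\<bar>"
private abbreviation (input) "r \<equiv> hi i"

private lemma pr: "p \<in> pts" "r \<in> pts" "r = p + 1" "p \<le> int n" "r \<le> int n"
proof -
  show "r = p + 1" by (auto simp: lo_def hi_def)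
  show "p \<le> int n" "r \<le> int n" using lo_hi_le[OF i] by auto
  then show "p \<in> pts" "r \<in> pts" using lo_hi[of i] by auto
qed

lemma elab_at_step:
  "elab n w r" "\<not> elab n (w \<circ> gen i) r"
  "z \<noteq> p \<Longrightarrow> z \<noteq> r \<Longrightarrow> z \<in> pts \<Longrightarrow> elab n (w \<circ> gen i) z = elab n w z"
  "\<not> elab n w p \<and> elab n (w \<circ> gen i) p \<or> p = 1 \<and> elab n w p \<and> \<not> elab n (w \<circ> gen i) p"
proof -
  have ne: "(w (lo i) > 0) \<noteq> (w (hi i) > 0)" using up by auto
  note flip = sign_flip[OF w ne]
  show "elab n w r" "\<not> elab n (w \<circ> gen i) r"
    using pr(2,5) up elab_pos[OF pr(2), of w] elab_pos[OF pr(2), of "w \<circ> gen i"] by auto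
  show "z \<noteq> p \<Longrightarrow> z \<noteq> r \<Longrightarrow> z \<in> pts \<Longrightarrow> elab n (w \<circ> gen i) z = elab n w z"
    using flip[of z] elab_pos[of z] by auto
  have e: "elab n w p \<longleftrightarrow> w p > 0" "elab n (w \<circ> gen i) p \<longleftrightarrow> \<not> w p > 0"
    using elab_pos[OF pr(1)] flip[of p] pr by auto
  show "\<not> elab n w p \<and> elab n (w \<circ> gen i) p \<or> p = 1 \<and> elab n w p \<and> \<not> elab n (w \<circ> gen i) p"
  proof (cases "i = 0")
    case True
    then have "p = 1" by (simp add: lo_def)
    then show ?thesis using e by auto
  next
    case False
    then have "p = lo i" by (simp add: lo_def)
    then show ?thesis using e up by auto
  qed
qed

lemma half_matching_step: "half_matching (2 * int n) (elab n (w \<circ> gen i)) (surgery p r \<pi>)"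
  by (rule half_matching_surgery[OF hm pr(1-3) _ elab_at_step(1,2,4)]) (rule elab_at_step(3))

text \<open>\<open>u\<close> and \<open>w\<close> have the same signs at \<open>p\<close> and
  \<open>r\<close>, and \<open>gen i\<close> flips the signs of either element at exactly these two
  points.\<close>

lemma diff_pts_step:
  assumes u: "u \<in> W n" "u (lo i) < 0" "0 < u (hi i)"
  shows "p \<notin> diff_pts w u" "r \<notin> diff_pts w u"
    and "diff_pts w (u \<circ> gen i) = diff_pts w u \<union> {p, r}"
    and "diff_pts (w \<circ> gen i) u = diff_pts w u \<union> {p, r}"
    and "diff_pts (w \<circ> gen i) (u \<circ> gen i) = diff_pts w u"
proof -
  have ne: "(w (lo i) > 0) \<noteq> (w (hi i) > 0)" "(u (lo i) > 0) \<noteq> (u (hi i) > 0)" using up u by auto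
  note flip = sign_flip[OF w ne(1)] sign_flip[OF u(1) ne(2)]
  have "w p > 0 \<longleftrightarrow> u p > 0"
  proof (cases "lo i > 0")
    case False
    then have "p = - lo i" by simp
    then show ?thesis using W_minus[OF w, of "lo i"] W_minus[OF u(1), of "lo i"] up u by simp
  qed (use up u in simp)
  moreover have "w r > 0 \<longleftrightarrow> u r > 0" using up u by simp
  ultimately have same: "w z > 0 \<longleftrightarrow> u z > 0" if "z \<in> {p, r}" for z using that by auto
  show "p \<notin> diff_pts w u" "r \<notin> diff_pts w u" using same by (auto simp: diff_pts_eq)
  have in1: "1 \<le> z \<and> z \<le> int n" if "z \<in> {p, r}" for z using that pr by auto
  show "diff_pts w (u \<circ> gen i) = diff_pts w u \<union> {p, r}"
    "diff_pts (w \<circ> gen i) u = diff_pts w u \<union> {p, r}"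
    "diff_pts (w \<circ> gen i) (u \<circ> gen i) = diff_pts w u"
    unfolding diff_pts_eq set_eq_iff Un_iff mem_Collect_eq using same in1 flip by (smt (verit) insert_iff singletonD)+
qed

text \<open>The right-hand side is that of \<open>Phi_Cs\<close>. Adding \<open>p\<close> and
  \<open>r\<close> to a difference set multiplies its monomial by q, and by
  \<open>closed_surgery_iff\<close> at most one of the two old coefficients is nonzero.\<close>

lemma KLcoef_step:
  assumes v: "v \<in> W n"
  shows "KLcoef (w \<circ> gen i) (surgery p r \<pi>) v =
    (if v (lo i) < 0 \<and> 0 < v (hi i) then KLcoef w \<pi> (v \<circ> gen i) + qq * KLcoef w \<pi> v
     else if 0 < v (lo i) \<and> v (hi i) < 0 then KLcoef w \<pi> (v \<circ> gen i) + qinv * KLcoef w \<pi> v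
     else 0)"
proof -
  have nz: "v (lo i) \<noteq> 0" "v (hi i) \<noteq> 0" using W_eq_0_iff[OF v] lo_hi[of i] by auto
  have inv: "\<forall>z\<in>pts. \<pi> z \<in> pts \<and> \<pi> z \<noteq> z \<and> \<pi> (\<pi> z) = z"
    using half_matchingD(1-3)[OF hm] by blast
  have "p \<noteq> r" using pr by auto
  have "\<pi> p \<noteq> r" using half_matchingD(4)[OF hm pr(1)] elab_at_step(1) pr(3) by auto
  have key: "KLcoef (w \<circ> gen i) (surgery p r \<pi>) u = KLcoef w \<pi> (u \<circ> gen i) + qq * KLcoef w \<pi> u"
    "KLcoef (w \<circ> gen i) (surgery p r \<pi>) (u \<circ> gen i) = KLcoef w \<pi> u + qinv * KLcoef w \<pi> (u \<circ> gen i)"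
    if u: "u \<in> W n" "u (lo i) < 0" "0 < u (hi i)" for u
  proof -
    define D where "D = diff_pts w u"
    note D = diff_pts_step[OF u, folded D_def]
    have "finite D" "D \<subseteq> pts" using finite_diff_pts diff_pts_subset by (auto simp: D_def)
    note cl = closed_surgery_iff[OF inv pr(1,2) \<open>p \<noteq> r\<close> \<open>\<pi> p \<noteq> r\<close> \<open>D \<subseteq> pts\<close> D(1,2)]
    define A B where "A \<longleftrightarrow> \<pi> ` D \<subseteq> D" and "B \<longleftrightarrow> \<pi> ` (D \<union> {p, r}) \<subseteq> D \<union> {p, r}"
    have "card (D \<union> {p, r}) = card D + 2"
      using D(1,2) \<open>finite D\<close> \<open>p \<noteq> r\<close> by simp
    then have q: "qpow (int (card (D \<union> {p, r})) div 2) = qq * qpow (int (card D) div 2)"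
      unfolding qq_def qpow_add[symmetric] by (intro arg_cong[of _ _ qpow]) presburger
    have split1: "(if A \<or> B then qq * X else 0) = (if B then qq * X else 0) + qq * (if A then X else 0)"
      and split2: "(if A \<or> B then X else 0) = (if A then X else 0) + qinv * (if B then qq * X else 0)" for X
      using cl(2)[folded A_def B_def] by (cases A; cases B; simp)+
    show "KLcoef (w \<circ> gen i) (surgery p r \<pi>) u = KLcoef w \<pi> (u \<circ> gen i) + qq * KLcoef w \<pi> u"
      "KLcoef (w \<circ> gen i) (surgery p r \<pi>) (u \<circ> gen i) = KLcoef w \<pi> u + qinv * KLcoef w \<pi> (u \<circ> gen i)"
      unfolding KLcoef_def D(3-5) D_def[symmetric] cl(3) cl(1) A_def[symmetric] B_def[symmetric] q
      by (rule split1, rule split2)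
  qed
  consider "v (lo i) < 0" "0 < v (hi i)" | "0 < v (lo i)" "v (hi i) < 0" | "v (lo i) > 0 \<longleftrightarrow> v (hi i) > 0"
    using nz by linarith
  then show ?thesis
  proof cases
    case 1
    then show ?thesis using key(1)[OF v] by simp
  next
    case 2
    then show ?thesis using key(2)[of "v \<circ> gen i"] v i by (simp add: comp_gen_W_iff)
  next
    case 3
    have ne: "(w (lo i) > 0) \<noteq> (w (hi i) > 0)" using up by auto
    have "(v p > 0 \<longleftrightarrow> w p > 0) \<longleftrightarrow> (v (lo i) > 0 \<longleftrightarrow> w (lo i) > 0)"
    proof (cases "lo i > 0")
      case False
      then have "p = - lo i" by simp
      then show ?thesis using W_minus[OF w, of "lo i"] W_minus[OF v, of "lo i"] up nz by auto
    qed simp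
    \<comment> \<open>The signs of \<open>v\<close> at \<open>lo i\<close> and \<open>hi i\<close>
      agree and those of \<open>w \<circ> gen i\<close> differ, so exactly one of the two points is
      a difference, whereas the surgery joins them.\<close>
    then have pd: "p \<in> diff_pts (w \<circ> gen i) v \<longleftrightarrow> r \<notin> diff_pts (w \<circ> gen i) v"
      using sign_flip[OF w ne, of p] sign_flip[OF w ne, of r] pr 3 up unfolding diff_pts_eq by auto
    have S: "surgery p r \<pi> p = r" "surgery p r \<pi> r = p"
      using bspec[OF inv pr(1)] bspec[OF inv pr(2)] \<open>\<pi> p \<noteq> r\<close> \<open>p \<noteq> r\<close>
      by (auto simp: surgery_def)
    have "\<not> surgery p r \<pi> ` diff_pts (w \<circ> gen i) v \<subseteq> diff_pts (w \<circ> gen i) v"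
      using pd S by (metis image_subset_iff)
    then have "KLcoef (w \<circ> gen i) (surgery p r \<pi>) v = 0" by (simp add: KLcoef_def)
    moreover have "\<not> (v (lo i) < 0 \<and> 0 < v (hi i))" "\<not> (0 < v (lo i) \<and> v (hi i) < 0)" using 3 by auto
    ultimately show ?thesis by (simp only: if_False)
  qed
qed

end

lemma diff_pts_self [simp]: "diff_pts w w = {}"
  by (simp add: diff_pts_def)

lemma diff_pts_empty_iff:
  assumes "v \<in> Wp n" "w \<in> Wp n"
  shows "diff_pts w v = {} \<longleftrightarrow> v = w"
proof
  assume "diff_pts w v = {}"
  then have "same_signs v w"
    by (intro same_signsI Wp_W assms) (auto simp: diff_pts_eq)
  then show "v = w" using Wp_unique assms by blast
qed simp

text \<open>For the identity the points up to n are labeled + and the later ones -, so all cups are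
  nested around the midpoint and none is dotted.\<close>

lemma half_matching_id: "half_matching (2 * int n) (elab n id) (\<lambda>x. 2 * int n + 1 - x)"
  unfolding half_matching_def by (auto simp: elab_pos) presburger

text \<open>\<open>h\<close> is the product of the C_s along a chain from the identity to
  \<open>w\<close> inside W^p, and \<open>\<pi>\<close> results from the corresponding
  surgeries.\<close>

lemma exists_bar_invariant:
  assumes "w \<in> Wp n"
  shows "\<exists>\<pi> h. half_matching (2 * int n) (elab n w) \<pi> \<and> h \<in> Hset n \<and> hbar n h = h \<and>
    (\<forall>v\<in>Wp n. Phi h v = (- qq) ^ len n v * KLcoef w \<pi> v)"
  using assms
proof (induction rule: Wp_induct)
  case id
  define \<pi> where "\<pi> = (\<lambda>x. 2 * int n + 1 - x)"
  have "Phi (Hb id) v = (- qq) ^ len n v * KLcoef id \<pi> v" if v: "v \<in> Wp n" for v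
  proof (cases "v = id")
    case True
    then show ?thesis by (simp add: Phi_Hb KLcoef_def)
  next
    case False
    then obtain x where x: "x \<in> diff_pts id v" using diff_pts_empty_iff[OF v id_Wp] by auto
    \<comment> \<open>Differences occur only at points up to n, while \<open>\<pi>\<close> exchanges
      the two halves of 1, ..., 2n.\<close>
    then have "\<pi> x \<notin> diff_pts id v" by (auto simp: diff_pts_eq \<pi>_def)
    then have "KLcoef id \<pi> v = 0" using x by (auto simp: KLcoef_def)
    moreover have "\<not> same_signs v id" using False Wp_unique[OF v id_Wp] by auto
    ultimately show ?thesis by (simp add: Phi_Hb)
  qed
  moreover have "half_matching (2 * int n) (elab n id) \<pi>" unfolding \<pi>_def by (rule half_matching_id)
  moreover have "Hb id \<in> Hset n" "hbar n (Hb id) = Hb id" by (simp_all add: hbar_Hb Hb_Hset)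
  ultimately show ?case by blast
next
  case (gen w i)
  then obtain \<pi> h where IH: "half_matching (2 * int n) (elab n w) \<pi>" "h \<in> Hset n" "hbar n h = h"
    "\<And>v. v \<in> Wp n \<Longrightarrow> Phi h v = (- qq) ^ len n v * KLcoef w \<pi> v" by blast
  note wW = Wp_W[OF gen(1)]
  define \<pi>' h' where "\<pi>' = surgery \<bar>lo i\<bar> (hi i) \<pi>" and "h' = hmul n h (Cs i)"
  have "half_matching (2 * int n) (elab n (w \<circ> gen i)) \<pi>'"
    unfolding \<pi>'_def by (rule half_matching_step[OF wW gen(2-4) IH(1)])
  moreover have "h' \<in> Hset n" "hbar n h' = h'"
    using hbar_Cs_right[OF gen(2) IH(2)] IH(2,3) hmul_Hset by (simp_all add: h'_def)
  moreover have "Phi h' v = (- qq) ^ len n v * KLcoef (w \<circ> gen i) \<pi>' v" if "v \<in> Wp n" for v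
    using Phi_Cs[OF that gen(2) IH(2,4)] KLcoef_step[OF wW gen(2-4) IH(1) Wp_W[OF that]]
    by (simp only: h'_def \<pi>'_def)
  ultimately show ?case by blast
qed

theorem nKL_eq:
  assumes v: "v \<in> Wp n" and w: "w \<in> Wp n"
  shows "(oriented n v w \<longrightarrow> even (cl n v w) \<and> nKL n v w = qpow (int (cl n v w) div 2)) \<and>
    (\<not> oriented n v w \<longrightarrow> nKL n v w = 0)"
proof -
  obtain \<pi> h where hm: "half_matching (2 * int n) (elab n w) \<pi>" and h: "h \<in> Hset n" "hbar n h = h"
    and Phi: "\<And>v. v \<in> Wp n \<Longrightarrow> Phi h v = (- qq) ^ len n v * KLcoef w \<pi> v"
    using exists_bar_invariant[OF w] by blast
  define m where "m = (\<lambda>v. if v \<in> Wp n then KLcoef w \<pi> v else 0)"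
  have even: "even (card (diff_pts w v))" if "\<pi> ` diff_pts w v \<subseteq> diff_pts w v" for v
    by (rule even_card_involution[where f = \<pi>, OF finite_diff_pts])
       (use that half_matchingD(2,3)[OF hm] diff_pts_subset in blast)
  have "nKL n v w = m v"
  proof (rule nKL_eqI[OF w h])
    show "coeffs_on n m" by (simp add: coeffs_on_def m_def)
    show "Phi h v = (- qq) ^ len n v * m v" if "v \<in> Wp n" for v using Phi[OF that] that by (simp add: m_def)
    show "m w = 1" using w by (simp add: m_def KLcoef_def)
    show "in_qZq (m u)" if u: "u \<in> Wp n" "u \<noteq> w" for u
    proof (cases "\<pi> ` diff_pts w u \<subseteq> diff_pts w u")
      case True
      have "card (diff_pts w u) \<noteq> 0" using diff_pts_empty_iff[OF u(1) w] u(2) finite_diff_pts by simp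
      \<comment> \<open>A nonempty difference set of even size has at least two points, which makes
        the exponent positive.\<close>
      then have "int (card (diff_pts w u)) div 2 > 0" using even[OF True] by (auto elim!: evenE)
      then show ?thesis using u True in_qZq_qpow by (simp add: m_def KLcoef_def)
    next
      case False
      then show ?thesis using in_qZq_0 by (simp add: m_def KLcoef_def)
    qed
  qed
  then show ?thesis
    using oriented_iff[OF Wp_W[OF w] hm Wp_W[OF v]] cl_eq[OF Wp_W[OF w] hm Wp_W[OF v]] even[of v] v
    by (simp add: m_def KLcoef_def)
qed

end

theorem theorem2p10:
  fixes n :: nat and v w :: sperm
  assumes "4 \<le> n" and "v \<in> Wp n" and "w \<in> Wp n"
  shows "(oriented n v w \<longrightarrow> even (cl n v w) \<and> nKL n v w = qpow (int (cl n v w) div 2))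
       \<and> (\<not> oriented n v w \<longrightarrow> nKL n v w = 0)"
proof -
  interpret type_D n using assms(1) by unfold_locales simp
  show ?thesis using assms(2,3) by (rule nKL_eq)
qed

end
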